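(* Let $k\ge 2$ be an integer, let $\mathcal{H}$ be an affine hyperplane in $\mathbb{R}^k$ with normal vector $(1,\alpha_2,\ldots,\alpha_k)$, and let $\mu$ be the induced Lebesgue probability measure on $\mathcal{H}\cap[0,1)^k$. Let $\psi:\mathbb{N}\to[0,1)$ be a non-increasing function with $\sum_{n=1}^\infty \psi(n)(\log n)^{k-1}=\infty$, and let $\mathbf{y}\in\mathbb{R}^k$. Assume that \[ k > 4 + 2\max\{\omega^*(\alpha_i,\alpha_j): 2\le i<j\le k\}. \] Then $\mu(W_k^\times(\psi,\mathbf{y}))=1$.
   Context: For $x \in \mathbb{R}$, $\|x\|$ denotes the distance from $x$ to the nearest integer. For $\psi:\mathbb{N}\to[0,1)$ and $\mathbf{y}\in\mathbb{R}^k$, $W_k^\times(\psi,\mathbf{y})$ is the set of $\mathbf{x}\in[0,1)^k$ such that $\|nx_1-y_1\|\cdots\|nx_k-y_k\|<\psi(n)$ holds for infinitely many $n\in\mathbb{N}$. The dual exponent of $\mathbf{x}\in\mathbb{R}^d$ is $\omega^*(\mathbf{x})=\sup\{w: \|\mathbf{n}\cdot\mathbf{x}\|<\|\mathbf{n}\|_\infty^{-w}\text{ for infinitely many }\mathbf{n}\in\mathbb{Z}^d\}$. *)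

theory Defs
  imports "HOL-Probability.Probability"
begin

text \<open>
  Points of \<open>\<real>\<^sup>k\<close> are functions \<open>x :: nat \<Rightarrow> real\<close> that are
  extensional on \<open>{1..k}\<close>, i.e. elements of the space of \<open>Pi\<^sub>M {1..k} (\<lambda>_. borel)\<close>.
  The coefficients \<open>\<alpha> i\<close> matter only for \<open>2 \<le> i \<le> k\<close>, the shifts \<open>y i\<close> only
  for \<open>1 \<le> i \<le> k\<close>.
\<close>

definition nearest_int_dist :: "real \<Rightarrow> real" where
  "nearest_int_dist x = \<bar>x - of_int (round x)\<bar>"

definition half_open_cube :: "nat \<Rightarrow> (nat \<Rightarrow> real) set" where
  "half_open_cube k = (\<Pi>\<^sub>E i\<in>{1..k}. {0..<1})"

text \<open>Only the values of \<open>\<psi>\<close> at positive integers are used.\<close>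

definition W_times ::
  "nat \<Rightarrow> (nat \<Rightarrow> real) \<Rightarrow> (nat \<Rightarrow> real) \<Rightarrow> (nat \<Rightarrow> real) set" where
  "W_times k \<psi> y = {x \<in> half_open_cube k.
     infinite {n. n \<ge> 1 \<and> (\<Prod>i=1..k. nearest_int_dist (real n * x i - y i)) < \<psi> n}}"

text \<open>
  A vector of \<open>\<real>\<^sup>d\<close> with \<open>d \<ge> 1\<close> is here a list of length \<open>d\<close>. The supremum is taken in
  the extended reals, since it may be infinite. The zero vector, for which the right-hand
  side below is \<open>0\<close> in HOL, does not affect whether there are infinitely many solutions.
\<close>

definition dual_exponent :: "real list \<Rightarrow> ereal" where
  "dual_exponent xs = Sup {ereal w | w :: real.
     infinite {ns :: int list. length ns = length xs \<and>
       nearest_int_dist (\<Sum>i<length xs. of_int (ns ! i) * xs ! i)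
         < of_int (Max (abs ` set ns)) powr (- w)}}"

text \<open>
  For \<open>k = 2\<close> there are no pairs and the maximum is read as \<open>0\<close>. For \<open>k \<ge> 3\<close> the inserted
  \<open>0\<close> changes nothing, because dual exponents are nonnegative (\<open>w = 0\<close> is always admissible).
\<close>

definition max_pair_exponent :: "nat \<Rightarrow> (nat \<Rightarrow> real) \<Rightarrow> ereal" where
  "max_pair_exponent k \<alpha> =
     Max (insert 0 {dual_exponent [\<alpha> i, \<alpha> j] | i j. 2 \<le> i \<and> i < j \<and> j \<le> k})"

text \<open>The affine hyperplanes with normal vector \<open>(1, \<alpha>\<^sub>2, \<dots>, \<alpha>\<^sub>k)\<close>, indexed by the offset \<open>c\<close>.\<close>

definition hyperplane :: "nat \<Rightarrow> (nat \<Rightarrow> real) \<Rightarrow> real \<Rightarrow> (nat \<Rightarrow> real) set" where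
  "hyperplane k \<alpha> c =
     {x \<in> (\<Pi>\<^sub>E i\<in>{1..k}. UNIV). x 1 + (\<Sum>i=2..k. \<alpha> i * x i) = c}"

text \<open>
  The \<open>(k-1)\<close>-dimensional Lebesgue measure of the hyperplane, as a Borel measure on \<open>\<real>\<^sup>k\<close>.
  The hyperplane is the graph of \<open>(x\<^sub>2, \<dots>, x\<^sub>k) \<mapsto> c - \<Sum>i. \<alpha> i * x i\<close>, and the
  scaling factor is the surface element \<open>sqrt (1 + |grad|\<^sup>2)\<close> of that graph.
\<close>

definition hyperplane_lebesgue ::
  "nat \<Rightarrow> (nat \<Rightarrow> real) \<Rightarrow> real \<Rightarrow> (nat \<Rightarrow> real) measure" where
  "hyperplane_lebesgue k \<alpha> c =
     scale_measure (ennreal (sqrt (1 + (\<Sum>i=2..k. (\<alpha> i)\<^sup>2))))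
       (distr (\<Pi>\<^sub>M i\<in>{2..k}. lborel) (\<Pi>\<^sub>M i\<in>{1..k}. borel)
          (\<lambda>x. x(1 := c - (\<Sum>i=2..k. \<alpha> i * x i))))"

text \<open>This is a probability measure precisely when the section has positive measure.\<close>

definition induced_probability ::
  "nat \<Rightarrow> (nat \<Rightarrow> real) \<Rightarrow> real \<Rightarrow> (nat \<Rightarrow> real) measure" where
  "induced_probability k \<alpha> c =
     uniform_measure (hyperplane_lebesgue k \<alpha> c) (hyperplane k \<alpha> c \<inter> half_open_cube k)"

end

theory Submission
  imports Defs "HOL-Real_Asymp.Real_Asymp"
begin

text \<open>
  Idea: a second moment argument with exact Fourier supports. Parametrise the hyperplane by
  \<open>x\<^sub>2, \<dots>, x\<^sub>k\<close>. The multiplicative condition contains all boxes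
  \<open>\<parallel>n x\<^sub>i - y\<^sub>i\<parallel> < k 4\<^bsup>-a\<^sub>i\<^esup>\<close> with \<open>4\<^bsup>a\<^sub>1 + \<dots> + a\<^sub>k\<^esup>\<close> of size
  \<open>1/\<psi>(n)\<close>, and already the roughly balanced ones, \<open>4\<^bsup>a\<^sub>i\<^esup> \<le> n\<^bsup>\<tau>\<^esup>\<close> with \<open>\<tau>\<close> slightly larger than
  \<open>1/k\<close>, number a positive proportion of \<open>(log n)\<^bsup>k-1\<^esup>\<close>. Each box indicator is minorised by a
  trigonometric polynomial of degree \<open>O(4\<^bsup>a\<^sub>i\<^esup>)\<close>. Their sum over \<open>n\<close> has variance at most a
  constant times its mean, with respect to a positive weight whose Fourier transform has
  compact support; as the mean diverges, the sum is unbounded almost everywhere.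

  The variance counts pairs of nonzero integer vectors \<open>t, s\<close> for which \<open>u = n t - m s\<close> satisfies
  \<open>\<bar>u\<^sub>i - \<alpha>\<^sub>i u\<^sub>1\<bar> < 1\<close>. Eliminating \<open>n\<close> and \<open>m\<close> makes every expression
  \<open>N\<^sub>0 - \<alpha>\<^sub>i N\<^sub>1 - \<alpha>\<^sub>j N\<^sub>2\<close> in the \<open>2 \<times> 2\<close> minors of \<open>(t, s)\<close> smaller than the bound coming from the
  dual exponent of \<open>(\<alpha>\<^sub>i, \<alpha>\<^sub>j)\<close>, so \<open>t\<close> and \<open>s\<close> are parallel. Parallel pairs with \<open>u \<noteq> 0\<close> are few by
  the same Diophantine bound, and those with \<open>u = 0\<close> are treated as for Lebesgue measure on the
  cube.
\<close>

text \<open>The hypothesis on k is a condition on \<tau>, where B = n^\<tau> is the size of the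
  frequencies. From below, \<tau> > 1/k: k powers of 4 whose product is at least n cannot all stay
  below n^(1/k). From above, with w slightly larger than the dual exponents: a minor relation has
  error B/n and must beat the Diophantine bound at height B^2, which asks for \<tau>(1 + 2w) < 1;
  the off-diagonal pairs number about B^(3 + w) and carry weights B/n, which asks for \<tau>(4 + w)
  < 1; the degenerate pairs on the diagonal ask for \<tau>(k - 1) < 1. If k > 4 + 2w, there is room
  for 1/k < \<tau> < 1/(4 + 2w). Boxes that are far from balanced are given up because their
  frequencies leave this range. The indicator of the cube would be a poor test function: its
  transform decays slowly and couples all pairs of frequencies. Only null sets matter in the end, so
  any everywhere positive integrable weight may replace it, and a band-limited one reduces the
  variance to a pure counting problem.\<close>

section \<open>A positive weight with compactly supported Fourier transform\<close>

text \<open>The Fejer kernel of the real line up to a constant; its Fourier transform is a triangle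
  on [-1, 1]. At 0 the division yields 0 and not the limit 1/2, so 0 is one of its zeros.\<close>

definition fejer_density :: "real \<Rightarrow> real" where
  "fejer_density x = (1 - cos x) / x\<^sup>2"

lemma fejer_density_nonneg: "0 \<le> fejer_density x"
  by (simp add: fejer_density_def)

lemma borel_measurable_fejer_density [measurable]: "fejer_density \<in> borel_measurable borel"
  unfolding fejer_density_def by measurable

lemma fejer_density_le: "fejer_density x \<le> 4 * inverse (1 + x\<^sup>2)"
proof (cases "\<bar>x\<bar> \<le> 1")
  case True
  have "1 - cos x \<le> x\<^sup>2 / 2"
  proof -
    have "1 - cos x = 2 * (sin (x / 2))\<^sup>2"
      using cos_double_sin[of "x / 2"] by simp
    also have "... \<le> 2 * (x / 2)\<^sup>2"
      using abs_sin_x_le_abs_x[of "x / 2"] by (metis abs_le_square_iff mult_le_cancel_left_pos zero_less_numeral)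
    finally show ?thesis by (simp add: power_divide)
  qed
  hence "fejer_density x \<le> 1/2"
    unfolding fejer_density_def by (cases "x = 0") (auto simp: field_simps)
  moreover have "x\<^sup>2 \<le> 1" using True abs_square_le_1 by blast
  hence "1/2 \<le> 4 * inverse (1 + x\<^sup>2)" by (simp add: field_simps add_pos_nonneg)
  ultimately show ?thesis by linarith
next
  case False
  hence x: "1 < x\<^sup>2" by (metis abs_square_le_1 linorder_not_le)
  have "1 - cos x \<le> 2" using cos_ge_minus_one[of x] by linarith
  hence "fejer_density x \<le> 2 / x\<^sup>2"
    unfolding fejer_density_def by (intro divide_right_mono) auto
  also have "... \<le> 4 * inverse (1 + x\<^sup>2)" 
  proof -
    have "2 * (1 + x\<^sup>2) \<le> 4 * x\<^sup>2" using x by simp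
    thus ?thesis using x by (simp add: divide_simps) 
  qed
  finally show ?thesis .
qed

lemma integrable_fejer_density: "integrable lborel fejer_density"
proof -
  have "integrable lborel (\<lambda>x::real. inverse (1 + x\<^sup>2))"
    using integrable_inverse_1_plus_square by (simp add: set_integrable_def einterval_def)
  hence "integrable lborel (\<lambda>x::real. 4 * inverse (1 + x\<^sup>2))" by simp
  thus ?thesis
    by (rule Bochner_Integration.integrable_bound)
       (auto simp: fejer_density_nonneg intro!: fejer_density_le)
qed

lemma Si_scaled_limit:
  assumes "0 \<le> a"
  shows "((\<lambda>T. a * Si (a * T)) \<longlongrightarrow> a * pi / 2) at_top"
proof (cases "a = 0")
  case False
  hence "filterlim (\<lambda>T. a * T) at_top at_top"
    using assms by (intro filterlim_tendsto_pos_mult_at_top[OF tendsto_const]) (auto simp: filterlim_ident)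
  from filterlim_compose[OF Si_at_top this] have "((\<lambda>T. Si (a * T)) \<longlongrightarrow> pi / 2) at_top" .
  from tendsto_mult_left[OF this, of a] show ?thesis by simp
qed simp

text \<open>By the addition theorem the numerator is, up to the factor -1/2, a second difference of
  cosines with frequencies \<xi> - 1, \<xi>, \<xi> + 1. One integration by parts gives an
  antiderivative \<open>G\<close> made of sine integrals. As a * Si(aT) tends to a * pi/2 for a
  \<ge> 0, the limit of \<open>G\<close> is a second difference of a linear function, that is, 0;
  the condition 1 \<le> \<xi> keeps all three frequencies nonnegative.\<close>

lemma fejer_cos_integral_zero:
  assumes "1 \<le> \<xi>"
  shows "(\<integral>x. fejer_density x * cos (\<xi> * x) \<partial>lborel) = 0"
proof -
  define f where "f x = fejer_density x * cos (\<xi> * x)" for x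
  define \<Phi> where "\<Phi> x = cos (\<xi> * x) - cos ((\<xi> + 1) * x) / 2 - cos ((\<xi> - 1) * x) / 2" for x
  define G where "G x = - \<Phi> x / x - \<xi> * Si (\<xi> * x) + (\<xi> + 1) * Si ((\<xi> + 1) * x) / 2
      + (\<xi> - 1) * Si ((\<xi> - 1) * x) / 2" for x
  have f\<Phi>: "f x = \<Phi> x / x\<^sup>2" for x
    unfolding f_def \<Phi>_def fejer_density_def by (simp add: algebra_simps cos_add cos_diff add_divide_distrib diff_divide_distrib)
  have sinc_eq: "a * sinc (a * x) = sin (a * x) / x" if "x \<noteq> 0" for a x :: real
    using that by auto
  have dG: "(G has_real_derivative f x) (at x)" if x: "x \<noteq> 0" for x
  proof -
    have S: "((\<lambda>x. a * Si (a * x)) has_real_derivative a * (sin (a * x) / x)) (at x)" for a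
    proof -
      have "((\<lambda>x. a * Si (a * x)) has_real_derivative a * (sinc (a * x) * a)) (at x)"
        by (intro DERIV_cmult DERIV_chain2[OF DERIV_Si]) (auto intro!: derivative_eq_intros)
      thus ?thesis using sinc_eq[OF x, of a] by (simp add: mult.commute)
    qed
    have d\<Phi>: "((\<lambda>x. - \<Phi> x / x) has_real_derivative
       (\<xi> * sin (\<xi> * x) - (\<xi> + 1) * sin ((\<xi> + 1) * x) / 2 - (\<xi> - 1) * sin ((\<xi> - 1) * x) / 2) / x
        + \<Phi> x / x\<^sup>2) (at x)"
      unfolding \<Phi>_def using x
      by (auto intro!: derivative_eq_intros simp: field_simps power2_eq_square)
    have "(G has_real_derivative
       ((\<xi> * sin (\<xi> * x) - (\<xi> + 1) * sin ((\<xi> + 1) * x) / 2 - (\<xi> - 1) * sin ((\<xi> - 1) * x) / 2) / x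
        + \<Phi> x / x\<^sup>2) - \<xi> * (sin (\<xi> * x) / x) + (\<xi> + 1) * (sin ((\<xi> + 1) * x) / x) / 2
      + (\<xi> - 1) * (sin ((\<xi> - 1) * x) / x) / 2) (at x)"
      unfolding G_def by (intro DERIV_add DERIV_diff DERIV_cdivide S d\<Phi>)
    moreover have "((\<xi> * sin (\<xi> * x) - (\<xi> + 1) * sin ((\<xi> + 1) * x) / 2 - (\<xi> - 1) * sin ((\<xi> - 1) * x) / 2) / x
        + \<Phi> x / x\<^sup>2) - \<xi> * (sin (\<xi> * x) / x) + (\<xi> + 1) * (sin ((\<xi> + 1) * x) / x) / 2
      + (\<xi> - 1) * (sin ((\<xi> - 1) * x) / x) / 2 = f x"
      using x by (simp add: f\<Phi> diff_divide_distrib add_divide_distrib)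
    ultimately show ?thesis by simp
  qed
  have \<Phi>0: "(\<lambda>x. \<Phi> x / x) \<midarrow>0\<rightarrow> 0"
  proof -
    have "(\<Phi> has_real_derivative 0) (at 0)"
      unfolding \<Phi>_def by (auto intro!: derivative_eq_intros)
    thus ?thesis by (simp add: has_field_derivative_iff \<Phi>_def)
  qed
  have contG: "isCont G x" for x
  proof (cases "x = 0")
    case True
    have "isCont (\<lambda>x. Si (a * x)) 0" for a
      by (intro isCont_o2[OF _ isCont_Si]) auto
    hence S: "(\<lambda>x. Si (a * x)) \<midarrow>0\<rightarrow> Si 0" for a
      using isContD[of 0 "\<lambda>x. Si (a * x)"] by simp
    have Si0: "Si 0 = 0" using Si_neg[of 0] by simp
    have "G \<midarrow>0\<rightarrow> - 0 - \<xi> * Si 0 + (\<xi> + 1) * Si 0 / 2 + (\<xi> - 1) * Si 0 / 2"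
      unfolding G_def minus_divide_left[symmetric] by (intro tendsto_intros \<Phi>0 S) auto
    thus ?thesis using True by (simp add: isCont_def Si0 G_def)
  next
    case False
    thus ?thesis using dG DERIV_isCont by blast
  qed
  have Godd: "G (- x) = - G x" if "0 \<le> x" for x
    unfolding G_def using that assms Si_neg[of "\<xi> * x"] Si_neg[of "(\<xi> + 1) * x"] Si_neg[of "(\<xi> - 1) * x"]
    by (simp add: \<Phi>_def)
  have [measurable]: "f \<in> borel_measurable borel"
    unfolding f_def by measurable
  have f_int: "integrable lborel f"
    unfolding f_def
    by (rule Bochner_Integration.integrable_bound[OF integrable_fejer_density])
       (auto simp: fejer_density_nonneg abs_mult intro!: mult_left_le)
  have part: "(\<integral>x. indicator {-T..T} x *\<^sub>R f x \<partial>lborel) = 2 * G T" if "0 \<le> T" for T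
  proof -
    \<comment> \<open>At 0 only the continuity of \<open>G\<close> is used: \<open>f 0\<close> is
      the default value 0, which is not the derivative of \<open>G\<close> there.\<close>
    have "(f has_integral (G T - G (-T))) {-T..T}"
      using that dG
      by (intro fundamental_theorem_of_calculus_strong[of "{0}"])
         (auto simp: has_real_derivative_iff_has_vector_derivative[symmetric]
               intro!: continuous_at_imp_continuous_on contG)
    moreover have "set_integrable lborel {-T..T} f"
      unfolding set_integrable_def using f_int by (intro integrable_mult_indicator) auto
    ultimately show ?thesis
      using set_borel_integral_eq_integral(2)[of "{-T..T}" f] Godd[OF that]
      by (simp add: set_lebesgue_integral_def integral_unique)
  qed
  have "((\<lambda>T. \<integral>x. indicator {-T..T} x *\<^sub>R f x \<partial>lborel) \<longlongrightarrow> (\<integral>x. f x \<partial>lborel)) at_top"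
  proof (rule integral_dominated_convergence_at_top[where w = "\<lambda>x. \<bar>f x\<bar>"])
    show "AE x in lborel. ((\<lambda>T. indicator {- T..T} x *\<^sub>R f x) \<longlongrightarrow> f x) at_top"
    proof (intro AE_I2 tendsto_eventually)
      fix x :: real
      show "\<forall>\<^sub>F T in at_top. indicator {- T..T} x *\<^sub>R f x = f x"
        using eventually_ge_at_top[of "\<bar>x\<bar>"] by eventually_elim (auto simp: indicator_def)
    qed
    show "integrable lborel (\<lambda>x. \<bar>f x\<bar>)" using f_int by (rule integrable_abs)
  qed (auto simp: indicator_def)
  moreover have "((\<lambda>T. 2 * G T) \<longlongrightarrow> 2 * (- 0 - \<xi> * pi / 2 + ((\<xi> + 1) * pi / 2) / 2 + ((\<xi> - 1) * pi / 2) / 2)) at_top"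
  proof -
    have "((\<lambda>x. \<Phi> x / x) \<longlongrightarrow> 0) at_top"
    proof (rule Lim_null_comparison)
      show "\<forall>\<^sub>F x in at_top. norm (\<Phi> x / x) \<le> 2 / x"
        using eventually_gt_at_top[of 0]
      proof eventually_elim
        case (elim x)
        have "\<bar>\<Phi> x\<bar> \<le> 2"
          unfolding \<Phi>_def using abs_cos_le_one[of "\<xi> * x"] abs_cos_le_one[of "(\<xi> + 1) * x"]
            abs_cos_le_one[of "(\<xi> - 1) * x"] by linarith
        thus ?case using elim by (simp add: divide_right_mono)
      qed
      show "((\<lambda>x::real. 2 / x) \<longlongrightarrow> 0) at_top" by real_asymp
    qed
    thus ?thesis
      unfolding G_def minus_divide_left[symmetric] using assms
      by (intro tendsto_intros Si_scaled_limit) auto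
  qed
  hence "((\<lambda>T. 2 * G T) \<longlongrightarrow> 0) at_top" by (simp add: field_simps)
  hence "((\<lambda>T. \<integral>x. indicator {-T..T} x *\<^sub>R f x \<partial>lborel) \<longlongrightarrow> 0) at_top"
    by (rule Lim_transform_eventually)
       (use eventually_ge_at_top[of 0] in eventually_elim, rule part[symmetric])
  ultimately have "(\<integral>x. f x \<partial>lborel) = 0"
    by (intro tendsto_unique[OF _ _]) auto
  thus ?thesis by (simp add: f_def)
qed

lemma integrable_fejer_cis: "integrable lborel (\<lambda>x. of_real (fejer_density x) * cis (\<xi> * x))"
proof -
  have "integrable lborel (\<lambda>x. complex_of_real (fejer_density x))"
    using integrable_fejer_density by simp
  thus ?thesis
    by (rule Bochner_Integration.integrable_bound)
       (auto simp: norm_mult cis_conv_exp)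
qed

lemma fejer_fourier_zero:
  assumes "1 \<le> \<bar>\<xi>\<bar>"
  shows "(\<integral>x. of_real (fejer_density x) * cis (\<xi> * x) \<partial>lborel) = 0"
proof -
  let ?I = "\<integral>x. of_real (fejer_density x) * cis (\<xi> * x) \<partial>lborel"
  have "Re ?I = (\<integral>x. fejer_density x * cos (\<xi> * x) \<partial>lborel)"
    using integral_Re[OF integrable_fejer_cis[of \<xi>]] by simp
  also have "... = (\<integral>x. fejer_density x * cos (\<bar>\<xi>\<bar> * x) \<partial>lborel)"
    by (cases "0 \<le> \<xi>") auto
  also have "... = 0" by (rule fejer_cos_integral_zero[OF assms])
  finally have re: "Re ?I = 0" .
  have im: "Im ?I = (\<integral>x. fejer_density x * sin (\<xi> * x) \<partial>lborel)"
    using integral_Im[OF integrable_fejer_cis[of \<xi>]] by simp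
  also have "... = (\<integral>x. fejer_density (-x) * sin (\<xi> * (-x)) \<partial>lborel)"
    using lborel_integral_real_affine[of "-1" "\<lambda>x. fejer_density x * sin (\<xi> * x)" 0] by simp
  also have "... = - (\<integral>x. fejer_density x * sin (\<xi> * x) \<partial>lborel)"
    by (simp add: fejer_density_def)
  finally have "Im ?I = 0" using im by linarith
  with re show ?thesis by (simp add: complex_eq_iff)
qed

text \<open>The shifted summand removes the zeros of the Fejer density.\<close>

definition weight :: "real \<Rightarrow> real" where
  "weight x = fejer_density x + fejer_density (x + 1)"

text \<open>The zeros of \<open>fejer_density\<close>, with 0 among them by default, are the points
  of cosine 1. Two such points cannot differ by 1, as cos 1 is not 1.\<close>

lemma weight_pos: "0 < weight x"
proof (rule ccontr)
  assume "\<not> 0 < weight x"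
  hence "fejer_density x = 0" "fejer_density (x + 1) = 0"
    using fejer_density_nonneg[of x] fejer_density_nonneg[of "x + 1"] unfolding weight_def by linarith+
  hence *: "cos x = 1" "cos (x + 1) = 1 \<or> x + 1 = 0" by (auto simp: fejer_density_def)
  have c1: "cos (1::real) \<noteq> 1"
    using cos_monotone_0_pi[of 0 1] pi_gt3 by simp
  from *(2) show False
  proof
    assume "cos (x + 1) = 1"
    moreover have "sin x = 0" using *(1) sin_cos_squared_add[of x] by simp
    ultimately show False using *(1) c1 by (simp add: cos_add)
  next
    assume "x + 1 = 0"
    hence "x = -1" by linarith
    thus False using *(1) c1 by simp
  qed
qed

lemma borel_measurable_weight [measurable]: "weight \<in> borel_measurable borel"
  unfolding weight_def by measurable

text \<open>Translating the density by 1 multiplies its transform by the unimodular number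
  \<open>cis (- \<xi>)\<close>, so the transform still vanishes for |\<xi>| \<ge> 1.\<close>

lemma weight_fourier:
  shows integrable_weight_cis: "integrable lborel (\<lambda>x. of_real (weight x) * cis (\<xi> * x))"
    and "1 \<le> \<bar>\<xi>\<bar> \<Longrightarrow> (\<integral>x. of_real (weight x) * cis (\<xi> * x) \<partial>lborel) = 0"
proof -
  have split: "of_real (weight x) * cis (\<xi> * x) = of_real (fejer_density x) * cis (\<xi> * x)
     + cis (- \<xi>) * (of_real (fejer_density (1 + 1 * x)) * cis (\<xi> * (1 + 1 * x)))" for x
    by (simp add: weight_def cis_mult algebra_simps)
  let ?g = "\<lambda>x. of_real (fejer_density x) * cis (\<xi> * x)"
  have sh: "integrable lborel (\<lambda>x. ?g (1 + 1 * x))"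
    using lborel_integrable_real_affine[where f = ?g and c = 1 and t = 1] integrable_fejer_cis by simp
  show "integrable lborel (\<lambda>x. of_real (weight x) * cis (\<xi> * x))"
    unfolding split by (intro Bochner_Integration.integrable_add integrable_fejer_cis integrable_mult_right sh)
  assume \<xi>: "1 \<le> \<bar>\<xi>\<bar>"
  have "(\<integral>x. ?g (1 + 1 * x) \<partial>lborel) = 0"
    using lborel_integral_real_affine[of 1 ?g 1] fejer_fourier_zero[OF \<xi>] by simp
  thus "(\<integral>x. of_real (weight x) * cis (\<xi> * x) \<partial>lborel) = 0"
    unfolding split
    by (subst Bochner_Integration.integral_add)
       (auto intro!: integrable_fejer_cis integrable_mult_right sh[simplified] simp: fejer_fourier_zero[OF \<xi>])
qed

section \<open>Trigonometric minorants of boxes\<close>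

definition exp_poly :: "(nat \<Rightarrow> real) \<Rightarrow> nat \<Rightarrow> real \<Rightarrow> complex" where
  "exp_poly p M \<theta> = (\<Sum>j\<le>M. of_real (p j) * cis (2 * pi * real j * \<theta>))"

definition autocorr :: "(nat \<Rightarrow> real) \<Rightarrow> nat \<Rightarrow> int \<Rightarrow> real" where
  "autocorr p M t = (\<Sum>(j, l) \<in> {(j, l). j \<le> M \<and> l \<le> M \<and> int j - int l = t}. p j * p l)"

lemma norm_exp_poly_square:
  "of_real ((cmod (exp_poly p M \<theta>))\<^sup>2)
     = (\<Sum>t=-int M..int M. of_real (autocorr p M t) * cis (2 * pi * of_int t * \<theta>))"
proof -
  have "of_real ((cmod (exp_poly p M \<theta>))\<^sup>2) = exp_poly p M \<theta> * cnj (exp_poly p M \<theta>)"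
    by (rule complex_norm_square)
  also have "... = (\<Sum>j\<le>M. \<Sum>l\<le>M. of_real (p j * p l) * cis (2 * pi * of_int (int j - int l) * \<theta>))"
    unfolding exp_poly_def cnj_sum sum_product
  proof (intro sum.cong refl)
    fix j l
    have e: "2 * pi * of_int (int j - int l) * \<theta> = 2 * pi * real j * \<theta> + - (2 * pi * real l * \<theta>)"
      by (simp add: algebra_simps)
    show "of_real (p j) * cis (2 * pi * real j * \<theta>) * cnj (of_real (p l) * cis (2 * pi * real l * \<theta>))
        = of_real (p j * p l) * cis (2 * pi * of_int (int j - int l) * \<theta>)"
      unfolding e cis_mult[symmetric] by (simp add: cis_cnj)
  qed
  also have "... = (\<Sum>(j, l)\<in>{..M} \<times> {..M}. of_real (p j * p l) * cis (2 * pi * of_int (int j - int l) * \<theta>))"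
    by (rule sum.cartesian_product)
  also have "... = (\<Sum>t=-int M..int M. \<Sum>(j, l)\<in>{jl \<in> {..M} \<times> {..M}. int (fst jl) - int (snd jl) = t}.
      of_real (p j * p l) * cis (2 * pi * of_int (int j - int l) * \<theta>))"
    by (rule sum.group[symmetric]) auto
  also have "... = (\<Sum>t=-int M..int M. of_real (autocorr p M t) * cis (2 * pi * of_int t * \<theta>))"
  proof (intro sum.cong refl)
    fix t
    have "{jl \<in> {..M} \<times> {..M}. int (fst jl) - int (snd jl) = t} = {(j, l). j \<le> M \<and> l \<le> M \<and> int j - int l = t}"
      by auto
    moreover have "(\<Sum>(j, l)\<in>{(j, l). j \<le> M \<and> l \<le> M \<and> int j - int l = t}.
        of_real (p j * p l) * cis (2 * pi * of_int (int j - int l) * \<theta>))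
      = (\<Sum>(j, l)\<in>{(j, l). j \<le> M \<and> l \<le> M \<and> int j - int l = t}.
        of_real (p j * p l) * cis (2 * pi * of_int t * \<theta>))"
      by (intro sum.cong refl) auto
    ultimately show "(\<Sum>(j, l)\<in>{jl \<in> {..M} \<times> {..M}. int (fst jl) - int (snd jl) = t}.
      of_real (p j * p l) * cis (2 * pi * of_int (int j - int l) * \<theta>))
      = of_real (autocorr p M t) * cis (2 * pi * of_int t * \<theta>)"
      by (simp add: autocorr_def sum_distrib_right case_prod_unfold)
  qed
  finally show ?thesis .
qed

lemma autocorr_zero: "autocorr p M 0 = (\<Sum>j\<le>M. (p j)\<^sup>2)"
proof -
  have "{(j, l). j \<le> M \<and> l \<le> M \<and> int j - int l = 0} = (\<lambda>j. (j, j)) ` {..M}" by auto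
  thus ?thesis
    unfolding autocorr_def by (simp add: sum.reindex inj_on_def power2_eq_square)
qed

text \<open>Cauchy-Schwarz in the form 2|xy| \<le> x^2 + y^2: when the difference t is fixed, each
  index occurs at most once in either component.\<close>

lemma abs_autocorr_le: "\<bar>autocorr p M t\<bar> \<le> (\<Sum>j\<le>M. (p j)\<^sup>2)"
proof -
  let ?S = "{(j, l). j \<le> M \<and> l \<le> M \<and> int j - int l = t}"
  have fin: "finite ?S" by (rule finite_subset[of _ "{..M} \<times> {..M}"]) auto
  have "\<bar>autocorr p M t\<bar> \<le> (\<Sum>(j, l)\<in>?S. (p j)\<^sup>2 / 2 + (p l)\<^sup>2 / 2)"
    unfolding autocorr_def
  proof (rule order_trans[OF sum_abs], intro sum_mono)
    fix x
    have "0 \<le> (\<bar>p (fst x)\<bar> - \<bar>p (snd x)\<bar>)\<^sup>2" by simp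
    thus "\<bar>case x of (j, l) \<Rightarrow> p j * p l\<bar> \<le> (case x of (j, l) \<Rightarrow> (p j)\<^sup>2 / 2 + (p l)\<^sup>2 / 2)"
      by (simp add: case_prod_unfold power2_diff abs_mult)
  qed
  also have "... = (\<Sum>x\<in>?S. (p (fst x))\<^sup>2) / 2 + (\<Sum>x\<in>?S. (p (snd x))\<^sup>2) / 2"
    by (simp add: case_prod_unfold sum.distrib sum_divide_distrib)
  also have "(\<Sum>x\<in>?S. (p (fst x))\<^sup>2) = (\<Sum>j\<in>fst ` ?S. (p j)\<^sup>2)"
    by (subst sum.reindex) (auto simp: inj_on_def)
  also have "... \<le> (\<Sum>j\<le>M. (p j)\<^sup>2)" by (intro sum_mono2) auto
  also have "(\<Sum>x\<in>?S. (p (snd x))\<^sup>2) = (\<Sum>j\<in>snd ` ?S. (p j)\<^sup>2)"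
    by (subst sum.reindex) (auto simp: inj_on_def)
  also have "... \<le> (\<Sum>j\<le>M. (p j)\<^sup>2)" by (intro sum_mono2) auto
  finally show ?thesis by simp
qed

lemma nearest_int_dist_le: "nearest_int_dist x \<le> \<bar>x - of_int m\<bar>"
  unfolding nearest_int_dist_def by (rule round_diff_minimal)

lemma norm_cis_minus_one_ge: "2 * nearest_int_dist \<theta> \<le> cmod (1 - cis (2 * pi * \<theta>))"
proof -
  define d where "d = \<theta> - of_int (round \<theta>)"
  have d: "\<bar>d\<bar> \<le> 1/2"
    using of_int_round_abs_le[of \<theta>] by (simp add: d_def abs_minus_commute)
  have "cis (2 * pi * \<theta>) = cis (2 * pi * d) * cis (2 * pi * of_int (round \<theta>))"
    by (simp add: cis_mult d_def algebra_simps)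
  also have "cis (2 * pi * of_int (round \<theta>)) = 1" by (rule cis_multiple_2pi) auto
  finally have "cmod (1 - cis (2 * pi * \<theta>)) = cmod (exp (\<i> * of_real (2 * pi * d)) - 1)"
    by (simp add: cis_conv_exp norm_minus_commute)
  also have "... = 2 * \<bar>sin (pi * d)\<bar>" using dist_exp_i_1[of "2 * pi * d"] by simp
  also have "\<bar>sin (pi * d)\<bar> = \<bar>sin (pi * \<bar>d\<bar>)\<bar>" by (cases "d \<ge> 0") auto
  finally have eq: "cmod (1 - cis (2 * pi * \<theta>)) = 2 * \<bar>sin (pi * \<bar>d\<bar>)\<bar>" .
  \<comment> \<open>Rough numbers suffice: x \<le> 1.6 gives x^3/6 \<le> x/2, so sin x \<ge> x/2 by
    Taylor's formula, and x/2 \<ge> |d| because pi > 2.\<close>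
  define x where "x = pi * \<bar>d\<bar>"
  have x0: "0 \<le> x" by (simp add: x_def)
  have "pi \<le> 3.2" using pi_approx by simp
  hence x1: "x \<le> 1.6" using d mult_mono[of pi "3.2" "\<bar>d\<bar>" "1/2"] by (simp add: x_def)
  have "\<bar>sin x - (\<Sum>m<3. sin_coeff m * x ^ m)\<bar> \<le> inverse (fact 3) * \<bar>x\<bar> ^ 3"
    by (rule Maclaurin_sin_bound)
  moreover have "(\<Sum>m<3. sin_coeff m * x ^ m) = x"
    by (simp add: numeral_3_eq_3 sin_coeff_def)
  ultimately have "\<bar>sin x - x\<bar> \<le> x ^ 3 / 6"
    using x0 by (simp add: fact_numeral)
  hence "x - x ^ 3 / 6 \<le> sin x" by linarith
  moreover have "x ^ 3 \<le> 1.6 * 1.6 * x"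
    using x0 x1 mult_mono[of x "1.6" x "1.6"] mult_right_mono[of "x * x" "1.6 * 1.6" x] by (simp add: power3_eq_cube)
  ultimately have "x / 2 \<le> sin x" using x0 by linarith
  moreover have "2 * \<bar>d\<bar> \<le> x" using pi_gt3 by (simp add: x_def mult_right_mono)
  ultimately have "\<bar>d\<bar> \<le> sin x" by linarith
  thus ?thesis unfolding eq x_def[symmetric] by (simp add: nearest_int_dist_def d_def)
qed

text \<open>Subtraction of natural numbers makes this 0 from 2D on. Heights of order D against
  slopes of size at most 1 make the differenced tent smaller in mean square by a factor of order
  1/D^2.\<close>

definition tent :: "nat \<Rightarrow> nat \<Rightarrow> real" where
  "tent D j = real (min j (2 * D - j))"

lemma sum_tent_square_ge: "real D ^ 3 / 3 \<le> (\<Sum>j\<le>2*D+1. (tent D j)\<^sup>2)"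
proof -
  have "real D ^ 3 / 3 \<le> (\<Sum>j\<le>D. (real j)\<^sup>2)"
  proof (induction D)
    case (Suc D)
    have "real (Suc D) ^ 3 / 3 \<le> real D ^ 3 / 3 + (real (Suc D))\<^sup>2"
      by (simp add: power3_eq_cube power2_eq_square algebra_simps)
    with Suc show ?case by simp
  qed simp
  also have "... = (\<Sum>j\<le>D. (tent D j)\<^sup>2)"
    by (intro sum.cong refl) (simp add: tent_def min_def)
  also have "... \<le> (\<Sum>j\<le>2*D+1. (tent D j)\<^sup>2)" by (intro sum_mono2) auto
  finally show ?thesis .
qed

definition tent_diff :: "nat \<Rightarrow> nat \<Rightarrow> real" where
  "tent_diff D j = (if j = 0 then 0 else tent D j - tent D (j - 1))"

lemma sum_tent_diff_square_le: "(\<Sum>j\<le>2*D+1. (tent_diff D j)\<^sup>2) \<le> 2 * real D + 1"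
proof -
  have "\<bar>tent_diff D j\<bar> \<le> (if j = 0 then 0 else 1)" for j
    unfolding tent_diff_def tent_def by (cases j) (auto simp: min_def)
  hence "(tent_diff D j)\<^sup>2 \<le> (if j = 0 then 0 else 1)" for j
    using abs_square_le_1[of "tent_diff D j"] by (smt (verit) power_zero_numeral)
  hence "(\<Sum>j\<le>2*D+1. (tent_diff D j)\<^sup>2) \<le> (\<Sum>j\<le>2*D+1. if j = 0 then 0 else 1)"
    by (intro sum_mono)
  also have "... = (\<Sum>j\<in>{1..2*D+1}. 1)"
    by (rule sum.mono_neutral_cong_right) auto
  also have "... = 2 * real D + 1" by simp
  finally show ?thesis .
qed

text \<open>Summation by parts; both boundary terms vanish, because the tent is 0 at 0 and at 2D +
  1.\<close>

lemma exp_poly_tent_diff: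
  "exp_poly (tent_diff D) (2*D+1) \<theta> = (1 - cis (2 * pi * \<theta>)) * exp_poly (tent D) (2*D+1) \<theta>"
proof -
  let ?z = "\<lambda>j. cis (2 * pi * real j * \<theta>)"
  have z: "?z (Suc j) = cis (2 * pi * \<theta>) * ?z j" for j
    by (simp add: cis_mult algebra_simps)
  have "exp_poly (tent_diff D) (2*D+1) \<theta> = (\<Sum>j\<le>2*D. of_real (tent D (Suc j) - tent D j) * ?z (Suc j))"
    unfolding exp_poly_def Suc_eq_plus1[symmetric] sum.atMost_Suc_shift by (simp add: tent_diff_def)
  also have "... = (\<Sum>j\<le>2*D. of_real (tent D (Suc j)) * ?z (Suc j))
      - cis (2 * pi * \<theta>) * (\<Sum>j\<le>2*D. of_real (tent D j) * ?z j)"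
    unfolding z sum_distrib_left sum_subtractf[symmetric]
    by (intro sum.cong refl) (simp add: algebra_simps)
  also have "(\<Sum>j\<le>2*D. of_real (tent D (Suc j)) * ?z (Suc j)) = exp_poly (tent D) (2*D+1) \<theta>"
    unfolding exp_poly_def Suc_eq_plus1[symmetric] sum.atMost_Suc_shift by (simp add: tent_def)
  also have "(\<Sum>j\<le>2*D. of_real (tent D j) * ?z j) = exp_poly (tent D) (2*D+1) \<theta>"
    unfolding exp_poly_def by (simp add: tent_def)
  finally show ?thesis by (simp add: algebra_simps)
qed

text \<open>\<open>K\<close> is an approximate identity at scale 1/D with coefficients
  \<open>\<kappa>\<close>; \<open>L\<close>, with coefficients \<open>\<sigma>\<close>, takes over
  outside the k/D-neighbourhood of the integers. The bound 1/(2k) allows k such corrections at a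
  total cost of 1/2. The degree 3D is the degree 2D + 1 rounded up.\<close>

definition kernel_pair :: "nat \<Rightarrow> nat \<Rightarrow> (int \<Rightarrow> real) \<times> (int \<Rightarrow> real) \<times> (real \<Rightarrow> real) \<times> (real \<Rightarrow> real) \<Rightarrow> bool" where
  "kernel_pair D k = (\<lambda>(\<kappa>, \<sigma>, K, L).
    (\<forall>\<theta>. of_real (K \<theta>) = (\<Sum>t=-int (3*D)..int (3*D). of_real (\<kappa> t) * cis (2 * pi * of_int t * \<theta>))) \<and>
    (\<forall>\<theta>. of_real (L \<theta>) = (\<Sum>t=-int (3*D)..int (3*D). of_real (\<sigma> t) * cis (2 * pi * of_int t * \<theta>))) \<and>
    (\<forall>\<theta>. 0 \<le> K \<theta>) \<and> (\<forall>\<theta>. 0 \<le> L \<theta>) \<and>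
    (\<forall>\<theta>. real k / real D \<le> nearest_int_dist \<theta> \<longrightarrow> K \<theta> \<le> L \<theta>) \<and>
    \<kappa> 0 = 1 \<and> (\<forall>t. \<bar>\<kappa> t\<bar> \<le> 1) \<and> (\<forall>t. \<bar>\<sigma> t\<bar> \<le> 1 / (2 * real k)))"

text \<open>Multiplying the Jackson-type kernel \<open>K\<close> by \<open>\<bar>1 - z\<bar>\<^sup>2\<close> differences its coefficients; this
  gives a trigonometric polynomial of small mean that dominates the tail of \<open>K\<close>.\<close>

lemma kernel_pair_exists:
  fixes D k :: nat
  assumes D: "1 \<le> D" and k: "5 \<le> k"
  shows "\<exists>q. kernel_pair D k q"
proof -
  define P where "P = (\<Sum>j\<le>2*D+1. (tent D j)\<^sup>2)"
  define R where "R = (\<Sum>j\<le>2*D+1. (tent_diff D j)\<^sup>2)"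
  \<comment> \<open>Away from the integers |1 - z| \<ge> 2k/D, so with this \<open>c\<close> the
    quotient c|1 - z|^2 of \<open>L\<close> and \<open>K\<close> is at least 1.\<close>
  define c where "c = (real D)\<^sup>2 / (4 * (real k)\<^sup>2)"
  define K where "K \<theta> = (cmod (exp_poly (tent D) (2*D+1) \<theta>))\<^sup>2 / P" for \<theta>
  define L where "L \<theta> = c * (cmod (exp_poly (tent_diff D) (2*D+1) \<theta>))\<^sup>2 / P" for \<theta>
  define \<kappa> where "\<kappa> t = autocorr (tent D) (2*D+1) t / P" for t
  define \<sigma> where "\<sigma> t = c * autocorr (tent_diff D) (2*D+1) t / P" for t
  have Pge: "real D ^ 3 / 3 \<le> P" unfolding P_def by (rule sum_tent_square_ge)
  have D3: "0 < real D ^ 3" using D by simp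
  have P: "0 < P" using Pge D3 by linarith
  have c0: "0 \<le> c" by (simp add: c_def)
  have ac0: "autocorr p M t = 0" if "t \<notin> {-int M..int M}" for p M t
  proof -
    have "{(j, l). j \<le> M \<and> l \<le> M \<and> int j - int l = t} = {}" using that by auto
    thus ?thesis unfolding autocorr_def by (simp only: sum.empty)
  qed
  have ext: "(\<Sum>t=-int (2*D+1)..int (2*D+1). of_real (autocorr p (2*D+1) t) * cis (2 * pi * of_int t * \<theta>))
      = (\<Sum>t=-int (3*D)..int (3*D). of_real (autocorr p (2*D+1) t) * cis (2 * pi * of_int t * \<theta>))" for p \<theta>
    using D by (intro sum.mono_neutral_left) (auto simp: ac0)
  have "kernel_pair D k (\<kappa>, \<sigma>, K, L)"
    unfolding kernel_pair_def split_conv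
  proof (intro conjI allI impI)
    fix \<theta>
    show "of_real (K \<theta>) = (\<Sum>t=-int (3*D)..int (3*D). of_real (\<kappa> t) * cis (2 * pi * of_int t * \<theta>))"
      unfolding K_def \<kappa>_def of_real_divide norm_exp_poly_square ext
      by (simp add: sum_divide_distrib)
    show "of_real (L \<theta>) = (\<Sum>t=-int (3*D)..int (3*D). of_real (\<sigma> t) * cis (2 * pi * of_int t * \<theta>))"
      unfolding L_def \<sigma>_def of_real_divide of_real_mult norm_exp_poly_square ext
      by (simp add: sum_divide_distrib sum_distrib_left mult_ac)
    show "0 \<le> K \<theta>" "0 \<le> L \<theta>" unfolding K_def L_def using P c0 by auto
  next
    fix \<theta> assume far: "real k / real D \<le> nearest_int_dist \<theta>"
    have "2 * (real k / real D) \<le> cmod (1 - cis (2 * pi * \<theta>))"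
      using far norm_cis_minus_one_ge[of \<theta>] by linarith
    hence "(2 * (real k / real D))\<^sup>2 \<le> (cmod (1 - cis (2 * pi * \<theta>)))\<^sup>2"
      by (rule power_mono) auto
    hence "1 \<le> c * (cmod (1 - cis (2 * pi * \<theta>)))\<^sup>2"
      using D k by (simp add: c_def field_simps power2_eq_square)
    moreover have "L \<theta> = (c * (cmod (1 - cis (2 * pi * \<theta>)))\<^sup>2) * K \<theta>"
      unfolding L_def K_def exp_poly_tent_diff by (simp add: norm_mult power_mult_distrib)
    moreover have "0 \<le> K \<theta>" unfolding K_def using P by auto
    ultimately show "K \<theta> \<le> L \<theta>" using mult_right_mono[of 1 _ "K \<theta>"] by simp
  next
    show "\<kappa> 0 = 1" using P by (simp add: \<kappa>_def autocorr_zero P_def)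
    fix t
    show "\<bar>\<kappa> t\<bar> \<le> 1"
      using P abs_autocorr_le[of "tent D" "2*D+1" t] by (simp add: \<kappa>_def P_def)
    have "\<bar>\<sigma> t\<bar> \<le> c * R / P"
      unfolding \<sigma>_def abs_mult abs_divide R_def using P c0 abs_autocorr_le[of "tent_diff D" "2*D+1" t]
      by (simp add: divide_right_mono mult_left_mono)
    also have "... \<le> c * (3 * real D) / (real D ^ 3 / 3)"
    proof -
      have "R \<le> 3 * real D"
        using sum_tent_diff_square_le[of D] D unfolding R_def by linarith
      thus ?thesis using Pge D3 P c0 by (intro frac_le mult_left_mono) auto
    qed
    also have "... = 9 / (4 * (real k)\<^sup>2)"
      using D k by (simp add: c_def field_simps power3_eq_cube power2_eq_square)
    \<comment> \<open>This comparison amounts to k \<ge> 9/2 and is the source of the assumption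
      \<open>5 \<le> k\<close> in this lemma.\<close>
    also have "... \<le> 1 / (2 * real k)"
      using k by (simp add: field_simps power2_eq_square)
    finally show "\<bar>\<sigma> t\<bar> \<le> 1 / (2 * real k)" .
  qed
  thus ?thesis ..
qed

section \<open>From one variable to boxes in k variables\<close>

type_synonym ivec = "nat \<Rightarrow> int"

abbreviation character :: "nat \<Rightarrow> ivec \<Rightarrow> (nat \<Rightarrow> real) \<Rightarrow> complex" where
  "character k t \<theta> \<equiv> cis (2 * pi * (\<Sum>i=1..k. of_int (t i) * \<theta> i))"

definition freq_box :: "nat \<Rightarrow> (nat \<Rightarrow> nat) \<Rightarrow> ivec set" where
  "freq_box k a = (\<Pi>\<^sub>E i\<in>{1..k}. {- int (3 * 4 ^ a i)..int (3 * 4 ^ a i)})"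

lemma finite_freq_box [simp]: "finite (freq_box k a)"
  unfolding freq_box_def by (intro finite_PiE) auto

lemma cis_sum: "cis (\<Sum>i\<in>A. f i) = (\<Prod>i\<in>A. cis (f i))"
  by (induction A rule: infinite_finite_induct) (auto simp: cis_mult[symmetric])

text \<open>The normalisation is by the mean, which lies between 1/2 and 2 whatever the size of the
  box. Inside the box no bound on \<open>g\<close> is asked for; outside, only its sign is
  prescribed. So \<open>0 < g \<theta>\<close> certifies that every coordinate is within k/4^(a_i)
  of an integer.\<close>

definition box_minorant :: "nat \<Rightarrow> (nat \<Rightarrow> nat) \<Rightarrow> (ivec \<Rightarrow> real) \<times> ((nat \<Rightarrow> real) \<Rightarrow> real) \<Rightarrow> bool" where
  "box_minorant k a = (\<lambda>(c, g).
    (\<forall>\<theta>. of_real (g \<theta>) = (\<Sum>t\<in>freq_box k a. of_real (c t) * character k t \<theta>)) \<and>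
    (\<forall>t. \<bar>c t\<bar> \<le> 2) \<and> 1 / 2 \<le> c (\<lambda>i\<in>{1..k}. 0) \<and>
    (\<forall>\<theta> i. i \<in> {1..k} \<longrightarrow> real k / 4 ^ a i \<le> nearest_int_dist (\<theta> i) \<longrightarrow> g \<theta> \<le> 0))"

text \<open>The witness is the product of the kernels \<open>K\<close> minus the k products in which
  one factor is replaced by \<open>L\<close>. If coordinate j is outside its interval, the j-th
  correction already dominates the main product, and the others are nonnegative. In each coefficient
  the corrections amount to at most k * 1/(2k) = 1/2.\<close>

lemma box_minorant_exists:
  assumes k: "5 \<le> k"
  shows "\<exists>q. box_minorant k a q"
proof -
  have "\<exists>q. kernel_pair (4 ^ a i) k q" for i
    by (rule kernel_pair_exists[OF _ k]) simp
  then obtain q where q: "\<And>i. kernel_pair (4 ^ a i) k (q i)" by metis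
  define \<kappa> where "\<kappa> i = fst (q i)" for i
  define \<sigma> where "\<sigma> i = fst (snd (q i))" for i
  define K where "K i = fst (snd (snd (q i)))" for i
  define L where "L i = snd (snd (snd (q i)))" for i
  have Q: "kernel_pair (4 ^ a i) k (\<kappa> i, \<sigma> i, K i, L i)" for i
    using q[of i] by (simp add: \<kappa>_def \<sigma>_def K_def L_def)
  have Kexp: "of_real (K i \<theta>) = (\<Sum>t=-int (3*4 ^ a i)..int (3*4 ^ a i). of_real (\<kappa> i t) * cis (2 * pi * of_int t * \<theta>))" for i \<theta>
    using Q[of i] unfolding kernel_pair_def by blast
  have Lexp: "of_real (L i \<theta>) = (\<Sum>t=-int (3*4 ^ a i)..int (3*4 ^ a i). of_real (\<sigma> i t) * cis (2 * pi * of_int t * \<theta>))" for i \<theta>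
    using Q[of i] unfolding kernel_pair_def by blast
  have K0: "0 \<le> K i \<theta>" and L0: "0 \<le> L i \<theta>" and \<kappa>0: "\<kappa> i 0 = 1" and \<kappa>1: "\<bar>\<kappa> i t\<bar> \<le> 1"
    and \<sigma>1: "\<bar>\<sigma> i t\<bar> \<le> 1 / (2 * real k)" for i t \<theta>
    using Q[of i] unfolding kernel_pair_def by blast+
  have KL: "K i \<theta> \<le> L i \<theta>" if "real k / 4 ^ a i \<le> nearest_int_dist \<theta>" for i \<theta>
    using Q[of i] that unfolding kernel_pair_def by simp
  define c where "c t = (\<Prod>i=1..k. \<kappa> i (t i)) - (\<Sum>l=1..k. \<Prod>i=1..k. (if i = l then \<sigma> i else \<kappa> i) (t i))" for t
  define g where "g \<theta> = (\<Prod>i=1..k. K i (\<theta> i)) - (\<Sum>l=1..k. \<Prod>i=1..k. (if i = l then L i else K i) (\<theta> i))" for \<theta> :: "nat \<Rightarrow> real"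
  have expand: "of_real (\<Prod>i=1..k. F i (\<theta> i))
      = (\<Sum>t\<in>freq_box k a. of_real (\<Prod>i=1..k. f i (t i)) * character k t \<theta>)"
    if F: "\<And>i \<theta>. of_real (F i \<theta>) = (\<Sum>t=-int (3*4 ^ a i)..int (3*4 ^ a i). of_real (f i t) * cis (2 * pi * of_int t * \<theta>))"
    for F :: "nat \<Rightarrow> real \<Rightarrow> real" and f :: "nat \<Rightarrow> int \<Rightarrow> real" and \<theta> :: "nat \<Rightarrow> real"
  proof -
    have "of_real (\<Prod>i=1..k. F i (\<theta> i))
      = (\<Prod>i=1..k. \<Sum>t=-int (3*4 ^ a i)..int (3*4 ^ a i). of_real (f i t) * cis (2 * pi * of_int t * \<theta> i))"
      by (simp add: F)
    also have "... = (\<Sum>t\<in>freq_box k a. \<Prod>i=1..k. of_real (f i (t i)) * cis (2 * pi * of_int (t i) * \<theta> i))"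
      unfolding freq_box_def by (rule prod_sum_PiE) auto
    also have "... = (\<Sum>t\<in>freq_box k a. of_real (\<Prod>i=1..k. f i (t i)) * character k t \<theta>)"
      by (simp add: prod.distrib cis_sum sum_distrib_left mult.assoc)
    finally show ?thesis .
  qed
  have k0: "real k > 0" using k by simp
  have \<sigma>prod: "\<bar>\<Prod>i=1..k. (if i = l then \<sigma> i else \<kappa> i) (t i)\<bar> \<le> 1 / (2 * real k)" if l: "l \<in> {1..k}" for l and t :: ivec
  proof -
    have "\<bar>\<Prod>i=1..k. (if i = l then \<sigma> i else \<kappa> i) (t i)\<bar> = \<bar>\<sigma> l (t l)\<bar> * (\<Prod>i\<in>{1..k}-{l}. \<bar>\<kappa> i (t i)\<bar>)"
      unfolding abs_prod using l by (subst prod.remove[of _ l]) (auto intro!: prod.cong)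
    also have "... \<le> 1 / (2 * real k) * 1"
      using \<sigma>1 \<kappa>1 by (intro mult_mono prod_le_1) (auto intro: prod_nonneg)
    finally show ?thesis by simp
  qed
  have sum\<sigma>: "\<bar>\<Sum>l=1..k. \<Prod>i=1..k. (if i = l then \<sigma> i else \<kappa> i) (t i)\<bar> \<le> 1 / 2" for t :: ivec
  proof -
    have "\<bar>\<Sum>l=1..k. \<Prod>i=1..k. (if i = l then \<sigma> i else \<kappa> i) (t i)\<bar> \<le> (\<Sum>l=1..k. 1 / (2 * real k))"
      by (rule order_trans[OF sum_abs]) (intro sum_mono \<sigma>prod)
    also have "... = 1 / 2" using k0 by simp
    finally show ?thesis .
  qed
  have "box_minorant k a (c, g)"
    unfolding box_minorant_def split_conv
  proof (intro conjI allI impI)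
    fix \<theta> :: "nat \<Rightarrow> real"
    have "of_real (g \<theta>) = of_real (\<Prod>i=1..k. K i (\<theta> i)) - (\<Sum>l=1..k. of_real (\<Prod>i=1..k. (if i = l then L i else K i) (\<theta> i)))"
      unfolding g_def by simp
    also have "of_real (\<Prod>i=1..k. K i (\<theta> i)) = (\<Sum>t\<in>freq_box k a. of_real (\<Prod>i=1..k. \<kappa> i (t i)) * character k t \<theta>)"
      by (rule expand) (rule Kexp)
    also have "(\<Sum>l=1..k. of_real (\<Prod>i=1..k. (if i = l then L i else K i) (\<theta> i)))
      = (\<Sum>l=1..k. \<Sum>t\<in>freq_box k a. of_real (\<Prod>i=1..k. (if i = l then \<sigma> i else \<kappa> i) (t i)) * character k t \<theta>)"
      by (intro sum.cong refl expand) (simp add: Kexp Lexp)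
    also have "... = (\<Sum>t\<in>freq_box k a. (\<Sum>l=1..k. of_real (\<Prod>i=1..k. (if i = l then \<sigma> i else \<kappa> i) (t i))) * character k t \<theta>)"
      by (subst sum.swap) (simp add: sum_distrib_right)
    also have "(\<Sum>t\<in>freq_box k a. of_real (\<Prod>i=1..k. \<kappa> i (t i)) * character k t \<theta>)
       - (\<Sum>t\<in>freq_box k a. (\<Sum>l=1..k. of_real (\<Prod>i=1..k. (if i = l then \<sigma> i else \<kappa> i) (t i))) * character k t \<theta>)
       = (\<Sum>t\<in>freq_box k a. of_real (c t) * character k t \<theta>)"
      unfolding c_def sum_subtractf[symmetric] by (intro sum.cong refl) (simp add: algebra_simps)
    finally show "of_real (g \<theta>) = (\<Sum>t\<in>freq_box k a. of_real (c t) * character k t \<theta>)" .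
  next
    fix t
    have "\<bar>\<Prod>i=1..k. \<kappa> i (t i)\<bar> \<le> 1"
      unfolding abs_prod using \<kappa>1 by (intro prod_le_1) auto
    thus "\<bar>c t\<bar> \<le> 2" using sum\<sigma>[of t] unfolding c_def by linarith
  next
    have "(\<Prod>i=1..k. \<kappa> i ((\<lambda>i\<in>{1..k}. 0) i)) = 1" by (simp add: \<kappa>0)
    thus "1 / 2 \<le> c (\<lambda>i\<in>{1..k}. 0)" using sum\<sigma>[of "\<lambda>i\<in>{1..k}. 0"] unfolding c_def by linarith
  next
    fix \<theta> j assume j: "j \<in> {1..k}" and far: "real k / 4 ^ a j \<le> nearest_int_dist (\<theta> j)"
    have nn: "0 \<le> (\<Prod>i=1..k. (if i = l then L i else K i) (\<theta> i))" for l
      using K0 L0 by (intro prod_nonneg) auto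
    have "(\<Prod>i=1..k. K i (\<theta> i)) \<le> (\<Prod>i=1..k. (if i = j then L i else K i) (\<theta> i))"
      using KL[OF far] K0 by (intro prod_mono) auto
    also have "... \<le> (\<Sum>l=1..k. \<Prod>i=1..k. (if i = l then L i else K i) (\<theta> i))"
      using j nn by (intro member_le_sum) auto
    finally show "g \<theta> \<le> 0" unfolding g_def by simp
  qed
  thus ?thesis ..
qed

section \<open>Frequencies off the diagonal\<close>

text \<open>Above the dual exponent only finitely many pairs violate the bound with constant 1, and
  a smaller constant absorbs them as long as their distances to the integers are positive. A nonzero
  pair at distance 0 would bring all its multiples along, against finiteness.\<close>

lemma pair_badly_approximable:
  assumes "dual_exponent [a, b] < ereal w"
  obtains c :: real where "0 < c"
    "\<And>N1 N2 :: int. (N1, N2) \<noteq> (0, 0) \<Longrightarrow>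
       c * of_int (max \<bar>N1\<bar> \<bar>N2\<bar>) powr (- w) \<le> nearest_int_dist (of_int N1 * a + of_int N2 * b)"
proof -
  define bad where "bad N1 N2 \<longleftrightarrow> nearest_int_dist (of_int N1 * a + of_int N2 * b)
      < of_int (max \<bar>N1\<bar> \<bar>N2\<bar>) powr (- w)" for N1 N2 :: int
  let ?X = "{ns :: int list. length ns = length [a, b] \<and>
       nearest_int_dist (\<Sum>i<length [a, b]. of_int (ns ! i) * [a, b] ! i)
         < of_int (Max (abs ` set ns)) powr (- w)}"
  have "finite ?X"
  proof (rule ccontr)
    assume "infinite ?X"
    hence "ereal w \<le> dual_exponent [a, b]"
      unfolding dual_exponent_def by (intro Sup_upper) blast
    thus False using assms by simp
  qed
  moreover have "{(N1, N2). bad N1 N2} \<subseteq> (\<lambda>ns. (ns ! 0, ns ! 1)) ` ?X"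
  proof safe
    fix N1 N2 assume "bad N1 N2"
    hence "[N1, N2] \<in> ?X" by (simp add: bad_def numeral_2_eq_2 lessThan_Suc add.commute)
    thus "(N1, N2) \<in> (\<lambda>ns. (ns ! 0, ns ! 1)) ` ?X" by (rule rev_image_eqI) simp
  qed
  ultimately have fin: "finite {(N1, N2). bad N1 N2}"
    by (meson finite_imageI finite_subset)
  define S where "S = {(N1, N2). bad N1 N2 \<and> (N1, N2) \<noteq> (0, 0)}"
  have finS: "finite S" by (rule finite_subset[OF _ fin]) (auto simp: S_def)
  define f where "f = (\<lambda>(N1, N2). nearest_int_dist (of_int N1 * a + of_int N2 * b) / of_int (max \<bar>N1\<bar> \<bar>N2\<bar>) powr (- w))"
  have f_pos: "0 < f N" if "N \<in> S" for N
  proof -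
    obtain N1 N2 where N: "N = (N1, N2)" "bad N1 N2" "(N1, N2) \<noteq> (0, 0)"
      using \<open>N \<in> S\<close> unfolding S_def by blast
    have "nearest_int_dist (of_int N1 * a + of_int N2 * b) \<noteq> 0"
    proof
      assume "nearest_int_dist (of_int N1 * a + of_int N2 * b) = 0"
      then obtain z :: int where z: "of_int N1 * a + of_int N2 * b = of_int z"
        unfolding nearest_int_dist_def by auto
      have "bad (int (Suc j) * N1) (int (Suc j) * N2)" for j
      proof -
        have "of_int (int (Suc j) * N1) * a + of_int (int (Suc j) * N2) * b = of_int (int (Suc j) * z)"
          unfolding of_int_mult z[symmetric] by (simp add: algebra_simps)
        hence "nearest_int_dist (of_int (int (Suc j) * N1) * a + of_int (int (Suc j) * N2) * b) = 0"
          unfolding nearest_int_dist_def by (simp only: round_of_int)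
        moreover have "max \<bar>int (Suc j) * N1\<bar> \<bar>int (Suc j) * N2\<bar> \<noteq> 0"
          using N(3) by (auto simp: max_def)
        ultimately show ?thesis
          unfolding bad_def by (simp only: powr_gt_zero of_int_eq_0_iff not_False_eq_True)
      qed
      hence "range (\<lambda>j. (int (Suc j) * N1, int (Suc j) * N2)) \<subseteq> {(N1, N2). bad N1 N2}" by auto
      hence "finite (range (\<lambda>j. (int (Suc j) * N1, int (Suc j) * N2)))" using fin finite_subset by blast
      moreover have "inj (\<lambda>j. (int (Suc j) * N1, int (Suc j) * N2))"
        using N(3) by (auto simp: inj_on_def)
      ultimately show False using finite_imageD infinite_UNIV_nat by blast
    qed
    moreover have "0 \<le> nearest_int_dist (of_int N1 * a + of_int N2 * b)" by (simp add: nearest_int_dist_def)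
    moreover have "0 < of_int (max \<bar>N1\<bar> \<bar>N2\<bar>) powr (- w)" using N(3) by auto
    ultimately show ?thesis unfolding f_def N(1) by simp
  qed
  show thesis
  proof (rule that[of "Min (insert 1 (f ` S))"])
    show "0 < Min (insert 1 (f ` S))" using finS f_pos by auto
    fix N1 N2 :: int assume N: "(N1, N2) \<noteq> (0, 0)"
    have M: "0 < of_int (max \<bar>N1\<bar> \<bar>N2\<bar>) powr (- w)" using N by auto
    show "Min (insert 1 (f ` S)) * of_int (max \<bar>N1\<bar> \<bar>N2\<bar>) powr (- w) \<le> nearest_int_dist (of_int N1 * a + of_int N2 * b)"
    proof (cases "bad N1 N2")
      case True
      hence "Min (insert 1 (f ` S)) \<le> f (N1, N2)"
        using finS N by (intro Min_le) (auto simp: S_def)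
      thus ?thesis using M by (simp add: f_def field_simps)
    next
      case False
      have "Min (insert 1 (f ` S)) \<le> 1" using finS by (intro Min_le) auto
      hence "Min (insert 1 (f ` S)) * of_int (max \<bar>N1\<bar> \<bar>N2\<bar>) powr (- w) \<le> 1 * of_int (max \<bar>N1\<bar> \<bar>N2\<bar>) powr (- w)"
        using M by (intro mult_right_mono) auto
      thus ?thesis using False unfolding bad_def by linarith
    qed
  qed
qed

definition badly_approximable_pairs :: "nat \<Rightarrow> (nat \<Rightarrow> real) \<Rightarrow> real \<Rightarrow> real \<Rightarrow> bool" where
  "badly_approximable_pairs k \<alpha> c w \<longleftrightarrow> (\<forall>i j. 2 \<le> i \<longrightarrow> i < j \<longrightarrow> j \<le> k \<longrightarrow> (\<forall>N1 N2. (N1, N2) \<noteq> (0, 0) \<longrightarrow>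
     c * of_int (max \<bar>N1\<bar> \<bar>N2\<bar>) powr (- w) \<le> nearest_int_dist (of_int N1 * \<alpha> i + of_int N2 * \<alpha> j)))"

lemma badly_approximable_pairsD:
  "badly_approximable_pairs k \<alpha> c w \<Longrightarrow> 2 \<le> i \<Longrightarrow> i < j \<Longrightarrow> j \<le> k \<Longrightarrow> (N1, N2) \<noteq> (0, 0) \<Longrightarrow>
     c * of_int (max \<bar>N1\<bar> \<bar>N2\<bar>) powr (- w) \<le> nearest_int_dist (of_int N1 * \<alpha> i + of_int N2 * \<alpha> j)"
  unfolding badly_approximable_pairs_def by blast

lemma badly_approximable:
  assumes "max_pair_exponent k \<alpha> < ereal w"
  obtains c where "0 < c" "badly_approximable_pairs k \<alpha> c w"
proof -
  let ?P = "{(i, j). 2 \<le> i \<and> i < j \<and> j \<le> k}"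
  have finP: "finite ?P" by (rule finite_subset[of _ "{..k} \<times> {..k}"]) auto
  have "{dual_exponent [\<alpha> i, \<alpha> j] | i j. 2 \<le> i \<and> i < j \<and> j \<le> k} = (\<lambda>(i, j). dual_exponent [\<alpha> i, \<alpha> j]) ` ?P"
    by auto
  hence fin: "finite {dual_exponent [\<alpha> i, \<alpha> j] | i j. 2 \<le> i \<and> i < j \<and> j \<le> k}" using finP by simp
  have "\<exists>c>0. \<forall>N1 N2 :: int. (N1, N2) \<noteq> (0, 0) \<longrightarrow>
       c * of_int (max \<bar>N1\<bar> \<bar>N2\<bar>) powr (- w) \<le> nearest_int_dist (of_int N1 * \<alpha> i + of_int N2 * \<alpha> j)"
    if "2 \<le> i" "i < j" "j \<le> k" for i j
  proof -
    have "dual_exponent [\<alpha> i, \<alpha> j] \<le> max_pair_exponent k \<alpha>"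
      unfolding max_pair_exponent_def using that fin by (intro Max_ge) auto
    hence "dual_exponent [\<alpha> i, \<alpha> j] < ereal w" using assms by (rule le_less_trans)
    from pair_badly_approximable[OF this] show ?thesis by metis
  qed
  then obtain c where c: "\<And>i j. 2 \<le> i \<Longrightarrow> i < j \<Longrightarrow> j \<le> k \<Longrightarrow> 0 < c i j"
    "\<And>i j N1 N2. 2 \<le> i \<Longrightarrow> i < j \<Longrightarrow> j \<le> k \<Longrightarrow> (N1, N2) \<noteq> (0, 0) \<Longrightarrow>
       c i j * of_int (max \<bar>N1\<bar> \<bar>N2\<bar>) powr (- w) \<le> nearest_int_dist (of_int N1 * \<alpha> i + of_int N2 * \<alpha> j)"
    by metis
  define c' where "c' = Min (insert (1::real) ((\<lambda>(i, j). c i j) ` ?P))"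
  show thesis
  proof (rule that[of c'])
    show "0 < c'" unfolding c'_def using finP c(1) by auto
    show "badly_approximable_pairs k \<alpha> c' w"
      unfolding badly_approximable_pairs_def
    proof (intro allI impI)
      fix i j N1 N2 assume ij: "2 \<le> i" "i < j" "j \<le> k" and N: "(N1, N2) \<noteq> (0::int, 0::int)"
      have "c' \<le> c i j" unfolding c'_def using finP ij by (intro Min_le) force+
      hence "c' * of_int (max \<bar>N1\<bar> \<bar>N2\<bar>) powr (- w) \<le> c i j * of_int (max \<bar>N1\<bar> \<bar>N2\<bar>) powr (- w)"
        by (rule mult_right_mono) auto
      also have "... \<le> nearest_int_dist (of_int N1 * \<alpha> i + of_int N2 * \<alpha> j)" by (rule c(2)[OF ij N])
      finally show "c' * of_int (max \<bar>N1\<bar> \<bar>N2\<bar>) powr (- w) \<le> nearest_int_dist (of_int N1 * \<alpha> i + of_int N2 * \<alpha> j)" .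
    qed
  qed
qed

text \<open>Take v = t / gcd(t). By parallelism \<open>v e\<close> divides every
  \<open>s e * v i\<close>, hence their gcd, which is |\<open>s e\<close>| because the entries of v
  are coprime. The quotient q at \<open>e\<close> then works at every index.\<close>

lemma parallel_primitive_vector:
  fixes t s :: ivec
  assumes I: "finite I" "e \<in> I" and par: "\<And>i j. i \<in> I \<Longrightarrow> j \<in> I \<Longrightarrow> t i * s j = t j * s i"
    and te: "t e \<noteq> 0" and se: "s e \<noteq> 0"
  obtains p q :: int and v :: ivec where "p \<noteq> 0" "q \<noteq> 0" "v e \<noteq> 0"
    "\<And>i. i \<in> I \<Longrightarrow> t i = p * v i" "\<And>i. i \<in> I \<Longrightarrow> s i = q * v i"
proof -
  define g where "g = Gcd (t ` I)"
  have gd: "g dvd t i" if "i \<in> I" for i unfolding g_def using that by (intro Gcd_dvd) auto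
  have g0: "g \<noteq> 0" using gd[OF I(2)] te by auto
  have gpos: "0 \<le> g" unfolding g_def by simp
  define v where "v i = t i div g" for i
  have tv: "t i = g * v i" if "i \<in> I" for i using gd[OF that] by (simp add: v_def)
  have "t ` I = (*) g ` (v ` I)" using tv by (force simp: image_image)
  hence "g = normalize (g * Gcd (v ` I))" unfolding g_def[symmetric] by (metis Gcd_mult g_def)
  hence "g = g * Gcd (v ` I)" using gpos by (simp add: abs_mult)
  hence G1: "Gcd (v ` I) = 1" using g0 by simp
  have ve: "v e \<noteq> 0" using tv[OF I(2)] te by auto
  have sv: "s e * v i = s i * v e" if "i \<in> I" for i
  proof -
    have "g * (s e * v i) = g * (s i * v e)"
      using par[OF that I(2)] tv[OF that] tv[OF I(2)] by (simp add: algebra_simps)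
    thus ?thesis using g0 by simp
  qed
  have "v e dvd Gcd ((*) (s e) ` (v ` I))"
    by (rule Gcd_greatest) (use sv in auto)
  hence "v e dvd s e" using G1 by (simp add: Gcd_mult)
  then obtain q where q: "s e = q * v e" by (metis dvd_def mult.commute)
  have sq: "s i = q * v i" if "i \<in> I" for i
    using sv[OF that] ve unfolding q by (simp add: algebra_simps)
  show thesis
    by (rule that[of g q v]) (use g0 se q ve tv sq in auto)
qed

section \<open>Parallel pairs and the off-diagonal count\<close>

lemma card_nat_near_le:
  fixes x H :: real
  assumes "0 \<le> H"
  shows "finite {m :: nat. \<bar>real m - x\<bar> \<le> H}" "real (card {m :: nat. \<bar>real m - x\<bar> \<le> H}) \<le> 2 * H + 1"
proof -
  let ?S = "{m :: nat. \<bar>real m - x\<bar> \<le> H}" and ?J = "{\<lceil>x - H\<rceil>..\<lfloor>x + H\<rfloor>}"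
  have sub: "int ` ?S \<subseteq> ?J" by (auto simp: ceiling_le_iff le_floor_iff abs_le_iff)
  hence "finite (int ` ?S)" using finite_subset by blast
  thus fin: "finite ?S" using finite_imageD by (metis inj_on_of_nat)
  have "card ?S = card (int ` ?S)" by (simp add: card_image)
  also have "... \<le> card ?J" using sub by (intro card_mono) auto
  finally have "real (card ?S) \<le> real (card ?J)" by simp
  also have "... \<le> 2 * H + 1"
    using assms by (simp add: of_nat_nat) linarith
  finally show "real (card ?S) \<le> 2 * H + 1" .
qed

text \<open>On the hyperplane the character of u = n t - m s has frequency 2 pi (u_i - \<alpha>_i
  u_1) in the variable \<open>x i\<close>. Leaving out the factor 2 pi enlarges the set of close
  pairs and keeps pi out of the counting.\<close>

definition freq_close :: "nat \<Rightarrow> (nat \<Rightarrow> real) \<Rightarrow> nat \<Rightarrow> nat \<Rightarrow> ivec \<Rightarrow> ivec \<Rightarrow> bool" where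
  "freq_close k \<alpha> n m t s \<longleftrightarrow> (\<forall>i\<in>{2..k}.
     \<bar>of_int (int n * t i - int m * s i) - \<alpha> i * of_int (int n * t 1 - int m * s 1)\<bar> < 1)"

definition nonzero_vec :: "nat \<Rightarrow> ivec \<Rightarrow> bool" where
  "nonzero_vec k t \<longleftrightarrow> (\<exists>i\<in>{1..k}. t i \<noteq> 0)"

text \<open>For 2 \<le> i < j put a_i = t_i - \<alpha>_i t_1 and b_i = s_i - \<alpha>_i s_1. The
  determinant a_i b_j - a_j b_i is a linear form N0 - N1 \<alpha>_i - N2 \<alpha>_j in the minors
  and has size O(B/n), as n a - m b is below 1 in both coordinates. If N1 and N2 are not both 0,
  this contradicts the Diophantine bound at height 2B^2; otherwise N0 is an integer of absolute
  value below 1.\<close>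

lemma freq_close_minors_vanish:
  fixes B n m k :: nat and t s :: ivec
  assumes k: "3 \<le> k" and w: "0 < w" and n: "1 \<le> n" and B: "1 \<le> B"
    and bad: "badly_approximable_pairs k \<alpha> c w"
    and c: "0 < c" and A: "\<And>i. i \<in> {2..k} \<Longrightarrow> \<bar>\<alpha> i\<bar> \<le> A"
    and tB: "\<And>i. i \<in> {1..k} \<Longrightarrow> \<bar>t i\<bar> \<le> int B" and sB: "\<And>i. i \<in> {1..k} \<Longrightarrow> \<bar>s i\<bar> \<le> int B"
    and small: "2 * (1 + A) * real B / real n < 1" "2 * (1 + A) * real B / real n < c * (2 * (real B)\<^sup>2) powr (- w)"
    and close: "freq_close k \<alpha> n m t s"
    and ij: "i \<in> {1..k}" "j \<in> {1..k}"
  shows "t i * s j = t j * s i"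
proof -
  have main: "t 1 * s j = t j * s 1 \<and> t i * s 1 = t 1 * s i \<and> t i * s j = t j * s i"
    if "2 \<le> i" "i < j" "j \<le> k" for i j
  proof -
    define a b where "a i = of_int (t i) - \<alpha> i * of_int (t 1)" and "b i = of_int (s i) - \<alpha> i * of_int (s 1)" for i
    define N0 N1 N2 where "N0 = t i * s j - t j * s i" and "N1 = t 1 * s j - t j * s 1" and "N2 = t i * s 1 - t 1 * s i"
    define \<Delta> where "\<Delta> = a i * b j - a j * b i"
    have \<Delta>: "\<Delta> = of_int N0 - (of_int N1 * \<alpha> i + of_int N2 * \<alpha> j)"
      unfolding \<Delta>_def a_def b_def N0_def N1_def N2_def by (simp add: algebra_simps)
    have ab: "\<bar>real n * a l - real m * b l\<bar> < 1" if "l \<in> {2..k}" for l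
      using close that unfolding freq_close_def a_def b_def by (force simp: algebra_simps)
    have bB: "\<bar>b l\<bar> \<le> (1 + A) * real B" if "l \<in> {2..k}" for l
    proof -
      have s1: "\<bar>of_int (s l)\<bar> \<le> real B" "\<bar>of_int (s 1)\<bar> \<le> real B"
        using sB[of l] sB[of 1] that k by (simp_all flip: of_int_abs)
      have "\<bar>b l\<bar> \<le> \<bar>of_int (s l)\<bar> + \<bar>\<alpha> l\<bar> * \<bar>of_int (s 1)\<bar>"
        unfolding b_def abs_mult[symmetric] by (rule abs_triangle_ineq4)
      also have "... \<le> real B + A * real B"
        using s1 A[OF that] by (intro add_mono mult_mono) auto
      finally show ?thesis by (simp add: algebra_simps)
    qed
    have il: "i \<in> {2..k}" "j \<in> {2..k}" using that by auto
    \<comment> \<open>The terms with \<open>m\<close> cancel, so the estimate is in terms of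
      \<open>n\<close> alone, which is the larger of the two numbers in the application.\<close>
    have "real n * \<Delta> = (real n * a i - real m * b i) * b j - (real n * a j - real m * b j) * b i"
      unfolding \<Delta>_def by (simp add: algebra_simps)
    also have "\<bar>...\<bar> \<le> \<bar>real n * a i - real m * b i\<bar> * \<bar>b j\<bar> + \<bar>real n * a j - real m * b j\<bar> * \<bar>b i\<bar>"
      unfolding abs_mult[symmetric] by (rule abs_triangle_ineq4)
    also have "... \<le> 1 * ((1 + A) * real B) + 1 * ((1 + A) * real B)"
      using ab[OF il(1)] ab[OF il(2)] bB[OF il(1)] bB[OF il(2)] by (intro add_mono mult_mono) auto
    finally have "real n * \<bar>\<Delta>\<bar> \<le> 2 * (1 + A) * real B" by (simp add: abs_mult algebra_simps)
    hence \<Delta>le: "\<bar>\<Delta>\<bar> \<le> 2 * (1 + A) * real B / real n"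
      using n by (simp add: pos_le_divide_eq algebra_simps)
    have N0': "N1 = 0 \<and> N2 = 0"
    proof (rule ccontr)
      assume "\<not> (N1 = 0 \<and> N2 = 0)"
      hence N: "(N1, N2) \<noteq> (0, 0)" by auto
      have pr: "\<bar>t x * s y - t y * s x\<bar> \<le> 2 * (int B)\<^sup>2" if "x \<in> {1..k}" "y \<in> {1..k}" for x y
      proof -
        have "\<bar>t x * s y\<bar> \<le> int B * int B" "\<bar>t y * s x\<bar> \<le> int B * int B"
          unfolding abs_mult using tB sB that by (intro mult_mono; auto)+
        thus ?thesis by (simp add: power2_eq_square abs_le_iff)
      qed
      have "max \<bar>N1\<bar> \<bar>N2\<bar> \<le> 2 * (int B)\<^sup>2"
        using pr[of 1 j] pr[of i 1] k that unfolding N1_def N2_def by auto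
      hence mx: "of_int (max \<bar>N1\<bar> \<bar>N2\<bar>) \<le> 2 * (real B)\<^sup>2"
        by (metis (mono_tags, lifting) of_int_le_iff of_int_mult of_int_numeral of_int_of_nat_eq of_int_power)
      have "0 < max \<bar>N1\<bar> \<bar>N2\<bar>" using N by auto
      hence "(2 * (real B)\<^sup>2) powr (- w) \<le> of_int (max \<bar>N1\<bar> \<bar>N2\<bar>) powr (- w)"
        using mx w by (intro powr_mono2') auto
      hence "c * (2 * (real B)\<^sup>2) powr (- w) \<le> c * of_int (max \<bar>N1\<bar> \<bar>N2\<bar>) powr (- w)"
        using c by simp
      also have "... \<le> nearest_int_dist (of_int N1 * \<alpha> i + of_int N2 * \<alpha> j)" by (rule badly_approximable_pairsD[OF bad that N])
      also have "... \<le> \<bar>\<Delta>\<bar>" unfolding \<Delta> by (subst abs_minus_commute) (rule nearest_int_dist_le)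
      finally show False using \<Delta>le small(2) by linarith
    qed
    hence "\<bar>of_int N0\<bar> < (1::real)" using \<Delta>le small(1) \<Delta> by simp
    hence "N0 = 0" by linarith
    thus ?thesis using N0' unfolding N0_def N1_def N2_def by auto
  qed
  \<comment> \<open>A minor with column 1 is read off a pair of indices in 2..k that contains j; for
    j = 2 the partner is 3, which exists because \<open>3 \<le> k\<close>.\<close>
  have one: "t 1 * s j = t j * s 1" if "j \<in> {2..k}" for j
  proof (cases "j = 2")
    case True
    thus ?thesis using main[of 2 3] k by (simp add: mult.commute)
  next
    case False
    thus ?thesis using main[of 2 j] that by auto
  qed
  show ?thesis
  proof (cases "i = 1 \<or> j = 1")
    case True
    thus ?thesis using one[of i] one[of j] ij by (cases "i = 1"; cases "j = 1") auto
  next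
    case False
    hence "i \<in> {2..k}" "j \<in> {2..k}" using ij by auto
    thus ?thesis using main[of i j] main[of j i] by (cases i j rule: linorder_cases) auto
  qed
qed

definition int_box :: "nat \<Rightarrow> nat \<Rightarrow> ivec set" where
  "int_box k B = (\<Pi>\<^sub>E i\<in>{1..k}. {- int B..int B})"

lemma finite_int_box [simp]: "finite (int_box k B)"
  unfolding int_box_def by (intro finite_PiE) auto

definition offdiag_pairs :: "nat \<Rightarrow> (nat \<Rightarrow> real) \<Rightarrow> nat \<Rightarrow> nat \<Rightarrow> nat \<Rightarrow> (ivec \<times> ivec) set" where
  "offdiag_pairs k \<alpha> B n m = {(t, s). t \<in> int_box k B \<and> s \<in> int_box k B \<and> nonzero_vec k t \<and> nonzero_vec k s
     \<and> freq_close k \<alpha> n m t s \<and> (\<exists>i\<in>{1..k}. int n * t i \<noteq> int m * s i)}"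

lemma finite_offdiag_pairs [simp]: "finite (offdiag_pairs k \<alpha> B n m)"
  by (rule finite_subset[of _ "int_box k B \<times> int_box k B"]) (auto simp: offdiag_pairs_def)

text \<open>Here t = p v and s = q v with v_1 nonzero, so u = h v with a nonzero integer h = n p - m
  q, and closeness reads |h| |v_i - \<alpha>_i v_1| < 1. Hence each v_i is one of two integers next
  to \<alpha>_i v_1, and the lower bound for the distance of \<alpha>_2 v_1 to the integers gives
  |h| \<le> H. This leaves 2B + 1 choices for each of p, q, v_1, at most 2^k for the rest of v, and
  2H + 1 for m. The weight is small because n \<le> |n p| \<le> m B + H and H \<le> n/2 force m
  \<ge> n/(2B).\<close>

lemma offdiag_count:
  fixes B n k :: nat
  assumes k: "3 \<le> k" and w: "0 < w" and n: "1 \<le> n" and B: "1 \<le> B"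
    and bad: "badly_approximable_pairs k \<alpha> c w"
    and c: "0 < c" and A: "\<And>i. i \<in> {2..k} \<Longrightarrow> \<bar>\<alpha> i\<bar> \<le> A"
    and small: "2 * (1 + A) * real B / real n < 1" "2 * (1 + A) * real B / real n < c * (2 * (real B)\<^sup>2) powr (- w)"
    and H: "H = real B powr w / c" "H \<le> real n / 2"
  shows "(\<Sum>m=1..n. 1 / real m * real (card (offdiag_pairs k \<alpha> B n m)))
     \<le> 2 * real B / real n * ((2 * real B + 1) ^ 3 * 2 ^ k * (2 * H + 1))"
proof -
  define P where "P = {- int B..int B}"
  define V where "V = (\<lambda>(x, \<delta>). \<lambda>i\<in>{1..k}. if i = 1 then x else \<lfloor>\<alpha> i * of_int x\<rfloor> + \<delta> i) `
    (P \<times> (\<Pi>\<^sub>E i\<in>{2..k}. {0, 1 :: int}))"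
  \<comment> \<open>For q = 0 the inequality would not bound m; the empty set in this case keeps
    \<open>X\<close> finite.\<close>
  define M where "M = (\<lambda>((p, q), v :: ivec). if q = 0 then {} else {m :: nat. \<bar>real n * of_int p - real m * of_int q\<bar> \<le> H})"
  define X where "X = Sigma ((P \<times> P) \<times> V) M"
  define \<Phi> where "\<Phi> = (\<lambda>(((p, q), v), m :: nat). (m, \<lambda>i\<in>{1..k}. p * v i, \<lambda>i\<in>{1..k}. q * v i) :: nat \<times> ivec \<times> ivec)"
  define Y where "Y = Sigma {1..n} (offdiag_pairs k \<alpha> B n)"
  have H0: "0 \<le> H" using c H(1) by simp
  have finP: "finite P" and cardP: "real (card P) = 2 * real B + 1" unfolding P_def by auto
  have finV: "finite V" unfolding V_def using finP by (intro finite_imageI finite_cartesian_product finite_PiE) auto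
  have "card V \<le> card (P \<times> (\<Pi>\<^sub>E i\<in>{2..k}. {0, 1 :: int}))"
    unfolding V_def using finP by (intro card_image_le finite_cartesian_product finite_PiE) auto
  also have "... = card P * 2 ^ (k - 1)" by (simp add: card_cartesian_product card_PiE numeral_2_eq_2)
  also have "... \<le> card P * 2 ^ k" by simp
  finally have "real (card V) \<le> real (card P * 2 ^ k)" by (rule of_nat_mono)
  hence cardV: "real (card V) \<le> (2 * real B + 1) * 2 ^ k" using cardP by simp
  have M: "finite (M z) \<and> real (card (M z)) \<le> 2 * H + 1" for z
  proof -
    obtain p q v where z: "z = ((p, q), v)" by (metis prod.exhaust)
    show ?thesis
    proof (cases "q = 0")
      case False
      have sub: "M z \<subseteq> {m :: nat. \<bar>real m - real n * of_int p / of_int q\<bar> \<le> H}"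
      proof
        fix m assume "m \<in> M z"
        hence "\<bar>real n * of_int p - real m * of_int q\<bar> \<le> H" using False by (simp add: M_def z)
        moreover have "real n * of_int p - real m * of_int q = - of_int q * (real m - real n * of_int p / of_int q)"
          using False by (simp add: field_simps)
        ultimately have "\<bar>of_int q\<bar> * \<bar>real m - real n * of_int p / of_int q\<bar> \<le> H"
          by (simp add: abs_mult)
        moreover have "1 \<le> \<bar>of_int q :: real\<bar>" using False by linarith
        ultimately have "1 * \<bar>real m - real n * of_int p / of_int q\<bar> \<le> H"
          by (meson abs_ge_zero mult_right_mono order_trans)
        thus "m \<in> {m :: nat. \<bar>real m - real n * of_int p / of_int q\<bar> \<le> H}" by simp
      qed
      note fin = card_nat_near_le(1)[OF H0, of "real n * of_int p / of_int q"]
      have "card (M z) \<le> card {m :: nat. \<bar>real m - real n * of_int p / of_int q\<bar> \<le> H}"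
        by (rule card_mono[OF fin sub])
      thus ?thesis using finite_subset[OF sub fin] using card_nat_near_le(2)[OF H0, of "real n * of_int p / of_int q"] by linarith
    qed (use H0 in \<open>simp add: M_def z\<close>)
  qed
  have finX: "finite X" unfolding X_def using finP finV M by (intro finite_SigmaI finite_cartesian_product) auto
  have "real (card X) = (\<Sum>z\<in>(P \<times> P) \<times> V. real (card (M z)))"
    unfolding X_def using finP finV M by (subst card_SigmaI) auto
  also have "... \<le> (\<Sum>z\<in>(P \<times> P) \<times> V. 2 * H + 1)" using M by (intro sum_mono) auto
  also have "... = (2 * real B + 1) * (2 * real B + 1) * real (card V) * (2 * H + 1)"
    by (simp add: card_cartesian_product cardP)
  also have "... \<le> (2 * real B + 1) * (2 * real B + 1) * ((2 * real B + 1) * 2 ^ k) * (2 * H + 1)"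
    using cardV H0 by (intro mult_right_mono mult_left_mono) auto
  finally have cardX: "real (card X) \<le> (2 * real B + 1) ^ 3 * 2 ^ k * (2 * H + 1)"
    by (simp add: power3_eq_cube mult_ac)
  have key: "(m, t, s) \<in> \<Phi> ` X \<and> real n / (2 * real B) \<le> real m" if mts: "(m, t, s) \<in> Y" for m t s
  proof -
    have m: "1 \<le> m" "m \<le> n" and t: "t \<in> int_box k B" and s: "s \<in> int_box k B"
      and nz: "nonzero_vec k t" "nonzero_vec k s" and close: "freq_close k \<alpha> n m t s"
      and off: "\<exists>i\<in>{1..k}. int n * t i \<noteq> int m * s i"
      using mts unfolding Y_def offdiag_pairs_def by auto
    have tB: "\<bar>t i\<bar> \<le> int B" and sB: "\<bar>s i\<bar> \<le> int B" if "i \<in> {1..k}" for i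
      using PiE_mem[OF t[unfolded int_box_def] that] PiE_mem[OF s[unfolded int_box_def] that] by auto
    have par: "t i * s j = t j * s i" if "i \<in> {1..k}" "j \<in> {1..k}" for i j
      by (rule freq_close_minors_vanish[OF k w n B bad c A tB sB small close that])
    have k1: "1 \<in> {1..k}" using k by auto
    \<comment> \<open>If t_1 = 0, then s_1 = 0 by parallelism, and closeness puts the integers n t_i
      - m s_i below 1 in absolute value; so all of them vanish, against \<open>off\<close>.\<close>
    have t1: "t 1 \<noteq> 0"
    proof
      assume t10: "t 1 = 0"
      obtain i where i: "i \<in> {1..k}" "t i \<noteq> 0" using nz(1) unfolding nonzero_vec_def by blast
      have "s 1 = 0" using par[OF k1 i(1)] t10 i(2) by simp
      hence "\<forall>i\<in>{2..k}. \<bar>real_of_int (int n * t i - int m * s i)\<bar> < 1"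
        using close t10 unfolding freq_close_def by simp
      moreover have "z = 0" if "\<bar>real_of_int z\<bar> < 1" for z using that by linarith
      ultimately have "\<forall>i\<in>{2..k}. int n * t i - int m * s i = 0" by blast
      moreover have "int n * t 1 - int m * s 1 = 0" using t10 \<open>s 1 = 0\<close> by simp
      ultimately have "int n * t i - int m * s i = 0" if "i \<in> {1..k}" for i
        using that by (cases "i = 1") auto
      thus False using off by auto
    qed
    have s1: "s 1 \<noteq> 0"
    proof
      assume s10: "s 1 = 0"
      obtain i where i: "i \<in> {1..k}" "s i \<noteq> 0" using nz(2) unfolding nonzero_vec_def by blast
      show False using par[OF k1 i(1)] s10 i(2) t1 by simp
    qed
    obtain p q v0 where pq: "p \<noteq> 0" "q \<noteq> 0" and v01: "v0 1 \<noteq> (0::int)"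
      and tv0: "\<And>i. i \<in> {1..k} \<Longrightarrow> t i = p * v0 i" and sv0: "\<And>i. i \<in> {1..k} \<Longrightarrow> s i = q * v0 i"
      by (rule parallel_primitive_vector[where t = t and s = s and I = "{1..k}" and e = 1, OF finite_atLeastAtMost k1 par t1 s1]) blast+
    define v where "v = restrict v0 {1..k}"
    have v1: "v 1 \<noteq> 0" using v01 k1 by (simp add: v_def)
    have tv: "t i = p * v i" and sv: "s i = q * v i" if "i \<in> {1..k}" for i
      using tv0[OF that] sv0[OF that] that by (simp_all add: v_def)
    define h where "h = int n * p - int m * q"
    have u: "int n * t i - int m * s i = h * v i" if "i \<in> {1..k}" for i
      using tv[OF that] sv[OF that] by (simp add: h_def algebra_simps)
    have h0: "h \<noteq> 0" using off u by auto
    have hv: "\<bar>real_of_int h\<bar> * \<bar>of_int (v i) - \<alpha> i * of_int (v 1)\<bar> < 1" if "i \<in> {2..k}" for i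
    proof -
      have "\<bar>real_of_int (h * v i) - \<alpha> i * of_int (h * v 1)\<bar> < 1"
      proof -
        have "i \<in> {1..k}" using that by auto
        from u[OF this] u[OF k1] bspec[OF close[unfolded freq_close_def] that] show ?thesis by simp
      qed
      moreover have "real_of_int (h * v i) - \<alpha> i * of_int (h * v 1) = of_int h * (of_int (v i) - \<alpha> i * of_int (v 1))"
        by (simp add: algebra_simps)
      ultimately show ?thesis by (simp add: abs_mult)
    qed
    have h1: "1 \<le> \<bar>real_of_int h\<bar>" using h0 by linarith
    have v_near: "\<bar>of_int (v i) - \<alpha> i * of_int (v 1)\<bar> < 1" if "i \<in> {2..k}" for i
      using hv[OF that] mult_right_mono[OF h1, of "\<bar>of_int (v i) - \<alpha> i * of_int (v 1)\<bar>"] by simp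
    have ab: "\<bar>p\<bar> \<le> int B" "\<bar>q\<bar> \<le> int B" "\<bar>v 1\<bar> \<le> int B"
    proof -
      have "\<bar>p\<bar> * 1 \<le> \<bar>p\<bar> * \<bar>v 1\<bar>" "\<bar>q\<bar> * 1 \<le> \<bar>q\<bar> * \<bar>v 1\<bar>" "1 * \<bar>v 1\<bar> \<le> \<bar>p\<bar> * \<bar>v 1\<bar>"
        using v1 pq by (intro mult_mono; simp)+
      thus "\<bar>p\<bar> \<le> int B" "\<bar>q\<bar> \<le> int B" "\<bar>v 1\<bar> \<le> int B"
        using tB[OF k1] sB[OF k1] tv[OF k1] sv[OF k1] by (simp_all add: abs_mult)
    qed
    have hH: "\<bar>real_of_int h\<bar> \<le> H"
    proof -
      \<comment> \<open>The bound for the pair \<alpha>_2, \<alpha>_3 is applied to the integer pair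
        (v_1, 0), so that only the distance of \<alpha>_2 v_1 to the integers remains.\<close>
      have "c * real B powr (- w) \<le> c * of_int (max \<bar>v 1\<bar> \<bar>0\<bar>) powr (- w)"
      proof -
        have "0 < \<bar>v 1\<bar>" using v1 by simp
        moreover have "real_of_int \<bar>v 1\<bar> \<le> real B" using ab(3) by linarith
        ultimately have "real B powr (- w) \<le> real_of_int \<bar>v 1\<bar> powr (- w)"
          using w by (intro powr_mono2') auto
        thus ?thesis using c by simp
      qed
      also have "... \<le> nearest_int_dist (of_int (v 1) * \<alpha> 2 + of_int 0 * \<alpha> 3)"
        using k v1 by (intro badly_approximable_pairsD[OF bad]) auto
      also have "... \<le> \<bar>\<alpha> 2 * of_int (v 1) - of_int (v 2)\<bar>"
        using nearest_int_dist_le by (simp add: mult.commute)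
      finally have low: "c * real B powr (- w) \<le> \<bar>of_int (v 2) - \<alpha> 2 * of_int (v 1)\<bar>"
        by (simp add: abs_minus_commute)
      have "\<bar>real_of_int h\<bar> * (c * real B powr (- w)) \<le> 1"
        using mult_left_mono[OF low, of "\<bar>real_of_int h\<bar>"] hv[of 2] k by auto
      thus ?thesis unfolding H(1) using c B by (simp add: powr_minus field_simps)
    qed
    have near: "\<bar>real n * of_int p - real m * of_int q\<bar> \<le> H"
      using hH by (simp add: h_def)
    have mM: "m \<in> M ((p, q), v)" using near pq(2) by (simp add: M_def)
    have vV: "v \<in> V"
    proof -
      define \<delta> where "\<delta> = (\<lambda>i\<in>{2..k}. v i - \<lfloor>\<alpha> i * of_int (v 1)\<rfloor>)"
      have "v i - \<lfloor>\<alpha> i * of_int (v 1)\<rfloor> \<in> {0, 1}" if "i \<in> {2..k}" for i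
      proof -
        have "v i - \<lfloor>\<alpha> i * of_int (v 1)\<rfloor> = 0 \<or> v i - \<lfloor>\<alpha> i * of_int (v 1)\<rfloor> = 1"
          using v_near[OF that] by linarith
        thus ?thesis by simp
      qed
      hence "\<delta> \<in> (\<Pi>\<^sub>E i\<in>{2..k}. {0, 1})" unfolding \<delta>_def restrict_PiE_iff by blast
      moreover have "v 1 \<in> P" using ab(3) by (auto simp: P_def)
      moreover have "v = (\<lambda>(x, \<delta>). \<lambda>i\<in>{1..k}. if i = 1 then x else \<lfloor>\<alpha> i * of_int x\<rfloor> + \<delta> i) (v 1, \<delta>)"
        unfolding split_conv by (rule ext) (simp add: \<delta>_def v_def)
      ultimately show ?thesis unfolding V_def by blast
    qed
    have "(((p, q), v), m) \<in> X" unfolding X_def using mM vV ab by (auto simp: P_def)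
    moreover have "(m, t, s) = \<Phi> (((p, q), v), m)"
    proof -
      have "t = (\<lambda>i\<in>{1..k}. p * v i)"
      proof
        fix i show "t i = (\<lambda>i\<in>{1..k}. p * v i) i"
          using tv[of i] PiE_arb[OF t[unfolded int_box_def], of i] by (cases "i \<in> {1..k}") simp_all
      qed
      moreover have "s = (\<lambda>i\<in>{1..k}. q * v i)"
      proof
        fix i show "s i = (\<lambda>i\<in>{1..k}. q * v i) i"
          using sv[of i] PiE_arb[OF s[unfolded int_box_def], of i] by (cases "i \<in> {1..k}") simp_all
      qed
      ultimately show ?thesis unfolding \<Phi>_def by simp
    qed
    ultimately have 1: "(m, t, s) \<in> \<Phi> ` X" by blast
    have "real n * 1 \<le> real n * \<bar>of_int p\<bar>" using pq(1) by (intro mult_left_mono) linarith+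
    also have "... = \<bar>real n * of_int p\<bar>" by (simp add: abs_mult)
    also have "... \<le> \<bar>real m * of_int q\<bar> + H" using near by linarith
    also have "\<bar>real m * of_int q\<bar> \<le> real m * real B"
    proof -
      have "\<bar>real_of_int q\<bar> \<le> real B" using ab(2) by linarith
      thus ?thesis by (simp add: abs_mult mult_left_mono)
    qed
    finally have "real n / 2 \<le> real m * real B" using H(2) by linarith
    hence "real n / (2 * real B) \<le> real m" using B by (simp add: field_simps)
    with 1 show ?thesis by blast
  qed
  have finY: "finite Y" unfolding Y_def by auto
  have "Y \<subseteq> \<Phi> ` X"
  proof
    fix x assume "x \<in> Y"
    thus "x \<in> \<Phi> ` X" using key[of "fst x" "fst (snd x)" "snd (snd x)"] by simp
  qed
  hence "card Y \<le> card (\<Phi> ` X)" using finX by (intro card_mono finite_imageI)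
  also have "... \<le> card X" by (rule card_image_le[OF finX])
  finally have cardY: "real (card Y) \<le> (2 * real B + 1) ^ 3 * 2 ^ k * (2 * H + 1)" using cardX by linarith
  have "(\<Sum>m=1..n. 1 / real m * real (card (offdiag_pairs k \<alpha> B n m)))
     = (\<Sum>m=1..n. \<Sum>ts\<in>offdiag_pairs k \<alpha> B n m. 1 / real m)" by simp
  also have "... = (\<Sum>(m, ts)\<in>Y. 1 / real m)"
    unfolding Y_def by (rule sum.Sigma) auto
  also have "... \<le> (\<Sum>(m, ts)\<in>Y. 2 * real B / real n)"
  proof (intro sum_mono, clarify)
    fix m t s assume "(m, t, s) \<in> Y"
    hence "real n / (2 * real B) \<le> real m" using key by blast
    hence "1 / real m \<le> 1 / (real n / (2 * real B))" using B n by (intro frac_le) auto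
    thus "1 / real m \<le> 2 * real B / real n" by simp
  qed
  also have "... = 2 * real B / real n * real (card Y)" by (simp add: case_prod_unfold)
  also have "... \<le> 2 * real B / real n * ((2 * real B + 1) ^ 3 * 2 ^ k * (2 * H + 1))"
    using cardY by (intro mult_left_mono) auto
  finally show ?thesis .
qed

section \<open>Frequencies on the diagonal\<close>

definition diag_pairs :: "nat \<Rightarrow> (nat \<Rightarrow> nat) \<Rightarrow> (nat \<Rightarrow> nat) \<Rightarrow> nat \<Rightarrow> nat \<Rightarrow> (ivec \<times> ivec) set" where
  "diag_pairs k a a' n m = {(t, s). t \<in> freq_box k a \<and> s \<in> freq_box k a' \<and> nonzero_vec k t \<and> nonzero_vec k s
     \<and> (\<forall>i\<in>{1..k}. int n * t i = int m * s i)}"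

lemma finite_diag_pairs [simp]: "finite (diag_pairs k a a' n m)"
  by (rule finite_subset[of _ "freq_box k a \<times> freq_box k a'"]) (auto simp: diag_pairs_def)

text \<open>Coprimality of n' and m' turns n t = m s into t = m' v, s = n' v with an integer vector
  v in a box of half-sides \<open>X i\<close>. If all \<open>X i\<close> are at least 1, then 2X + 1
  \<le> 3X and the count is of the order of the volume. If some \<open>X j\<close> is below 1, then
  v_j = 0 and only k - 1 coordinates are free; this saving is recorded in the exponent of the second
  term.\<close>

lemma diag_count:
  fixes n m k B :: nat
  assumes k: "1 \<le> k" and n: "1 \<le> n" and m: "1 \<le> m"
    and B: "\<And>i. i \<in> {1..k} \<Longrightarrow> 3 * 4 ^ a' i \<le> B"
    and n': "n' = n div gcd n m" and m': "m' = m div gcd n m"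
  shows "real (card (diag_pairs k a a' n m))
    \<le> 3 ^ k * (\<Prod>i=1..k. min (3 * 4 ^ a i / real m') (3 * 4 ^ a' i / real n')) + (3 * real B / real n') ^ (k - 1)"
proof -
  have n0: "0 < n'" and m0: "0 < m'" using n m unfolding n' m' by (auto simp: div_greater_zero_iff)
  have cop: "coprime n' m'" unfolding n' m' using n by (intro div_gcd_coprime) auto
  have nd: "n = n' * gcd n m" and md: "m = m' * gcd n m" unfolding n' m' by auto
  have g0: "0 < gcd n m" using n by simp
  define X where "X i = min (3 * 4 ^ a i / real m') (3 * 4 ^ a' i / real n')" for i
  have X0: "0 \<le> X i" for i unfolding X_def by simp
  define J where "J i = {- \<lfloor>X i\<rfloor>..\<lfloor>X i\<rfloor>}" for i
  have cardJ: "real (card (J i)) \<le> 2 * X i + 1" for i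
    unfolding J_def using X0[of i] by (simp add: of_nat_nat)
  define W where "W = {v \<in> \<Pi>\<^sub>E i\<in>{1..k}. J i. nonzero_vec k v}"
  have finPi: "finite (\<Pi>\<^sub>E i\<in>{1..k}. J i)" unfolding J_def by (intro finite_PiE) auto
  have finW: "finite W" unfolding W_def using finPi by simp
  have "diag_pairs k a a' n m \<subseteq> (\<lambda>v. (\<lambda>i\<in>{1..k}. int m' * v i, \<lambda>i\<in>{1..k}. int n' * v i)) ` W"
  proof (clarify)
    fix t s assume "(t, s) \<in> diag_pairs k a a' n m"
    hence t: "t \<in> freq_box k a" and s: "s \<in> freq_box k a'" and nz: "nonzero_vec k t"
      and eq: "\<And>i. i \<in> {1..k} \<Longrightarrow> int n * t i = int m * s i"
      unfolding diag_pairs_def by auto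
    define v where "v = (\<lambda>i\<in>{1..k}. t i div int m')"
    have tv: "t i = int m' * v i" and sv: "s i = int n' * v i" if i: "i \<in> {1..k}" for i
    proof -
      have "int (gcd n m) * (int n' * t i) = int (gcd n m) * (int m' * s i)"
        using eq[OF i] by (subst (asm) nd, subst (asm) (2) md) (simp add: mult_ac)
      hence e: "int n' * t i = int m' * s i" using n by auto
      hence "int m' dvd int n' * t i" by simp
      hence "int m' dvd t i" using cop by (simp add: coprime_commute coprime_dvd_mult_right_iff)
      thus tv: "t i = int m' * v i" using i by (simp add: v_def)
      have "int m' * (int n' * v i) = int m' * s i" using e unfolding tv by simp
      hence "int n' * v i = s i" using m0 by simp
      thus "s i = int n' * v i" by simp
    qed
    have vJ: "v i \<in> J i" if i: "i \<in> {1..k}" for i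
    proof -
      have "\<bar>t i\<bar> \<le> int (3 * 4 ^ a i)" "\<bar>s i\<bar> \<le> int (3 * 4 ^ a' i)"
        using PiE_mem[OF t[unfolded freq_box_def] i] PiE_mem[OF s[unfolded freq_box_def] i] by auto
      hence "real_of_int \<bar>t i\<bar> \<le> real_of_int (int (3 * 4 ^ a i))" "real_of_int \<bar>s i\<bar> \<le> real_of_int (int (3 * 4 ^ a' i))"
        by (simp_all only: of_int_le_iff)
      hence "real_of_int \<bar>t i\<bar> \<le> 3 * 4 ^ a i" "real_of_int \<bar>s i\<bar> \<le> 3 * 4 ^ a' i"
        by simp_all
      hence "real m' * real_of_int \<bar>v i\<bar> \<le> 3 * 4 ^ a i" "real n' * real_of_int \<bar>v i\<bar> \<le> 3 * 4 ^ a' i"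
        unfolding tv[OF i] sv[OF i] by (simp_all add: abs_mult)
      hence "real_of_int \<bar>v i\<bar> \<le> X i"
        unfolding X_def using n0 m0 by (simp add: field_simps)
      hence "\<bar>v i\<bar> \<le> \<lfloor>X i\<rfloor>" by (simp add: le_floor_iff)
      thus ?thesis unfolding J_def by (simp add: abs_le_iff)
    qed
    have "nonzero_vec k v" using nz tv unfolding nonzero_vec_def by auto
    moreover have "v \<in> (\<Pi>\<^sub>E i\<in>{1..k}. J i)"
      using vJ by (intro PiE_I) (auto simp: v_def)
    ultimately have "v \<in> W" unfolding W_def by blast
    moreover have "t = (\<lambda>i\<in>{1..k}. int m' * v i)"
    proof
      fix i show "t i = (\<lambda>i\<in>{1..k}. int m' * v i) i"
        using tv[of i] PiE_arb[OF t[unfolded freq_box_def], of i] by (cases "i \<in> {1..k}") simp_all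
    qed
    moreover have "s = (\<lambda>i\<in>{1..k}. int n' * v i)"
    proof
      fix i show "s i = (\<lambda>i\<in>{1..k}. int n' * v i) i"
        using sv[of i] PiE_arb[OF s[unfolded freq_box_def], of i] by (cases "i \<in> {1..k}") simp_all
    qed
    ultimately show "(t, s) \<in> (\<lambda>v. (\<lambda>i\<in>{1..k}. int m' * v i, \<lambda>i\<in>{1..k}. int n' * v i)) ` W" by blast
  qed
  hence "card (diag_pairs k a a' n m) \<le> card ((\<lambda>v. (\<lambda>i\<in>{1..k}. int m' * v i, \<lambda>i\<in>{1..k}. int n' * v i)) ` W)"
    using finW by (intro card_mono) auto
  also have "... \<le> card W" by (rule card_image_le[OF finW])
  finally have cW: "real (card (diag_pairs k a a' n m)) \<le> real (card W)" by simp
  have p1: "0 \<le> 3 ^ k * (\<Prod>i=1..k. X i)" using X0 by (simp add: prod_nonneg)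
  have p2: "0 \<le> (3 * real B / real n') ^ (k - 1)" by simp
  show ?thesis
  proof (cases "\<forall>i\<in>{1..k}. 1 \<le> X i")
    case True
    have "card W \<le> card (\<Pi>\<^sub>E i\<in>{1..k}. J i)" unfolding W_def using finPi by (intro card_mono) auto
    also have "... = (\<Prod>i=1..k. card (J i))" by (simp add: card_PiE)
    finally have "real (card W) \<le> (\<Prod>i=1..k. real (card (J i)))" by (metis of_nat_mono of_nat_prod)
    also have "... \<le> (\<Prod>i=1..k. 3 * X i)"
      using True cardJ by (intro prod_mono) (smt (verit) of_nat_0_le_iff)
    also have "... = 3 ^ k * (\<Prod>i=1..k. X i)" by (simp add: prod.distrib)
    finally show ?thesis using cW p2 unfolding X_def by linarith
  next
    case False
    then obtain j where j: "j \<in> {1..k}" "X j < 1" by force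
    have "real (card W) \<le> (3 * real B / real n') ^ (k - 1)"
    proof (cases "W = {}")
      case False
      then obtain v where v: "v \<in> (\<Pi>\<^sub>E i\<in>{1..k}. J i)" "nonzero_vec k v" unfolding W_def by blast
      then obtain i0 where i0: "i0 \<in> {1..k}" "v i0 \<noteq> 0" unfolding nonzero_vec_def by blast
      have XB: "X i \<le> real B / real n'" if "i \<in> {1..k}" for i
      proof -
        have "real (3 * 4 ^ a' i) \<le> real B" using B[OF that] by (rule of_nat_mono)
        hence "3 * 4 ^ a' i / real n' \<le> real B / real n'" by (intro divide_right_mono) auto
        thus ?thesis unfolding X_def by linarith
      qed
      have "v i0 \<in> J i0" using v(1) i0(1) by auto
      hence "- \<lfloor>X i0\<rfloor> \<le> v i0" "v i0 \<le> \<lfloor>X i0\<rfloor>" unfolding J_def by simp_all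
      hence "1 \<le> \<lfloor>X i0\<rfloor>" using i0(2) by linarith
      hence "1 \<le> X i0" by linarith
      \<comment> \<open>A nonzero v exists only if B/n' \<ge> 1, and this absorbs the 1 in 2X + 1
        below.\<close>
      hence Y1: "1 \<le> real B / real n'" using XB[OF i0(1)] by linarith
      have "\<lfloor>X j\<rfloor> = 0" using j(2) X0[of j] by linarith
      hence Jj: "card (J j) = 1" unfolding J_def by simp
      have "card W \<le> card (\<Pi>\<^sub>E i\<in>{1..k}. J i)" unfolding W_def using finPi by (intro card_mono) auto
      also have "... = (\<Prod>i=1..k. card (J i))" by (simp add: card_PiE)
      also have "... = card (J j) * (\<Prod>i\<in>{1..k}-{j}. card (J i))" using j(1) by (intro prod.remove) auto
      finally have "real (card W) \<le> (\<Prod>i\<in>{1..k}-{j}. real (card (J i)))"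
        unfolding Jj by (metis mult_1 of_nat_mono of_nat_prod)
      also have "... \<le> (\<Prod>i\<in>{1..k}-{j}. 3 * real B / real n')"
      proof (intro prod_mono conjI)
        fix i assume "i \<in> {1..k} - {j}"
        hence "X i \<le> real B / real n'" using XB by blast
        hence "2 * X i + 1 \<le> 3 * (real B / real n')" using Y1 by linarith
        thus "real (card (J i)) \<le> 3 * real B / real n'" using cardJ[of i] by simp
      qed simp
      also have "... = (3 * real B / real n') ^ (k - 1)" using j(1) by simp
      finally show ?thesis .
    qed simp
    thus ?thesis using cW p1 unfolding X_def by linarith
  qed
qed

text \<open>A two-sided geometric series of ratio 1/2 with its peak where 2^b is near z; this is why
  the bound is uniform in z and L.\<close>

lemma sum_min_geometric_le:
  fixes z :: real
  assumes "0 < z"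
  shows "(\<Sum>b\<le>L. min (z / 2 ^ b) (2 ^ b / z)) \<le> 4"
proof -
  have small: "(\<Sum>b\<le>L. min (z / 2 ^ b) (2 ^ b / z)) \<le> 2 * z" if "0 < z" for L :: nat and z :: real
  proof -
    have "(\<Sum>b\<le>L. min (z / 2 ^ b) (2 ^ b / z)) \<le> (\<Sum>b\<le>L. z * (1 / 2) ^ b)"
      by (intro sum_mono) (simp add: power_one_over)
    also have "... = z * (\<Sum>b\<le>L. (1 / 2) ^ b)" by (simp add: sum_distrib_left)
    also have "(\<Sum>b\<le>L. (1 / 2 :: real) ^ b) = 2 - (1 / 2) ^ L"
      by (induction L) auto
    also have "z * (2 - (1 / 2) ^ L) \<le> z * 2" using that by (intro mult_left_mono) auto
    finally show ?thesis by simp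
  qed
  \<comment> \<open>The subtracted 1/z carries the induction: for z/2 the hypothesis gives 4 - 2/z,
    and the new first term adds at most 1/z.\<close>
  have large: "(\<Sum>b\<le>L. min (z / 2 ^ b) (2 ^ b / z)) \<le> 4 - 1 / z" if "1 \<le> z" for z :: real
    using that
  proof (induction L arbitrary: z)
    case 0
    have "1 / z \<le> 1" using 0 by simp
    hence "2 * (1 / z) \<le> 4" by linarith
    thus ?case by simp
  next
    case (Suc L)
    have "(\<Sum>b\<le>Suc L. min (z / 2 ^ b) (2 ^ b / z)) = min z (1 / z) + (\<Sum>b\<le>L. min ((z / 2) / 2 ^ b) (2 ^ b / (z / 2)))"
      unfolding sum.atMost_Suc_shift by (simp add: mult.commute)
    moreover have "min z (1 / z) + (\<Sum>b\<le>L. min ((z / 2) / 2 ^ b) (2 ^ b / (z / 2))) \<le> 4 - 1 / z"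
    proof (cases "2 \<le> z")
      case True
      have "(\<Sum>b\<le>L. min ((z / 2) / 2 ^ b) (2 ^ b / (z / 2))) \<le> 4 - 1 / (z / 2)"
        using True by (intro Suc.IH) auto
      hence "(\<Sum>b\<le>L. min ((z / 2) / 2 ^ b) (2 ^ b / (z / 2))) \<le> 4 - 2 * (1 / z)" by simp
      moreover have "min z (1 / z) \<le> 1 / z" by simp
      ultimately show ?thesis by linarith
    next
      case False
      have "(\<Sum>b\<le>L. min ((z / 2) / 2 ^ b) (2 ^ b / (z / 2))) \<le> 2 * (z / 2)"
        using Suc.prems by (intro small) auto
      moreover have "2 * (1 / z) + z \<le> 4"
      proof -
        have "(z - 1) * (z - 2) \<le> 0" using False Suc.prems by (simp add: mult_nonneg_nonpos)
        thus ?thesis using Suc.prems by (simp add: field_simps)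
      qed
      ultimately show ?thesis by linarith
    qed
    ultimately show ?case by simp
  qed
  show ?thesis
  proof (cases "1 \<le> z")
    case True
    have "0 \<le> 1 / z" using True by simp
    thus ?thesis using large[OF True] by linarith
  next
    case False
    thus ?thesis using small[OF assms, of L] by linarith
  qed
qed

text \<open>Separates a minimum into a geometric mean, sensitive only to the product, and a factor
  that measures the imbalance.\<close>

lemma min_eq_sqrt_mult:
  fixes x y :: real
  assumes "0 < x" "0 < y"
  shows "min x y = sqrt (x * y) * min (sqrt (x / y)) (sqrt (y / x))"
proof -
  have "sqrt (x * y) * sqrt (x / y) = x" "sqrt (x * y) * sqrt (y / x) = y"
    unfolding real_sqrt_mult[symmetric] using assms by (simp_all add: power2_eq_square[symmetric])
  thus ?thesis using assms by (simp add: min_mult_distrib_left)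
qed

text \<open>The geometric means multiply to a quantity that depends on b only through its fixed sum,
  while the imbalance factors split over the coordinates and add up to at most 4 in each. So the sum
  over all boxes costs a constant and not a power of log n. Scales are powers of 4 so that the
  square roots are powers of 2; 12 is this 4 times the 3 from the degrees.\<close>

lemma sum_prod_min_le:
  fixes a :: "nat \<Rightarrow> nat" and \<A> :: "(nat \<Rightarrow> nat) set"
  assumes mu: "0 < \<mu>" "0 < \<nu>" and k: "1 \<le> k"
    and sub: "\<A> \<subseteq> (\<Pi>\<^sub>E i\<in>{1..k}. {..L})" and sumA: "\<And>b. b \<in> \<A> \<Longrightarrow> (\<Sum>i=1..k. b i) = A'"
    and suma: "(\<Sum>i=1..k. a i) = A"
  shows "(\<Sum>b\<in>\<A>. \<Prod>i=1..k. min (3 * 4 ^ a i / \<mu>) (3 * 4 ^ b i / \<nu>))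
     \<le> 12 ^ k * sqrt (4 ^ A * 4 ^ A' / (\<mu> * \<nu>) ^ k)"
proof -
  define z where "z i = 2 ^ a i * sqrt (\<nu> / \<mu>)" for i
  have z: "0 < z i" for i unfolding z_def using mu by simp
  have four: "(4::real) ^ j = (2 ^ j) ^ 2" for j by (simp add: power2_eq_square power_mult_distrib[symmetric])
  have "(\<Prod>i=1..k. min (3 * 4 ^ a i / \<mu>) (3 * 4 ^ b i / \<nu>))
      = 3 ^ k * sqrt (4 ^ A * 4 ^ A' / (\<mu> * \<nu>) ^ k) * (\<Prod>i=1..k. min (z i / 2 ^ b i) (2 ^ b i / z i))"
    if b: "b \<in> \<A>" for b
  proof -
    have "min (3 * 4 ^ a i / \<mu>) (3 * 4 ^ b i / \<nu>)
        = 3 * sqrt (4 ^ a i * 4 ^ b i / (\<mu> * \<nu>)) * min (z i / 2 ^ b i) (2 ^ b i / z i)" for i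
    proof -
      have e1: "(3 * 4 ^ a i / \<mu>) * (3 * 4 ^ b i / \<nu>) = 3\<^sup>2 * (4 ^ a i * 4 ^ b i / (\<mu> * \<nu>))"
        by (simp add: power2_eq_square)
      have e2: "(3 * 4 ^ a i / \<mu>) / (3 * 4 ^ b i / \<nu>) = (2 ^ a i / 2 ^ b i)\<^sup>2 * (\<nu> / \<mu>)"
        "(3 * 4 ^ b i / \<nu>) / (3 * 4 ^ a i / \<mu>) = (2 ^ b i / 2 ^ a i)\<^sup>2 / (\<nu> / \<mu>)"
      proof -
        have "4 ^ a i / 4 ^ b i = (2 ^ a i / 2 ^ b i :: real)\<^sup>2" "4 ^ b i / 4 ^ a i = (2 ^ b i / 2 ^ a i :: real)\<^sup>2"
          unfolding four power_divide by simp_all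
        moreover have "(3 * 4 ^ a i / \<mu>) / (3 * 4 ^ b i / \<nu>) = 4 ^ a i / 4 ^ b i * (\<nu> / \<mu>)"
          "(3 * 4 ^ b i / \<nu>) / (3 * 4 ^ a i / \<mu>) = 4 ^ b i / 4 ^ a i / (\<nu> / \<mu>)"
          by simp_all
        ultimately show "(3 * 4 ^ a i / \<mu>) / (3 * 4 ^ b i / \<nu>) = (2 ^ a i / 2 ^ b i)\<^sup>2 * (\<nu> / \<mu>)"
          "(3 * 4 ^ b i / \<nu>) / (3 * 4 ^ a i / \<mu>) = (2 ^ b i / 2 ^ a i)\<^sup>2 / (\<nu> / \<mu>)" by simp_all
      qed
      have "min (3 * 4 ^ a i / \<mu>) (3 * 4 ^ b i / \<nu>)
         = sqrt (3\<^sup>2 * (4 ^ a i * 4 ^ b i / (\<mu> * \<nu>)))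
           * min (sqrt ((2 ^ a i / 2 ^ b i)\<^sup>2 * (\<nu> / \<mu>))) (sqrt ((2 ^ b i / 2 ^ a i)\<^sup>2 / (\<nu> / \<mu>)))"
      proof -
        have "0 < 3 * 4 ^ a i / \<mu>" "0 < 3 * 4 ^ b i / \<nu>" using mu by simp_all
        from min_eq_sqrt_mult[OF this] show ?thesis unfolding e1 e2 .
      qed
      also have "sqrt (3\<^sup>2 * (4 ^ a i * 4 ^ b i / (\<mu> * \<nu>))) = 3 * sqrt (4 ^ a i * 4 ^ b i / (\<mu> * \<nu>))"
        by (subst real_sqrt_mult) simp
      also have "sqrt ((2 ^ a i / 2 ^ b i)\<^sup>2 * (\<nu> / \<mu>)) = z i / 2 ^ b i"
        by (subst real_sqrt_mult) (simp add: z_def)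
      also have "sqrt ((2 ^ b i / 2 ^ a i)\<^sup>2 / (\<nu> / \<mu>)) = 2 ^ b i / z i"
        by (subst real_sqrt_divide) (simp add: z_def)
      finally show ?thesis .
    qed
    hence "(\<Prod>i=1..k. min (3 * 4 ^ a i / \<mu>) (3 * 4 ^ b i / \<nu>))
      = 3 ^ k * (\<Prod>i=1..k. sqrt (4 ^ a i * 4 ^ b i / (\<mu> * \<nu>))) * (\<Prod>i=1..k. min (z i / 2 ^ b i) (2 ^ b i / z i))"
      by (simp add: prod.distrib)
    also have "(\<Prod>i=1..k. sqrt (4 ^ a i * 4 ^ b i / (\<mu> * \<nu>))) = sqrt (\<Prod>i=1..k. 4 ^ a i * 4 ^ b i / (\<mu> * \<nu>))"
    proof -
      have "(\<Prod>i\<in>I. sqrt (f i)) = sqrt (\<Prod>i\<in>I. f i)" if "finite I" for I :: "nat set" and f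
        using that by (induction I) (auto simp: real_sqrt_mult)
      thus ?thesis by simp
    qed
    also have "(\<Prod>i=1..k. 4 ^ a i * 4 ^ b i / (\<mu> * \<nu>)) = 4 ^ A * 4 ^ A' / (\<mu> * \<nu>) ^ k"
      using suma sumA[OF b] by (simp add: prod.distrib prod_dividef power_sum[symmetric])
    finally show ?thesis .
  qed
  hence "(\<Sum>b\<in>\<A>. \<Prod>i=1..k. min (3 * 4 ^ a i / \<mu>) (3 * 4 ^ b i / \<nu>))
     = 3 ^ k * sqrt (4 ^ A * 4 ^ A' / (\<mu> * \<nu>) ^ k) * (\<Sum>b\<in>\<A>. \<Prod>i=1..k. min (z i / 2 ^ b i) (2 ^ b i / z i))"
    by (simp add: sum_distrib_left)
  also have "... \<le> 3 ^ k * sqrt (4 ^ A * 4 ^ A' / (\<mu> * \<nu>) ^ k) * 4 ^ k"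
  proof (rule mult_left_mono)
    have "(\<Sum>b\<in>\<A>. \<Prod>i=1..k. min (z i / 2 ^ b i) (2 ^ b i / z i))
       \<le> (\<Sum>b\<in>(\<Pi>\<^sub>E i\<in>{1..k}. {..L}). \<Prod>i=1..k. min (z i / 2 ^ b i) (2 ^ b i / z i))"
      using sub z by (intro sum_mono2 finite_PiE prod_nonneg) (auto intro: less_imp_le)
    also have "... = (\<Prod>i=1..k. \<Sum>b\<le>L. min (z i / 2 ^ b) (2 ^ b / z i))"
      by (rule prod_sum_PiE[symmetric]) auto
    also have "... \<le> (\<Prod>i=1..k. 4)"
      using z by (intro prod_mono conjI sum_min_geometric_le sum_nonneg) (auto intro: less_imp_le)
    finally show "(\<Sum>b\<in>\<A>. \<Prod>i=1..k. min (z i / 2 ^ b i) (2 ^ b i / z i)) \<le> 4 ^ k" by simp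
  qed (use mu in auto)
  also have "... = 12 ^ k * sqrt (4 ^ A * 4 ^ A' / (\<mu> * \<nu>) ^ k)"
    by (simp add: power_mult_distrib[symmetric])
  finally show ?thesis .
qed

section \<open>Summation over reduced fractions\<close>

lemma sum_inverse_squares_le: "(\<Sum>j=1..N. 1 / (real j)\<^sup>2) \<le> 2"
proof -
  have "(\<Sum>j=1..N. 1 / (real j)\<^sup>2) \<le> 2 - 1 / real N" if "1 \<le> N"
    using that
  proof (induction N rule: dec_induct)
    case (step N)
    have "1 / (real (Suc N))\<^sup>2 \<le> 1 / real N - 1 / real (Suc N)"
    proof -
      have "1 / (real (Suc N))\<^sup>2 \<le> 1 / (real N * real (Suc N))"
        using step.hyps unfolding power2_eq_square by (intro divide_left_mono mult_right_mono) auto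
      also have "... = 1 / real N - 1 / real (Suc N)"
        using step.hyps by (simp add: diff_frac_eq)
      finally show ?thesis .
    qed
    with step show ?case by simp
  qed simp
  thus ?thesis by (cases "N = 0") (auto intro: order_trans[of _ "2 - 1 / real N"])
qed

text \<open>With n fixed, m is recovered from the reduced form of n/m. The sum is therefore at most
  the one over all pairs of positive integers, which is a product of two sums, each at most
  2.\<close>

lemma sum_reduced_fraction_le:
  fixes n :: nat
  assumes n: "1 \<le> n" and fin: "finite M" and pos: "\<And>m. m \<in> M \<Longrightarrow> 1 \<le> m"
  shows "(\<Sum>m\<in>M. 1 / (real (n div gcd n m) * real (m div gcd n m))\<^sup>2) \<le> 4"
proof -
  define \<phi> where "\<phi> m = (n div gcd n m, m div gcd n m)" for m
  have inj: "inj_on \<phi> M"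
  proof (rule inj_onI)
    fix m l assume "m \<in> M" "l \<in> M" and e: "\<phi> m = \<phi> l"
    have g: "gcd n m > 0" "gcd n l > 0" using n by auto
    have q: "n div gcd n m > 0" using n by (auto simp: div_greater_zero_iff)
    have e1: "n div gcd n m = n div gcd n l" and e2: "m div gcd n m = l div gcd n l"
      using e unfolding \<phi>_def by simp_all
    have "n div gcd n m * gcd n m = n div gcd n l * gcd n l" by simp
    hence "gcd n m = gcd n l" using q unfolding e1 by (metis nat_mult_eq_cancel1)
    moreover have "m div gcd n m * gcd n m = m" "l div gcd n l * gcd n l = l" by simp_all
    ultimately show "m = l" using e2 by metis
  qed
  define N where "N = Max (insert n M)"
  have N: "m \<le> N" if "m \<in> insert n M" for m unfolding N_def using fin that by (intro Max_ge) auto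
  have sub: "\<phi> ` M \<subseteq> {1..N} \<times> {1..N}"
  proof
    fix x assume "x \<in> \<phi> ` M"
    then obtain m where m: "m \<in> M" "x = \<phi> m" by blast
    have "1 \<le> n div gcd n m" "1 \<le> m div gcd n m"
      using n pos[OF m(1)] by (auto simp: Suc_le_eq div_greater_zero_iff)
    moreover have "n div gcd n m \<le> N" "m div gcd n m \<le> N"
      using N[of n] N[of m] m(1) by (meson div_le_dividend insertCI le_trans)+
    ultimately show "x \<in> {1..N} \<times> {1..N}" unfolding m(2) \<phi>_def by auto
  qed
  have "(\<Sum>m\<in>M. 1 / (real (n div gcd n m) * real (m div gcd n m))\<^sup>2) = (\<Sum>x\<in>\<phi> ` M. 1 / (real (fst x) * real (snd x))\<^sup>2)"
    by (subst sum.reindex[OF inj]) (simp add: \<phi>_def)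
  also have "... \<le> (\<Sum>x\<in>{1..N} \<times> {1..N}. 1 / (real (fst x) * real (snd x))\<^sup>2)"
    using sub by (intro sum_mono2) auto
  also have "... = (\<Sum>i=1..N. 1 / (real i)\<^sup>2) * (\<Sum>j=1..N. 1 / (real j)\<^sup>2)"
    by (simp add: sum_product sum.cartesian_product case_prod_unfold power_mult_distrib)
  also have "... \<le> 2 * 2"
    by (intro mult_mono sum_inverse_squares_le sum_nonneg) auto
  finally show ?thesis by simp
qed

section \<open>The variance bound\<close>

definition corr_pairs :: "nat \<Rightarrow> (nat \<Rightarrow> real) \<Rightarrow> nat \<Rightarrow> (nat \<Rightarrow> nat) \<Rightarrow> nat \<Rightarrow> (nat \<Rightarrow> nat) \<Rightarrow> (ivec \<times> ivec) set" where
  "corr_pairs k \<alpha> n a m a' = {(t, s). t \<in> freq_box k a \<and> s \<in> freq_box k a' \<and> nonzero_vec k t \<and> nonzero_vec k s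
     \<and> freq_close k \<alpha> n m t s}"

lemma finite_corr_pairs [simp]: "finite (corr_pairs k \<alpha> n a m a')"
  by (rule finite_subset[of _ "freq_box k a \<times> freq_box k a'"]) (auto simp: corr_pairs_def)

lemma freq_close_sym: "freq_close k \<alpha> n m t s \<longleftrightarrow> freq_close k \<alpha> m n s t"
proof -
  have "\<bar>of_int (int n * t i - int m * s i) - \<alpha> i * of_int (int n * t 1 - int m * s 1)\<bar>
      = \<bar>of_int (int m * s i - int n * t i) - \<alpha> i * of_int (int m * s 1 - int n * t 1)\<bar>" for i
    by (simp add: abs_if algebra_simps)
  thus ?thesis unfolding freq_close_def by simp
qed

lemma card_corr_pairs_sym: "card (corr_pairs k \<alpha> n a m a') = card (corr_pairs k \<alpha> m a' n a)"
proof -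
  have "corr_pairs k \<alpha> m a' n a = prod.swap ` corr_pairs k \<alpha> n a m a'"
  proof -
    have "(t, s) \<in> corr_pairs k \<alpha> m a' n a \<longleftrightarrow> (s, t) \<in> corr_pairs k \<alpha> n a m a'" for t s
      unfolding corr_pairs_def using freq_close_sym[of k \<alpha> m n t s] by blast
    thus ?thesis by (auto simp: image_iff Bex_def)
  qed
  thus ?thesis by (simp add: card_image)
qed

text \<open>The boxes used for n: the total exponent \<open>S\<close> fixes the volume, and the cap
  n^\<tau> keeps the frequencies, which are at most 3 * 4^(a_i), within
  \<open>freq_bound\<close>.\<close>

definition scale_box :: "nat \<Rightarrow> real \<Rightarrow> nat \<Rightarrow> nat \<Rightarrow> (nat \<Rightarrow> nat) set" where
  "scale_box k \<tau> S n = {a \<in> \<Pi>\<^sub>E i\<in>{1..k}. UNIV. (\<Sum>i=1..k. a i) = S \<and> (\<forall>i\<in>{1..k}. 4 ^ a i \<le> real n powr \<tau>)}"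

definition freq_bound :: "real \<Rightarrow> nat \<Rightarrow> nat" where
  "freq_bound \<tau> n = nat \<lfloor>3 * real n powr \<tau>\<rfloor>"

lemma freq_bound_mono: "0 \<le> \<tau> \<Longrightarrow> m \<le> n \<Longrightarrow> freq_bound \<tau> m \<le> freq_bound \<tau> n"
  unfolding freq_bound_def by (intro nat_mono floor_mono mult_left_mono powr_mono2) auto

lemma freq_bound_ge_1: "0 \<le> \<tau> \<Longrightarrow> 1 \<le> n \<Longrightarrow> 1 \<le> freq_bound \<tau> n"
proof -
  assume "0 \<le> \<tau>" "1 \<le> n"
  hence "1 \<le> real n powr \<tau>" by (intro ge_one_powr_ge_zero) auto
  thus ?thesis unfolding freq_bound_def by (simp add: le_nat_iff le_floor_iff)
qed

lemma scale_box_freq_bound: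
  assumes "a \<in> scale_box k \<tau> S n" "i \<in> {1..k}"
  shows "3 * 4 ^ a i \<le> freq_bound \<tau> n"
proof -
  have "real (3 * 4 ^ a i) \<le> 3 * real n powr \<tau>"
    using assms unfolding scale_box_def by auto
  thus ?thesis unfolding freq_bound_def by (simp add: le_nat_iff le_floor_iff)
qed

lemma scale_box_subset:
  assumes \<tau>: "0 \<le> \<tau>" "\<tau> \<le> 1" and n: "1 \<le> n"
  shows "scale_box k \<tau> S n \<subseteq> (\<Pi>\<^sub>E i\<in>{1..k}. {..nat \<lfloor>ln (real n)\<rfloor>})"
proof
  fix a assume a: "a \<in> scale_box k \<tau> S n"
  have "a i \<le> nat \<lfloor>ln (real n)\<rfloor>" if i: "i \<in> {1..k}" for i
  proof -
    have "4 ^ a i \<le> real n powr \<tau>" using a i unfolding scale_box_def by auto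
    also have "... \<le> real n powr 1" using \<tau> n by (intro powr_mono) auto
    finally have "ln (4 ^ a i) \<le> ln (real n)" using n by (intro ln_mono) auto
    hence "real (a i) * ln 4 \<le> ln (real n)" by (simp add: ln_realpow)
    moreover have "1 \<le> ln (4 :: real)"
      using exp_le by (subst ln_ge_iff) auto
    ultimately have "real (a i) * 1 \<le> ln (real n)"
      using mult_left_mono[of 1 "ln 4" "real (a i)"] by linarith
    thus ?thesis by (simp add: le_nat_floor)
  qed
  thus "a \<in> (\<Pi>\<^sub>E i\<in>{1..k}. {..nat \<lfloor>ln (real n)\<rfloor>})"
    using a unfolding scale_box_def PiE_iff by blast
qed

lemma finite_scale_box: "0 \<le> \<tau> \<Longrightarrow> \<tau> \<le> 1 \<Longrightarrow> 1 \<le> n \<Longrightarrow> finite (scale_box k \<tau> S n)"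
  by (rule finite_subset[OF scale_box_subset]) (auto intro!: finite_PiE)

lemma card_scale_box_le:
  assumes \<tau>: "0 \<le> \<tau>" "\<tau> \<le> 1" and n: "1 \<le> n"
  shows "real (card (scale_box k \<tau> S n)) \<le> (ln (real n) + 1) ^ k"
proof -
  have "card (scale_box k \<tau> S n) \<le> card (\<Pi>\<^sub>E i\<in>{1..k}. {..nat \<lfloor>ln (real n)\<rfloor>})"
    by (intro card_mono scale_box_subset assms finite_PiE) auto
  also have "... = Suc (nat \<lfloor>ln (real n)\<rfloor>) ^ k" by (simp add: card_PiE)
  finally have "real (card (scale_box k \<tau> S n)) \<le> real (Suc (nat \<lfloor>ln (real n)\<rfloor>)) ^ k"
    by (metis of_nat_mono of_nat_power)
  also have "... \<le> (ln (real n) + 1) ^ k"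
  proof (rule power_mono)
    have "0 \<le> ln (real n)" using n by simp
    thus "real (Suc (nat \<lfloor>ln (real n)\<rfloor>)) \<le> ln (real n) + 1" by simp
  qed simp
  finally show ?thesis .
qed

text \<open>What "n is large" has to supply. The first two inequalities make the minors vanish, the
  third is H \<le> n/2 in the off-diagonal count, the fourth absorbs the degenerate term of
  \<open>diag_count\<close>, the fifth the whole off-diagonal contribution. The factor (ln n + 1)^k
  bounds the number of boxes.\<close>

definition growth_ok :: "nat \<Rightarrow> real \<Rightarrow> real \<Rightarrow> real \<Rightarrow> real \<Rightarrow> nat \<Rightarrow> bool" where
  "growth_ok k w c A \<tau> n \<longleftrightarrow>
     2 * (1 + A) * real (freq_bound \<tau> n) / real n < 1
     \<and> 2 * (1 + A) * real (freq_bound \<tau> n) / real n < c * (2 * (real (freq_bound \<tau> n))\<^sup>2) powr (- w)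
     \<and> real (freq_bound \<tau> n) powr w / c \<le> real n / 2
     \<and> (ln (real n) + 1) ^ k * (3 * real (freq_bound \<tau> n)) ^ (k - 1) / real n \<le> 1
     \<and> (ln (real n) + 1) ^ k * (2 * real (freq_bound \<tau> n) / real n *
         ((2 * real (freq_bound \<tau> n) + 1) ^ 3 * 2 ^ k * (2 * (real (freq_bound \<tau> n) powr w / c) + 1))) \<le> 1"

text \<open>In the application \<psi> is the original function truncated at 1/n, and
  \<open>G\<close> consists of the large n at which it is not too small. The bound on
  \<open>4 ^ S n\<close> says that the boxes are not much smaller than \<psi>(n) permits.\<close>

locale variance_setup =
  fixes k :: nat and \<alpha> \<psi> :: "nat \<Rightarrow> real" and c w A \<tau> C3 :: real and S :: "nat \<Rightarrow> nat" and G :: "nat set"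
  assumes k: "5 \<le> k" and w: "0 < w" and c: "0 < c" and \<tau>: "0 \<le> \<tau>" "\<tau> \<le> 1" and C3: "0 < C3"
    and bad: "badly_approximable_pairs k \<alpha> c w"
    and A: "\<And>i. i \<in> {2..k} \<Longrightarrow> \<bar>\<alpha> i\<bar> \<le> A"
    and G1: "\<And>n. n \<in> G \<Longrightarrow> 1 \<le> n"
    and \<psi>pos: "\<And>n. n \<in> G \<Longrightarrow> 0 < \<psi> n" and \<psi>le: "\<And>n. n \<in> G \<Longrightarrow> \<psi> n \<le> 1 / real n"
    and S: "\<And>n. n \<in> G \<Longrightarrow> 4 ^ S n \<le> C3 / \<psi> n"
    and growth: "\<And>n. n \<in> G \<Longrightarrow> growth_ok k w c A \<tau> n"
begin

lemmas growth' = growth[unfolded growth_ok_def]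
lemmas growth_conjuncts = growth'[THEN conjunct1] growth'[THEN conjunct2, THEN conjunct1]
  growth'[THEN conjunct2, THEN conjunct2, THEN conjunct1]
  growth'[THEN conjunct2, THEN conjunct2, THEN conjunct2, THEN conjunct1]
  growth'[THEN conjunct2, THEN conjunct2, THEN conjunct2, THEN conjunct2]

abbreviation Box :: "nat \<Rightarrow> (nat \<Rightarrow> nat) set" where "Box n \<equiv> scale_box k \<tau> (S n) n"
abbreviation B :: "nat \<Rightarrow> nat" where "B n \<equiv> freq_bound \<tau> n"
abbreviation num :: "nat \<Rightarrow> real" where "num n \<equiv> real (card (Box n))"

text \<open>Up to a factor 2 the mean of the n-th summand of the counting function, as every box
  minorant has mean between 1/2 and 2.\<close>

definition mass :: "nat \<Rightarrow> real" where "mass n = \<psi> n * num n"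

definition red :: "nat \<Rightarrow> nat \<Rightarrow> real" where "red n m = real (n div gcd n m) * real (m div gcd n m)"

lemma red_sym: "red n m = red m n" unfolding red_def by (simp add: gcd.commute mult.commute)

lemma red_ge_1: "1 \<le> n \<Longrightarrow> 1 \<le> m \<Longrightarrow> 1 \<le> red n m"
proof -
  assume "1 \<le> n" "1 \<le> m"
  hence "1 \<le> n div gcd n m" "1 \<le> m div gcd n m" by (auto simp: Suc_le_eq div_greater_zero_iff)
  hence "1 * 1 \<le> real (n div gcd n m) * real (m div gcd n m)" by (intro mult_mono) auto
  thus ?thesis unfolding red_def by simp
qed

lemma mass_nonneg: "n \<in> G \<Longrightarrow> 0 \<le> mass n" unfolding mass_def using \<psi>pos[of n] by simp

lemma num_le: "n \<in> G \<Longrightarrow> num n \<le> (ln (real n) + 1) ^ k" using card_scale_box_le \<tau> G1 by blast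

lemma num_le': "n \<in> G \<Longrightarrow> m \<in> G \<Longrightarrow> m \<le> n \<Longrightarrow> num m \<le> (ln (real n) + 1) ^ k"
proof -
  assume nm: "n \<in> G" "m \<in> G" "m \<le> n"
  have "num m \<le> (ln (real m) + 1) ^ k" by (rule num_le[OF nm(2)])
  also have "... \<le> (ln (real n) + 1) ^ k" using nm G1[of m] by (intro power_mono) auto
  finally show ?thesis .
qed

text \<open>Summing over \<open>b\<close> first, or over \<open>a\<close> first, bounds the double
  sum by either number of boxes times the same \<open>Q\<close>, hence by the smaller one. As
  \<open>Q\<close> contains the reciprocal of sqrt(\<psi>(n) \<psi>(m)), one such root is left over,
  and the inequality of the arithmetic and geometric means turns it into the two masses.\<close>

lemma geometric_part:
  assumes n: "n \<in> G" and m: "m \<in> G"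
  shows "\<psi> n * \<psi> m * (\<Sum>a\<in>Box n. \<Sum>b\<in>Box m. \<Prod>i=1..k. min (3 * 4 ^ a i / real (m div gcd n m)) (3 * 4 ^ b i / real (n div gcd n m)))
    \<le> 12 ^ k * C3 * ((mass n + mass m) / 2 / (red n m)\<^sup>2)"
proof -
  define \<mu> \<nu> where "\<mu> = real (m div gcd n m)" and "\<nu> = real (n div gcd n m)"
  have g: "0 < gcd n m" using G1[OF n] by simp
  have mu: "0 < \<mu>" "0 < \<nu>"
    unfolding \<mu>_def \<nu>_def using G1[OF n] G1[OF m] by (auto simp: div_greater_zero_iff)
  have r: "red n m = \<mu> * \<nu>" unfolding red_def \<mu>_def \<nu>_def by simp
  have r1: "1 \<le> \<mu> * \<nu>" using red_ge_1[OF G1[OF n] G1[OF m]] unfolding r .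
  define Q where "Q = 12 ^ k * sqrt (4 ^ S n * 4 ^ S m / (\<mu> * \<nu>) ^ k)"
  define x where "x = (\<Sum>a\<in>Box n. \<Sum>b\<in>Box m. \<Prod>i=1..k. min (3 * 4 ^ a i / \<mu>) (3 * 4 ^ b i / \<nu>))"
  have p: "0 < \<psi> n" "0 < \<psi> m" using \<psi>pos n m by auto
  have k1: "1 \<le> k" using k by simp
  have "x \<le> (\<Sum>a\<in>Box n. Q)"
    unfolding x_def
  proof (rule sum_mono)
    fix a assume a: "a \<in> Box n"
    show "(\<Sum>b\<in>Box m. \<Prod>i=1..k. min (3 * 4 ^ a i / \<mu>) (3 * 4 ^ b i / \<nu>)) \<le> Q"
      unfolding Q_def
      by (rule sum_prod_min_le[OF mu k1 scale_box_subset[OF \<tau> G1[OF m]]])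
         (use a in \<open>auto simp: scale_box_def\<close>)
  qed
  hence x1: "x \<le> num n * Q" by simp
  have "x = (\<Sum>b\<in>Box m. \<Sum>a\<in>Box n. \<Prod>i=1..k. min (3 * 4 ^ b i / \<nu>) (3 * 4 ^ a i / \<mu>))"
    unfolding x_def by (subst sum.swap) (simp add: min.commute)
  also have "... \<le> (\<Sum>b\<in>Box m. Q)"
  proof (rule sum_mono)
    fix b assume b: "b \<in> Box m"
    have "(\<Sum>a\<in>Box n. \<Prod>i=1..k. min (3 * 4 ^ b i / \<nu>) (3 * 4 ^ a i / \<mu>)) \<le> 12 ^ k * sqrt (4 ^ S m * 4 ^ S n / (\<nu> * \<mu>) ^ k)"
      by (rule sum_prod_min_le[OF mu(2,1) k1 scale_box_subset[OF \<tau> G1[OF n]]])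
         (use b in \<open>auto simp: scale_box_def\<close>)
    thus "(\<Sum>a\<in>Box n. \<Prod>i=1..k. min (3 * 4 ^ b i / \<nu>) (3 * 4 ^ a i / \<mu>)) \<le> Q"
      unfolding Q_def by (simp add: mult.commute)
  qed
  finally have x2: "x \<le> num m * Q" by simp
  have Q: "Q \<le> 12 ^ k * (C3 / (sqrt (\<psi> n * \<psi> m) * (\<mu> * \<nu>)\<^sup>2))"
  proof -
    have "4 ^ S n * 4 ^ S m \<le> (C3 / \<psi> n) * (C3 / \<psi> m)"
      using S[OF n] S[OF m] C3 p by (intro mult_mono) auto
    \<comment> \<open>The square root of this fourth power gives the decay 1/(\<mu>\<nu>)^2, which
      is summable over reduced fractions.\<close>
    moreover have "(\<mu> * \<nu>) ^ 4 \<le> (\<mu> * \<nu>) ^ k" using r1 k by (intro power_increasing) auto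
    moreover have "0 < (\<mu> * \<nu>) ^ 4" using mu by simp
    moreover have "0 \<le> (C3 / \<psi> n) * (C3 / \<psi> m)" using C3 p by simp
    ultimately have "4 ^ S n * 4 ^ S m / (\<mu> * \<nu>) ^ k \<le> (C3 / \<psi> n) * (C3 / \<psi> m) / (\<mu> * \<nu>) ^ 4"
      by (intro frac_le) auto
    also have "... = C3\<^sup>2 / (\<psi> n * \<psi> m * ((\<mu> * \<nu>)\<^sup>2)\<^sup>2)" by (simp add: power2_eq_square power4_eq_xxxx)
    finally have "sqrt (4 ^ S n * 4 ^ S m / (\<mu> * \<nu>) ^ k) \<le> sqrt (C3\<^sup>2 / (\<psi> n * \<psi> m * ((\<mu> * \<nu>)\<^sup>2)\<^sup>2))"
      by (rule real_sqrt_le_mono)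
    also have "... = C3 / (sqrt (\<psi> n * \<psi> m) * (\<mu> * \<nu>)\<^sup>2)"
    proof -
      have "sqrt (((\<mu> * \<nu>)\<^sup>2)\<^sup>2) = (\<mu> * \<nu>)\<^sup>2" by (simp only: real_sqrt_abs abs_power2)
      thus ?thesis using C3 unfolding real_sqrt_divide real_sqrt_mult by simp
    qed
    finally show ?thesis unfolding Q_def by (rule mult_left_mono) simp
  qed
  define z where "z = sqrt (\<psi> n * \<psi> m)"
  have z: "0 < z" "z * z = \<psi> n * \<psi> m" "z \<le> (\<psi> n + \<psi> m) / 2"
    unfolding z_def using p arith_geo_mean_sqrt[of "\<psi> n" "\<psi> m"] by simp_all
  have Q0: "0 \<le> Q" unfolding Q_def using mu by simp
  have x0: "x \<le> min (num n) (num m) * Q" using x1 x2 Q0 by (simp add: min_mult_distrib_right)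
  have "\<psi> n * \<psi> m * x \<le> (z * z) * (min (num n) (num m) * (12 ^ k * (C3 / (z * (\<mu> * \<nu>)\<^sup>2))))"
  proof -
    have "\<psi> n * \<psi> m * x \<le> (z * z) * (min (num n) (num m) * Q)"
      unfolding z(2) using x0 p by (intro mult_left_mono) auto
    also have "... \<le> (z * z) * (min (num n) (num m) * (12 ^ k * (C3 / (z * (\<mu> * \<nu>)\<^sup>2))))"
      using Q z(1) unfolding z_def[symmetric] by (intro mult_left_mono) auto
    finally show ?thesis .
  qed
  also have "... = 12 ^ k * C3 * (z * min (num n) (num m) / (\<mu> * \<nu>)\<^sup>2)"
  proof -
    have "(z * z) * (M * (K * (C3 / (z * y)))) = K * C3 * (z * M / y)" for M K y
      using z(1) by simp
    thus ?thesis .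
  qed
  also have "... \<le> 12 ^ k * C3 * ((mass n + mass m) / 2 / (\<mu> * \<nu>)\<^sup>2)"
  proof -
    have "z * min (num n) (num m) \<le> (\<psi> n + \<psi> m) / 2 * min (num n) (num m)"
      using z(3) by (intro mult_right_mono) auto
    also have "... = (\<psi> n * min (num n) (num m) + \<psi> m * min (num n) (num m)) / 2" by (simp add: algebra_simps)
    also have "... \<le> (mass n + mass m) / 2"
      unfolding mass_def using p by (intro divide_right_mono add_mono mult_left_mono) auto
    finally show ?thesis using C3 by (intro mult_left_mono divide_right_mono) auto
  qed
  finally show ?thesis unfolding x_def \<mu>_def \<nu>_def r .
qed

text \<open>The three terms come from the pairs with u \<noteq> 0, from the degenerate diagonal
  pairs and from the volume term on the diagonal. In the first two the boxes of m are counted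
  trivially, at the cost of a power of log n, which a power of n outweighs; the third has no power
  to spare and relies on \<open>geometric_part\<close>.\<close>

lemma pair_sum_le:
  assumes n: "n \<in> G" and m: "m \<in> G" and mn: "m \<le> n"
  shows "\<psi> n * \<psi> m * (\<Sum>a\<in>Box n. \<Sum>b\<in>Box m. real (card (corr_pairs k \<alpha> n a m b)))
    \<le> mass n * ((ln (real n) + 1) ^ k * (1 / real m * real (card (offdiag_pairs k \<alpha> (B n) n m))))
      + mass n * (1 / (red n m)\<^sup>2)
      + 36 ^ k * C3 * ((mass n + mass m) / 2 / (red n m)\<^sup>2)"
proof -
  define \<mu> \<nu> where "\<mu> = m div gcd n m" and "\<nu> = n div gcd n m"
  have n1: "1 \<le> n" and m1: "1 \<le> m" using G1 n m by auto
  have mu: "1 \<le> \<mu>" "1 \<le> \<nu>"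
    unfolding \<mu>_def \<nu>_def using n1 m1 by (auto simp: Suc_le_eq div_greater_zero_iff)
  have r: "red n m = real \<nu> * real \<mu>" unfolding red_def \<mu>_def \<nu>_def by simp
  have p: "0 < \<psi> n" "0 < \<psi> m" using \<psi>pos n m by auto
  define P where "P a b = (\<Prod>i=1..k. min (3 * 4 ^ a i / real \<mu>) (3 * 4 ^ b i / real \<nu>))" for a b :: "nat \<Rightarrow> nat"
  define E where "E = (3 * real (B n) / real \<nu>) ^ (k - 1)"
  define F where "F = real (card (offdiag_pairs k \<alpha> (B n) n m))"
  have Bm: "B m \<le> B n" using freq_bound_mono \<tau>(1) mn by blast
  have each: "real (card (corr_pairs k \<alpha> n a m b)) \<le> F + E + 3 ^ k * P a b" if a: "a \<in> Box n" and b: "b \<in> Box m" for a b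
  proof -
    have sb: "freq_box k a \<subseteq> int_box k (B n)" "freq_box k b \<subseteq> int_box k (B n)"
    proof -
      have "int (3 * 4 ^ a i) \<le> int (B n)" "int (3 * 4 ^ b i) \<le> int (B n)" if "i \<in> {1..k}" for i
        using scale_box_freq_bound[OF a that] scale_box_freq_bound[OF b that] Bm by linarith+
      thus "freq_box k a \<subseteq> int_box k (B n)" "freq_box k b \<subseteq> int_box k (B n)"
        unfolding freq_box_def int_box_def by (intro PiE_mono; force)+
    qed
    have "corr_pairs k \<alpha> n a m b \<subseteq> offdiag_pairs k \<alpha> (B n) n m \<union> diag_pairs k a b n m"
      using sb unfolding corr_pairs_def offdiag_pairs_def diag_pairs_def by auto
    hence "card (corr_pairs k \<alpha> n a m b) \<le> card (offdiag_pairs k \<alpha> (B n) n m \<union> diag_pairs k a b n m)"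
      by (intro card_mono) auto
    also have "... \<le> card (offdiag_pairs k \<alpha> (B n) n m) + card (diag_pairs k a b n m)" by (rule card_Un_le)
    finally have "real (card (corr_pairs k \<alpha> n a m b)) \<le> F + real (card (diag_pairs k a b n m))" unfolding F_def by linarith
    moreover have "real (card (diag_pairs k a b n m)) \<le> 3 ^ k * P a b + E"
      unfolding P_def E_def
      using k le_trans[OF scale_box_freq_bound[OF b] Bm]
      by (intro diag_count[OF _ n1 m1 _ \<nu>_def \<mu>_def]) simp_all
    ultimately show ?thesis by linarith
  qed
  have "(\<Sum>a\<in>Box n. \<Sum>b\<in>Box m. real (card (corr_pairs k \<alpha> n a m b))) \<le> (\<Sum>a\<in>Box n. \<Sum>b\<in>Box m. F + E + 3 ^ k * P a b)"
    by (intro sum_mono each)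
  also have "... = num n * num m * F + num n * num m * E + 3 ^ k * (\<Sum>a\<in>Box n. \<Sum>b\<in>Box m. P a b)"
    by (simp add: sum.distrib sum_distrib_left algebra_simps)
  finally have "\<psi> n * \<psi> m * (\<Sum>a\<in>Box n. \<Sum>b\<in>Box m. real (card (corr_pairs k \<alpha> n a m b)))
     \<le> \<psi> n * \<psi> m * (num n * num m * F + num n * num m * E + 3 ^ k * (\<Sum>a\<in>Box n. \<Sum>b\<in>Box m. P a b))"
    using p by (intro mult_left_mono) auto
  also have "... = mass n * (num m * (\<psi> m * F)) + mass n * (num m * (\<psi> m * E))
     + 3 ^ k * (\<psi> n * \<psi> m * (\<Sum>a\<in>Box n. \<Sum>b\<in>Box m. P a b))"
    unfolding mass_def by (simp add: algebra_simps)
  also have "... \<le> mass n * ((ln (real n) + 1) ^ k * (1 / real m * F)) + mass n * (1 / (red n m)\<^sup>2)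
     + 36 ^ k * C3 * ((mass n + mass m) / 2 / (red n m)\<^sup>2)"
  proof (intro add_mono mult_left_mono)
    show "num m * (\<psi> m * F) \<le> (ln (real n) + 1) ^ k * (1 / real m * F)"
      using num_le'[OF n m mn] \<psi>le[OF m] p n1 unfolding F_def by (intro mult_mono) auto
    \<comment> \<open>Since 1/m = \<nu>/(n\<mu>), the growth condition takes care of B^(k - 1)/n and
      leaves 1/(\<mu> \<nu>^(k - 2)). This is at most 1/(\<mu>\<nu>)^2 because \<mu> \<le> \<nu> and
      k - 2 \<ge> 3.\<close>
    show "num m * (\<psi> m * E) \<le> 1 / (red n m)\<^sup>2"
    proof -
      have mu_le: "\<mu> \<le> \<nu>" unfolding \<mu>_def \<nu>_def using mn by (rule div_le_mono)
      obtain g where g: "m = \<mu> * g" "n = \<nu> * g"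
        unfolding \<mu>_def \<nu>_def by (metis dvd_div_mult_self gcd_dvd1 gcd_dvd2)
      have "m * \<nu> = n * \<mu>" using g by simp
      hence "real m * real \<nu> = real n * real \<mu>" by (metis of_nat_mult)
      hence mm: "1 / real m = real \<nu> / (real n * real \<mu>)" using n1 m1 mu by (simp add: field_simps)
      have "num m * (\<psi> m * E) \<le> (ln (real n) + 1) ^ k * (1 / real m * E)"
        using num_le'[OF n m mn] \<psi>le[OF m] p n1 unfolding E_def by (intro mult_mono) auto
      also have "... = ((ln (real n) + 1) ^ k * (3 * real (B n)) ^ (k - 1) / real n) * (real \<nu> / (real \<mu> * real \<nu> ^ (k - 1)))"
        unfolding mm E_def by (simp add: power_divide mult_ac)
      also have "... \<le> 1 * (real \<nu> / (real \<mu> * real \<nu> ^ (k - 1)))"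
        using growth_conjuncts(4)[OF n] by (intro mult_right_mono) auto
      also have "... = 1 / (real \<mu> * real \<nu> ^ (k - 2))"
      proof -
        have "real \<nu> ^ (k - 1) = real \<nu> * real \<nu> ^ (k - 2)"
        proof -
          have "k - 1 = Suc (k - 2)" using k by simp
          thus ?thesis by simp
        qed
        thus ?thesis using mu by simp
      qed
      also have "... \<le> 1 / (red n m)\<^sup>2"
      proof (rule divide_left_mono)
        have "(red n m)\<^sup>2 = real \<mu> * (real \<mu> * real \<nu> ^ 2)" unfolding r by (simp add: power2_eq_square)
        also have "... \<le> real \<mu> * (real \<nu> * real \<nu> ^ 2)"
          using mu_le by (intro mult_left_mono mult_right_mono) auto
        also have "... = real \<mu> * real \<nu> ^ 3" by (simp add: power3_eq_cube power2_eq_square)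
        also have "... \<le> real \<mu> * real \<nu> ^ (k - 2)"
          using mu k by (intro mult_left_mono power_increasing) auto
        finally show "(red n m)\<^sup>2 \<le> real \<mu> * real \<nu> ^ (k - 2)" .
        show "0 < real \<mu> * real \<nu> ^ (k - 2) * (red n m)\<^sup>2" using mu unfolding r by simp
      qed simp
      finally show ?thesis .
    qed
    have "3 ^ k * (\<psi> n * \<psi> m * (\<Sum>a\<in>Box n. \<Sum>b\<in>Box m. P a b)) \<le> 3 ^ k * (12 ^ k * C3 * ((mass n + mass m) / 2 / (red n m)\<^sup>2))"
      unfolding P_def \<mu>_def \<nu>_def by (intro mult_left_mono geometric_part n m) auto
    also have "... = 36 ^ k * C3 * ((mass n + mass m) / 2 / (red n m)\<^sup>2)"
      by (simp add: power_mult_distrib[symmetric] flip: mult.assoc)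
    finally show "3 ^ k * (\<psi> n * \<psi> m * (\<Sum>a\<in>Box n. \<Sum>b\<in>Box m. P a b)) \<le> 36 ^ k * C3 * ((mass n + mass m) / 2 / (red n m)\<^sup>2)" .
  qed (use mass_nonneg n in auto)
  finally show ?thesis unfolding F_def .
qed

lemma symmetric_double_sum_le:
  fixes f :: "nat \<Rightarrow> nat \<Rightarrow> real"
  assumes fin: "finite J" and sym: "\<And>n m. f n m = f m n" and nn: "\<And>n m. n \<in> J \<Longrightarrow> m \<in> J \<Longrightarrow> 0 \<le> f n m"
  shows "(\<Sum>n\<in>J. \<Sum>m\<in>J. f n m) \<le> 2 * (\<Sum>n\<in>J. \<Sum>m\<in>{m\<in>J. m \<le> n}. f n m)"
proof -
  define h where "h n m = (if m \<le> n then f n m else 0)" for n m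
  have "(\<Sum>n\<in>J. \<Sum>m\<in>J. f n m) \<le> (\<Sum>n\<in>J. \<Sum>m\<in>J. h n m + h m n)"
    using nn sym by (intro sum_mono) (auto simp: h_def)
  also have "... = (\<Sum>n\<in>J. \<Sum>m\<in>J. h n m) + (\<Sum>n\<in>J. \<Sum>m\<in>J. h m n)"
    by (simp add: sum.distrib)
  also have "(\<Sum>n\<in>J. \<Sum>m\<in>J. h m n) = (\<Sum>n\<in>J. \<Sum>m\<in>J. h n m)" by (rule sum.swap)
  also have "(\<Sum>n\<in>J. \<Sum>m\<in>J. h n m) = (\<Sum>n\<in>J. \<Sum>m\<in>{m\<in>J. m \<le> n}. f n m)"
    unfolding h_def sum.inter_filter[OF fin] ..
  finally show ?thesis by simp
qed

text \<open>By symmetry it is enough to treat m \<le> n, the range of the off-diagonal count. Each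
  row costs 1 + 4 masses for the error terms, the 4 being the sum over reduced fractions, and the
  same 4 bounds the volume term after summation; doubling gives 10 and 8 * 36^k.\<close>

lemma variance_sum_le:
  assumes fin: "finite J" and sub: "J \<subseteq> G"
  shows "(\<Sum>n\<in>J. \<Sum>m\<in>J. \<psi> n * \<psi> m * (\<Sum>a\<in>Box n. \<Sum>b\<in>Box m. real (card (corr_pairs k \<alpha> n a m b))))
    \<le> (10 + 8 * 36 ^ k * C3) * (\<Sum>n\<in>J. mass n)"
proof -
  define f where "f n m = \<psi> n * \<psi> m * (\<Sum>a\<in>Box n. \<Sum>b\<in>Box m. real (card (corr_pairs k \<alpha> n a m b)))" for n m
  define M where "M = (\<Sum>n\<in>J. mass n)"
  define K where "K = 36 ^ k * C3"
  have K0: "0 \<le> K" unfolding K_def using C3 by simp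
  have sym: "f n m = f m n" for n m
    unfolding f_def by (subst sum.swap, subst card_corr_pairs_sym) (simp add: mult.commute)
  have nn: "0 \<le> f n m" if "n \<in> J" "m \<in> J" for n m
  proof -
    have "0 < \<psi> n" "0 < \<psi> m" using \<psi>pos that sub by auto
    thus ?thesis unfolding f_def by (intro mult_nonneg_nonneg sum_nonneg) auto
  qed
  have red4: "(\<Sum>m\<in>J. 1 / (red n m)\<^sup>2) \<le> 4" if "n \<in> J" for n
    unfolding red_def using that sub G1 fin by (intro sum_reduced_fraction_le) auto
  have row: "(\<Sum>m\<in>{m\<in>J. m \<le> n}. f n m) \<le> 5 * mass n + K * (\<Sum>m\<in>J. (mass n + mass m) / 2 / (red n m)\<^sup>2)"
    if n: "n \<in> J" for n
  proof -
    have nG: "n \<in> G" and n1: "1 \<le> n" using n sub G1 by auto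
    define Lg where "Lg = (ln (real n) + 1) ^ k"
    have Lg0: "0 \<le> Lg" unfolding Lg_def using n1 by simp
    have mn0: "0 \<le> mass n" using mass_nonneg nG by simp
    have fJ: "finite {m\<in>J. m \<le> n}" using fin by simp
    have "(\<Sum>m\<in>{m\<in>J. m \<le> n}. f n m) \<le> (\<Sum>m\<in>{m\<in>J. m \<le> n}.
        mass n * (Lg * (1 / real m * real (card (offdiag_pairs k \<alpha> (B n) n m))))
      + mass n * (1 / (red n m)\<^sup>2) + K * ((mass n + mass m) / 2 / (red n m)\<^sup>2))"
      unfolding f_def Lg_def K_def using sub nG by (intro sum_mono pair_sum_le) auto
    also have "... = mass n * (Lg * (\<Sum>m\<in>{m\<in>J. m \<le> n}. 1 / real m * real (card (offdiag_pairs k \<alpha> (B n) n m))))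
      + mass n * (\<Sum>m\<in>{m\<in>J. m \<le> n}. 1 / (red n m)\<^sup>2)
      + K * (\<Sum>m\<in>{m\<in>J. m \<le> n}. (mass n + mass m) / 2 / (red n m)\<^sup>2)"
      by (simp only: sum.distrib sum_distrib_left)
    also have "... \<le> mass n * 1 + mass n * 4 + K * (\<Sum>m\<in>J. (mass n + mass m) / 2 / (red n m)\<^sup>2)"
    proof (intro add_mono mult_left_mono mn0 K0)
      have "(\<Sum>m\<in>{m\<in>J. m \<le> n}. 1 / real m * real (card (offdiag_pairs k \<alpha> (B n) n m)))
        \<le> (\<Sum>m=1..n. 1 / real m * real (card (offdiag_pairs k \<alpha> (B n) n m)))"
        using sub G1 by (intro sum_mono2) auto
      also have "... \<le> 2 * real (B n) / real n * ((2 * real (B n) + 1) ^ 3 * 2 ^ k * (2 * (real (B n) powr w / c) + 1))"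
        using k by (intro offdiag_count[OF _ w n1 freq_bound_ge_1[OF \<tau>(1) n1] bad c A growth_conjuncts(1)[OF nG] growth_conjuncts(2)[OF nG] refl growth_conjuncts(3)[OF nG]]) auto
      finally have "Lg * (\<Sum>m\<in>{m\<in>J. m \<le> n}. 1 / real m * real (card (offdiag_pairs k \<alpha> (B n) n m)))
        \<le> Lg * (2 * real (B n) / real n * ((2 * real (B n) + 1) ^ 3 * 2 ^ k * (2 * (real (B n) powr w / c) + 1)))"
        using Lg0 by (rule mult_left_mono)
      also have "... \<le> 1" unfolding Lg_def by (rule growth_conjuncts(5)[OF nG])
      finally show "Lg * (\<Sum>m\<in>{m\<in>J. m \<le> n}. 1 / real m * real (card (offdiag_pairs k \<alpha> (B n) n m))) \<le> 1" .
      have "(\<Sum>m\<in>{m\<in>J. m \<le> n}. 1 / (red n m)\<^sup>2) \<le> (\<Sum>m\<in>J. 1 / (red n m)\<^sup>2)"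
        using fin by (intro sum_mono2) auto
      thus "(\<Sum>m\<in>{m\<in>J. m \<le> n}. 1 / (red n m)\<^sup>2) \<le> 4" using red4[OF n] by linarith
      show "(\<Sum>m\<in>{m\<in>J. m \<le> n}. (mass n + mass m) / 2 / (red n m)\<^sup>2) \<le> (\<Sum>m\<in>J. (mass n + mass m) / 2 / (red n m)\<^sup>2)"
        using fin mn0 mass_nonneg sub by (intro sum_mono2) (auto intro!: add_nonneg_nonneg)
    qed
    finally show ?thesis by simp
  qed
  have half: "(\<Sum>n\<in>J. \<Sum>m\<in>J. mass n / (red n m)\<^sup>2) \<le> 4 * M"
  proof -
    have "(\<Sum>n\<in>J. \<Sum>m\<in>J. mass n / (red n m)\<^sup>2) = (\<Sum>n\<in>J. mass n * (\<Sum>m\<in>J. 1 / (red n m)\<^sup>2))"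
      by (simp add: sum_distrib_left)
    also have "... \<le> (\<Sum>n\<in>J. mass n * 4)"
      using red4 mass_nonneg sub by (intro sum_mono mult_left_mono) auto
    finally show ?thesis unfolding M_def sum_distrib_right[symmetric] by (simp only: mult.commute)
  qed
  have half': "(\<Sum>n\<in>J. \<Sum>m\<in>J. mass m / (red n m)\<^sup>2) \<le> 4 * M"
    using half by (subst sum.swap, subst red_sym)
  have both: "(\<Sum>n\<in>J. \<Sum>m\<in>J. (mass n + mass m) / 2 / (red n m)\<^sup>2) \<le> 4 * M"
  proof -
    have "(\<Sum>n\<in>J. \<Sum>m\<in>J. (mass n + mass m) / 2 / (red n m)\<^sup>2)
      = (\<Sum>n\<in>J. \<Sum>m\<in>J. mass n / (red n m)\<^sup>2) / 2 + (\<Sum>n\<in>J. \<Sum>m\<in>J. mass m / (red n m)\<^sup>2) / 2"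
      by (simp add: sum.distrib add_divide_distrib sum_divide_distrib mult.commute)
    thus ?thesis using half half' by linarith
  qed
  have "(\<Sum>n\<in>J. \<Sum>m\<in>J. f n m) \<le> 2 * (\<Sum>n\<in>J. \<Sum>m\<in>{m\<in>J. m \<le> n}. f n m)"
    by (rule symmetric_double_sum_le[OF fin sym nn])
  also have "... \<le> 2 * (\<Sum>n\<in>J. 5 * mass n + K * (\<Sum>m\<in>J. (mass n + mass m) / 2 / (red n m)\<^sup>2))"
    by (intro mult_left_mono sum_mono row) auto
  also have "... = 10 * M + 2 * (K * (\<Sum>n\<in>J. \<Sum>m\<in>J. (mass n + mass m) / 2 / (red n m)\<^sup>2))"
    unfolding M_def by (simp add: sum.distrib sum_distrib_left)
  also have "... \<le> 10 * M + 2 * (K * (4 * M))"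
    using both K0 by (intro add_left_mono mult_left_mono) auto
  also have "... = (10 + 8 * 36 ^ k * C3) * M" unfolding K_def by (simp add: algebra_simps)
  finally show ?thesis unfolding f_def M_def .
qed

end

section \<open>Growth, scales and divergence\<close>

lemma log_power_eventually_small:
  fixes C \<eta> \<epsilon> :: real
  assumes \<eta>: "0 < \<eta>" and \<epsilon>: "0 < \<epsilon>" and k: "1 \<le> k"
  shows "\<forall>\<^sub>F n :: nat in sequentially. C * ((ln (real n) + 1) ^ k * real n powr (- \<eta>)) < \<epsilon>"
proof -
  \<comment> \<open>Dividing the exponent by k writes the expression as a k-th power whose base
    contains only a first power of the logarithm.\<close>
  define \<eta>' where "\<eta>' = \<eta> / real k"
  have \<eta>': "0 < \<eta>'" unfolding \<eta>'_def using \<eta> k by simp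
  have "(\<lambda>n :: nat. (ln (real n) + 1) * real n powr (- \<eta>')) \<longlonglongrightarrow> 0"
    using \<eta>' by real_asymp
  hence "(\<lambda>n :: nat. C * ((ln (real n) + 1) * real n powr (- \<eta>')) ^ k) \<longlonglongrightarrow> C * 0 ^ k"
    by (intro tendsto_intros)
  hence "(\<lambda>n :: nat. C * ((ln (real n) + 1) * real n powr (- \<eta>')) ^ k) \<longlonglongrightarrow> 0"
    using k by (simp add: zero_power)
  hence "\<forall>\<^sub>F n :: nat in sequentially. C * ((ln (real n) + 1) * real n powr (- \<eta>')) ^ k < \<epsilon>"
    using \<epsilon> by (rule order_tendstoD)
  thus ?thesis
  proof eventually_elim
    case (elim n)
    have "(real n powr (- \<eta>')) ^ k = real n powr (- \<eta>)"
    proof (cases "n = 0")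
      case False
      thus ?thesis using k by (simp add: powr_powr \<eta>'_def flip: powr_realpow)
    qed (use k in auto)
    thus ?case using elim by (simp add: power_mult_distrib)
  qed
qed

lemma powr_eventually_small:
  fixes C \<eta> \<epsilon> :: real
  assumes "0 < \<eta>" "0 < \<epsilon>"
  shows "\<forall>\<^sub>F n :: nat in sequentially. C * real n powr (- \<eta>) < \<epsilon>"
proof -
  have "(\<lambda>n :: nat. C * real n powr (- \<eta>)) \<longlonglongrightarrow> C * 0"
    using assms by (intro tendsto_intros) real_asymp
  thus ?thesis using assms(2) by (intro order_tendstoD) auto
qed

text \<open>With B at most 3 n^\<tau>, the exponents of n to be kept below 1 are \<tau>, \<tau>(1 +
  2w), \<tau>w, \<tau>(k - 1) and \<tau>(4 + w), in the order of the conditions. The last one is 1 +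
  3 + w: the weight B/n, the three parameters p, q, v_1, and H. The bound on \<tau>(2w + 4) covers
  both 1 + 2w and 4 + w.\<close>

lemma growth_eventually:
  fixes k :: nat and w c A \<tau> :: real
  assumes k: "5 \<le> k" and w: "0 < w" and c: "0 < c" and A: "0 \<le> A" and \<tau>: "0 < \<tau>"
    and \<tau>k: "\<tau> * (real k - 1) < 1" and \<tau>w: "\<tau> * (2 * w + 4) < 1"
  shows "\<forall>\<^sub>F n in sequentially. growth_ok k w c A \<tau> n"
proof -
  have tw: "0 < \<tau> * w" using \<tau> w by simp
  have e1: "0 < 1 - \<tau>" "0 < 1 - \<tau> - 2 * w * \<tau>" "0 < 1 - \<tau> * w" "0 < 1 - \<tau> * (real k - 1)" "0 < 1 - \<tau> * (4 + w)"
    using \<tau> tw \<tau>k \<tau>w by (auto simp: algebra_simps)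
  have k1: "1 \<le> k" using k by simp
  define C5 where "C5 = 6 * 7 ^ 3 * 2 ^ k * (2 * 3 powr w / c + 1)"
  show ?thesis
    using eventually_ge_at_top[of 1]
      powr_eventually_small[OF e1(1) zero_less_one, of "6 * (1 + A)"]
      powr_eventually_small[OF e1(2) zero_less_one, of "6 * (1 + A) * 18 powr w / c"]
      powr_eventually_small[OF e1(3) zero_less_one, of "2 * 3 powr w / c"]
      log_power_eventually_small[OF e1(4) zero_less_one k1, of "9 ^ (k - 1)"]
      log_power_eventually_small[OF e1(5) zero_less_one k1, of C5]
  proof eventually_elim
    case (elim n)
    define T where "T = real n powr \<tau>"
    define b where "b = real (freq_bound \<tau> n)"
    have n: "1 \<le> n" "0 < real n" using elim(1) by auto
    have T1: "1 \<le> T" unfolding T_def using n \<tau> by (intro ge_one_powr_ge_zero) auto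
    have b1: "1 \<le> b" unfolding b_def using freq_bound_ge_1[of \<tau> n] \<tau> n by simp
    have b3: "b \<le> 3 * T" unfolding b_def freq_bound_def T_def by simp
    have Tp: "T powr x = real n powr (\<tau> * x)" for x unfolding T_def by (simp add: powr_powr)
    have Tpow: "T ^ j = real n powr (\<tau> * real j)" for j
      using T1 by (subst powr_realpow[symmetric]) (auto simp: Tp)
    have div_n: "real n powr x / real n = real n powr (x - 1)" for x
      using n by (simp add: powr_diff)
    have bw: "b powr w \<le> 3 powr w * real n powr (\<tau> * w)"
    proof -
      have "b powr w \<le> (3 * T) powr w" using b1 b3 w by (intro powr_mono2) auto
      also have "... = 3 powr w * real n powr (\<tau> * w)" using T1 by (simp add: powr_mult Tp)
      finally show ?thesis .
    qed
    have L0: "0 \<le> (ln (real n) + 1) ^ k" using n by simp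
    have c1: "2 * (1 + A) * b / real n \<le> 6 * (1 + A) * real n powr (- (1 - \<tau>))"
    proof -
      have "2 * (1 + A) * b / real n \<le> 2 * (1 + A) * (3 * T) / real n"
        using b3 A by (intro divide_right_mono mult_left_mono) auto
      also have "... = 6 * (1 + A) * (real n powr \<tau> / real n)" by (simp add: T_def)
      also have "... = 6 * (1 + A) * real n powr (- (1 - \<tau>))" unfolding div_n by simp
      finally show ?thesis .
    qed
    have c2: "2 * (1 + A) * b / real n < c * (2 * b\<^sup>2) powr (- w)"
    proof -
      have "b\<^sup>2 \<le> (3 * T)\<^sup>2" using b1 b3 by (intro power_mono) auto
      hence "2 * b\<^sup>2 \<le> 18 * T\<^sup>2" by (simp add: power_mult_distrib)
      hence low: "c * (18 * T\<^sup>2) powr (- w) \<le> c * (2 * b\<^sup>2) powr (- w)"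
        using b1 w c by (intro mult_left_mono powr_mono2') auto
      have "(18 * T\<^sup>2) powr (- w) = 18 powr (- w) * real n powr (- 2 * w * \<tau>)"
        using T1 by (simp add: powr_mult Tpow powr_powr mult_ac)
      hence eq: "c * (18 * T\<^sup>2) powr (- w) = c / 18 powr w * real n powr (- 2 * w * \<tau>)"
        by (simp add: powr_minus_divide)
      have "6 * (1 + A) * real n powr (- (1 - \<tau>)) = (c / 18 powr w * real n powr (- 2 * w * \<tau>)) *
          (6 * (1 + A) * 18 powr w / c * real n powr (- (1 - \<tau> - 2 * w * \<tau>)))"
      proof -
        have "real n powr (- (1 - \<tau>)) = real n powr (- 2 * w * \<tau>) * real n powr (- (1 - \<tau> - 2 * w * \<tau>))"
          by (simp flip: powr_add)
        thus ?thesis using c by simp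
      qed
      also have "... < (c / 18 powr w * real n powr (- 2 * w * \<tau>)) * 1"
        using elim(3) c n by (intro mult_strict_left_mono) auto
      finally show ?thesis using c1 low eq by linarith
    qed
    have c3: "b powr w / c \<le> real n / 2"
    proof -
      have "2 * (b powr w / c) \<le> 2 * (3 powr w * real n powr (\<tau> * w) / c)"
        using bw c by (intro mult_left_mono divide_right_mono) auto
      also have "... = real n * (2 * 3 powr w / c * real n powr (- (1 - \<tau> * w)))"
        using n by (simp add: powr_diff)
      also have "... \<le> real n * 1" using elim(4) n by (intro mult_left_mono) auto
      finally show ?thesis by linarith
    qed
    have c4: "(ln (real n) + 1) ^ k * (3 * b) ^ (k - 1) / real n \<le> 1"
    proof -
      have "(3 * b) ^ (k - 1) \<le> (9 * T) ^ (k - 1)" using b1 b3 by (intro power_mono) auto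
      hence "(ln (real n) + 1) ^ k * (3 * b) ^ (k - 1) / real n \<le> (ln (real n) + 1) ^ k * (9 * T) ^ (k - 1) / real n"
        using L0 by (intro divide_right_mono mult_left_mono) auto
      also have "(9 * T) ^ (k - 1) = 9 ^ (k - 1) * real n powr (\<tau> * (real k - 1))"
        using k by (simp add: power_mult_distrib Tpow of_nat_diff)
      also have "(ln (real n) + 1) ^ k * (9 ^ (k - 1) * real n powr (\<tau> * (real k - 1))) / real n
        = 9 ^ (k - 1) * ((ln (real n) + 1) ^ k * (real n powr (\<tau> * (real k - 1)) / real n))"
        by simp
      also have "... = 9 ^ (k - 1) * ((ln (real n) + 1) ^ k * real n powr (- (1 - \<tau> * (real k - 1))))"
        unfolding div_n by simp
      finally show ?thesis using elim(5) by linarith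
    qed
    have c5: "(ln (real n) + 1) ^ k * (2 * b / real n * ((2 * b + 1) ^ 3 * 2 ^ k * (2 * (b powr w / c) + 1))) \<le> 1"
    proof -
      have "2 * (b powr w / c) + 1 \<le> (2 * 3 powr w / c + 1) * real n powr (\<tau> * w)"
      proof -
        have "1 \<le> real n powr (\<tau> * w)" using n tw by (intro ge_one_powr_ge_zero) auto
        moreover have "2 * (b powr w / c) \<le> 2 * (3 powr w * real n powr (\<tau> * w) / c)"
          using bw c by (intro mult_left_mono divide_right_mono) auto
        ultimately show ?thesis by (simp add: algebra_simps)
      qed
      moreover have "(2 * b + 1) ^ 3 \<le> (7 * T) ^ 3" using b1 b3 T1 by (intro power_mono) auto
      moreover have "0 \<le> 2 * (b powr w / c) + 1" using c by simp
      ultimately have "2 * b / real n * ((2 * b + 1) ^ 3 * 2 ^ k * (2 * (b powr w / c) + 1))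
        \<le> 2 * (3 * T) / real n * ((7 * T) ^ 3 * 2 ^ k * ((2 * 3 powr w / c + 1) * real n powr (\<tau> * w)))"
        using b1 b3 T1 n c by (intro mult_mono divide_right_mono mult_nonneg_nonneg) auto
      also have "... = C5 * (T * T ^ 3 * real n powr (\<tau> * w) / real n)"
        unfolding C5_def by (simp add: power_mult_distrib mult_ac)
      also have "T * T ^ 3 * real n powr (\<tau> * w) / real n = real n powr (- (1 - \<tau> * (4 + w)))"
      proof -
        have "T * T ^ 3 * real n powr (\<tau> * w) = real n powr (\<tau> * (4 + w))"
        proof -
          have "T * T ^ 3 = T ^ 4" by (simp add: power3_eq_cube power4_eq_xxxx)
          also have "... = real n powr (\<tau> * 4)" using Tpow[of 4] by simp
          finally show ?thesis by (simp add: algebra_simps flip: powr_add)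
        qed
        thus ?thesis using div_n[of "\<tau> * (4 + w)"] by simp
      qed
      finally have "(ln (real n) + 1) ^ k * (2 * b / real n * ((2 * b + 1) ^ 3 * 2 ^ k * (2 * (b powr w / c) + 1)))
        \<le> (ln (real n) + 1) ^ k * (C5 * real n powr (- (1 - \<tau> * (4 + w))))"
        using L0 by (rule mult_left_mono)
      thus ?thesis using elim(6) by (simp add: mult_ac)
    qed
    show ?case using c1 elim(2) c2 c3 c4 c5 unfolding b_def growth_ok_def by linarith
  qed
qed

text \<open>The exponents \<open>a\<^sub>2, \<dots>, a\<^sub>k\<close> range freely over \<open>{S div k - s..S div k}\<close>, and \<open>a\<^sub>1\<close> absorbs the rest.\<close>

lemma card_scale_box_ge:
  fixes k S s n :: nat and \<tau> :: real
  assumes k: "1 \<le> k" and s: "s \<le> S div k" and n: "1 \<le> n"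
    and fits: "real (S div k + k + k * s) * ln 4 \<le> \<tau> * ln (real n)" and \<tau>: "0 \<le> \<tau>" "\<tau> \<le> 1"
  shows "(s + 1) ^ (k - 1) \<le> card (scale_box k \<tau> S n)"
proof -
  define q where "q = S div k"
  define f where "f b = (\<lambda>i\<in>{1..k}. if i = 1 then S - (\<Sum>i=2..k. q - b i) else q - b i)" for b :: "nat \<Rightarrow> nat"
  let ?P = "\<Pi>\<^sub>E i\<in>{2..k}. {..s}"
  have split: "{1..k} = insert 1 {2..k}" using k by auto
  have small: "4 ^ j \<le> real n powr \<tau>" if "j \<le> q + k + k * s" for j
  proof -
    have "real j \<le> real (q + k + k * s)" using that by (simp only: of_nat_le_iff)
    hence "real j * ln 4 \<le> real (q + k + k * s) * ln 4" by (intro mult_right_mono) auto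
    also have "... \<le> \<tau> * ln (real n)" using fits unfolding q_def .
    finally have "exp (real j * ln 4) \<le> exp (\<tau> * ln (real n))" by simp
    moreover have "exp (real j * ln 4) = (4 :: real) ^ j" by (simp add: exp_of_nat_mult)
    ultimately show ?thesis using n by (simp add: powr_def)
  qed
  have "f ` ?P \<subseteq> scale_box k \<tau> S n"
  proof clarify
    fix b assume b: "b \<in> ?P"
    have bs: "b i \<le> s" if "i \<in> {2..k}" for i using b that by auto
    have "(\<Sum>i=2..k. q - b i) \<le> (\<Sum>i=2..k. q)" by (intro sum_mono) auto
    also have "... = (k - 1) * q" by simp
    finally have le: "(\<Sum>i=2..k. q - b i) \<le> (k - 1) * q" .
    have "S = k * q + S mod k" "S mod k < k" unfolding q_def using k by simp_all
    hence Sq: "k * q \<le> S" "S \<le> k * q + k" by linarith+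
    have kq: "(k - 1) * q + q = k * q" using k by (cases k) auto
    have leS: "(\<Sum>i=2..k. q - b i) \<le> S" using le Sq(1) kq by linarith
    have "(\<Sum>i=1..k. f b i) = f b 1 + (\<Sum>i=2..k. f b i)" unfolding split by simp
    also have "(\<Sum>i=2..k. f b i) = (\<Sum>i=2..k. q - b i)" by (intro sum.cong refl) (auto simp: f_def)
    also have "f b 1 = S - (\<Sum>i=2..k. q - b i)" using k by (simp add: f_def)
    finally have sumf: "(\<Sum>i=1..k. f b i) = S" using leS by simp
    have "f b i \<le> q + k + k * s" if "i \<in> {1..k}" for i
    proof (cases "i = 1")
      case True
      \<comment> \<open>Each of the k - 1 free exponents falls short of q by at most s, and S \<le>
        kq + k; so the first exponent exceeds q by at most k + ks.\<close>
      have "(\<Sum>i=2..k. q) \<le> (\<Sum>i=2..k. (q - b i) + s)"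
      proof (rule sum_mono)
        fix i assume "i \<in> {2..k}"
        thus "q \<le> (q - b i) + s" using bs by fastforce
      qed
      hence "(k - 1) * q \<le> (\<Sum>i=2..k. q - b i) + (k - 1) * s" by (simp add: sum.distrib)
      moreover have "(k - 1) * s \<le> k * s" by simp
      ultimately have "S - (\<Sum>i=2..k. q - b i) \<le> q + k + k * s" using Sq(2) kq by linarith
      thus ?thesis using True that by (simp add: f_def)
    next
      case False
      thus ?thesis using that by (simp add: f_def)
    qed
    hence "\<forall>i\<in>{1..k}. 4 ^ f b i \<le> real n powr \<tau>" using small by blast
    moreover have "f b \<in> (\<Pi>\<^sub>E i\<in>{1..k}. UNIV)" by (simp add: f_def)
    ultimately show "f b \<in> scale_box k \<tau> S n" using sumf unfolding scale_box_def by blast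
  qed
  moreover have "inj_on f ?P"
  proof (rule inj_onI)
    fix b b' assume b: "b \<in> ?P" and b': "b' \<in> ?P" and e: "f b = f b'"
    show "b = b'"
    proof
      fix i
      show "b i = b' i"
      proof (cases "i \<in> {2..k}")
        case True
        \<comment> \<open>Since b \<le> s \<le> q, the natural-number subtraction q - b is never
          truncated and determines b.\<close>
        have "b i \<le> s" "b' i \<le> s" using b b' True by auto
        moreover have "q - b i = q - b' i" using fun_cong[OF e, of i] True by (simp add: f_def)
        ultimately show ?thesis using s unfolding q_def by linarith
      next
        case False
        thus ?thesis using PiE_arb[OF b, of i] PiE_arb[OF b', of i] by simp
      qed
    qed
  qed
  ultimately have "card ?P \<le> card (scale_box k \<tau> S n)"
    using finite_scale_box[OF \<tau> n] by (metis card_image card_mono)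
  moreover have "card ?P = (s + 1) ^ (k - 1)" by (simp add: card_PiE)
  ultimately show ?thesis by simp
qed

text \<open>In units of x = ln n / ln 4 a balanced exponent is about x/k, and the cap is \<tau>x.
  The room \<tau> - 1/k is divided into thirds: one for the excess \<kappa> in S, one for the spread
  ks of the first exponent, and one for the constants once n is large. As s is proportional to x,
  the k - 1 free exponents produce the power of ln n.\<close>

lemma card_scale_box_eventually_ge:
  fixes k :: nat and \<tau> \<kappa> C3 :: real
  assumes k: "2 \<le> k" and \<tau>: "\<tau> \<le> 1" and \<tau>k: "1 < real k * \<tau>" and \<kappa>: "\<kappa> = (real k * \<tau> - 1) / 3" and C3: "1 \<le> C3"
  obtains c1 :: real where "0 < c1"
    "\<forall>\<^sub>F n in sequentially. \<forall>S. real n \<le> 4 ^ S \<and> 4 ^ S \<le> C3 * real n powr (1 + \<kappa>)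
        \<longrightarrow> c1 * ln (real n) ^ (k - 1) \<le> real (card (scale_box k \<tau> S n))"
proof -
  define \<rho> where "\<rho> = (\<tau> - 1 / real k) / (3 * real k)"
  have k0: "0 < real k" using k by simp
  have \<delta>: "0 < \<tau> - 1 / real k" using \<tau>k k0 by (simp add: field_simps)
  have \<rho>: "0 < \<rho>" unfolding \<rho>_def using \<delta> k0 by simp
  have \<tau>0: "0 \<le> \<tau>" using \<delta> k0 by (smt (verit) divide_pos_pos)
  have \<rho>k: "\<rho> < 1 / real k"
  proof -
    have "\<tau> - 1 / real k < 3" using \<tau> k0 by (smt (verit) divide_pos_pos)
    hence "(\<tau> - 1 / real k) / (3 * real k) < 3 / (3 * real k)" using k0 by (intro divide_strict_right_mono) auto
    thus ?thesis unfolding \<rho>_def by simp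
  qed
  have l4: "0 < ln (4 :: real)" by simp
  define c1 where "c1 = (\<rho> / ln 4) ^ (k - 1)"
  \<comment> \<open>The gap between \<rho> and 1/k pays for the rounding in \<open>S div k\<close>,
    so that s \<le> \<open>S div k\<close>.\<close>
  have ev1: "\<forall>\<^sub>F n :: nat in sequentially. 1 \<le> (1 / real k - \<rho>) * (ln (real n) / ln 4)"
  proof -
    have "0 < 1 / real k - \<rho>" using \<rho>k by simp
    hence "filterlim (\<lambda>n :: nat. (1 / real k - \<rho>) * (ln (real n) / ln 4)) at_top at_top"
      using l4 by real_asymp
    thus ?thesis unfolding filterlim_at_top by blast
  qed
  have ev2: "\<forall>\<^sub>F n :: nat in sequentially. (ln C3 / ln 4) / real k + real k \<le> (\<tau> - 1 / real k) / 3 * (ln (real n) / ln 4)"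
  proof -
    have "filterlim (\<lambda>n :: nat. (\<tau> - 1 / real k) / 3 * (ln (real n) / ln 4)) at_top at_top"
      using l4 \<delta> by real_asymp
    thus ?thesis unfolding filterlim_at_top by blast
  qed
  have "\<forall>\<^sub>F n in sequentially. \<forall>S. real n \<le> 4 ^ S \<and> 4 ^ S \<le> C3 * real n powr (1 + \<kappa>)
        \<longrightarrow> c1 * ln (real n) ^ (k - 1) \<le> real (card (scale_box k \<tau> S n))"
    using eventually_ge_at_top[of 1] ev1 ev2
  proof eventually_elim
    case (elim n)
    show ?case
    proof (intro allI impI, elim conjE)
      fix S assume lo: "real n \<le> 4 ^ S" and hi: "4 ^ S \<le> C3 * real n powr (1 + \<kappa>)"
      define x where "x = ln (real n) / ln 4"
      have x0: "0 \<le> x" unfolding x_def using elim(1) by simp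
      have "ln (real n) \<le> ln (4 ^ S)" using lo elim(1) by (intro ln_mono) auto
      hence Slo: "x \<le> real S" unfolding x_def by (simp add: ln_realpow divide_le_eq)
      have "ln (4 ^ S) \<le> ln (C3 * real n powr (1 + \<kappa>))" using hi by (intro ln_mono) auto
      also have "... = ln C3 + (1 + \<kappa>) * ln (real n)"
        using C3 elim(1) by (subst ln_mult) (auto simp: ln_powr)
      finally have "real S * ln 4 \<le> ln C3 + (1 + \<kappa>) * ln (real n)" by (simp add: ln_realpow)
      hence "real S \<le> (ln C3 + (1 + \<kappa>) * ln (real n)) / ln 4" using l4 by (simp add: le_divide_eq)
      hence Shi: "real S \<le> ln C3 / ln 4 + (1 + \<kappa>) * x" unfolding x_def by (simp add: add_divide_distrib)
      define s where "s = nat \<lfloor>\<rho> * x\<rfloor>"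
      have s_le: "real s \<le> \<rho> * x" unfolding s_def using \<rho> x0 by simp
      have s_ge: "\<rho> * x \<le> real s + 1" unfolding s_def using \<rho> x0 by linarith
      have "real S = real (S div k) * real k + real (S mod k)"
        by (metis div_mult_mod_eq of_nat_add of_nat_mult)
      hence Sdiv: "real S / real k = real (S div k) + real (S mod k) / real k" using k0 by (simp add: add_divide_distrib)
      have "S mod k < k" using k by simp
      hence "real (S mod k) / real k \<le> 1" using k0 by simp
      moreover have "0 \<le> real (S mod k) / real k" by simp
      ultimately have q1: "real (S div k) \<le> real S / real k" and q2: "real S / real k - 1 \<le> real (S div k)"
        unfolding Sdiv by linarith+
      have "x / real k \<le> real S / real k" using Slo k0 by (intro divide_right_mono) auto
      moreover have "1 \<le> x / real k - \<rho> * x" using elim(2) unfolding x_def[symmetric] by (simp add: left_diff_distrib)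
      ultimately have "real s \<le> real (S div k)" using s_le q2 by linarith
      hence sq: "s \<le> S div k" by simp
      have "real S / real k \<le> (ln C3 / ln 4 + (1 + \<kappa>) * x) / real k" using Shi k0 by (intro divide_right_mono) auto
      also have "... = (ln C3 / ln 4) / real k + (1 / real k + (\<tau> - 1 / real k) / 3) * x"
        unfolding \<kappa> using k0 by (simp add: field_simps)
      finally have f1: "real S / real k \<le> (ln C3 / ln 4) / real k + (1 / real k + (\<tau> - 1 / real k) / 3) * x" .
      have f2: "real k * real s \<le> (\<tau> - 1 / real k) / 3 * x"
      proof -
        have "real k * real s \<le> real k * (\<rho> * x)" using s_le by (intro mult_left_mono) auto
        also have "... = (\<tau> - 1 / real k) / 3 * x" unfolding \<rho>_def using k0 by simp
        finally show ?thesis .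
      qed
      have f3: "(ln C3 / ln 4) / real k + real k \<le> (\<tau> - 1 / real k) / 3 * x"
        using elim(3) unfolding x_def .
      have "real (S div k) + real k + real k * real s \<le> \<tau> * x"
      proof -
        define D where "D = (\<tau> - 1 / real k) / 3 * x"
        have e1: "(1 / real k + (\<tau> - 1 / real k) / 3) * x = x / real k + D"
          unfolding D_def by (simp add: field_simps)
        have e2: "3 * D = \<tau> * x - x / real k" unfolding D_def by (simp add: field_simps)
        show ?thesis using f1[unfolded e1] f2[folded D_def] f3[folded D_def] q1 e2 by linarith
      qed
      hence "(real (S div k) + real k + real k * real s) * ln 4 \<le> \<tau> * x * ln 4"
        using l4 by (intro mult_right_mono) auto
      hence fits: "real (S div k + k + k * s) * ln 4 \<le> \<tau> * ln (real n)"
        unfolding x_def by simp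
      have "(s + 1) ^ (k - 1) \<le> card (scale_box k \<tau> S n)"
        using k by (intro card_scale_box_ge sq elim(1) fits \<tau>0 \<tau>) auto
      hence "real ((s + 1) ^ (k - 1)) \<le> real (card (scale_box k \<tau> S n))" by (rule of_nat_mono)
      moreover have "c1 * ln (real n) ^ (k - 1) = (\<rho> * x) ^ (k - 1)"
        unfolding c1_def x_def by (simp add: power_mult_distrib power_divide)
      moreover have "(\<rho> * x) ^ (k - 1) \<le> (real s + 1) ^ (k - 1)"
        using s_ge \<rho> x0 by (intro power_mono) auto
      moreover have "real ((s + 1) ^ (k - 1)) = (real s + 1) ^ (k - 1)" by (simp add: add.commute)
      ultimately show "c1 * ln (real n) ^ (k - 1) \<le> real (card (scale_box k \<tau> S n))" by linarith
    qed
  qed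
  moreover have "0 < c1" unfolding c1_def using \<rho> l4 by simp
  ultimately show thesis by (rule that[rotated])
qed

section \<open>Divergence after truncation\<close>

lemma summable_powr_log:
  fixes \<kappa> :: real
  assumes \<kappa>: "0 < \<kappa>"
  shows "summable (\<lambda>n. real n powr (- 1 - \<kappa>) * ln (real n) ^ j)"
proof -
  have ev: "\<forall>\<^sub>F n :: nat in sequentially. 1 * ((ln (real n) + 1) ^ Suc j * real n powr (- (\<kappa> / 2))) < 1"
    using \<kappa> by (intro log_power_eventually_small) auto
  have "summable (\<lambda>n. real n powr (- 1 - \<kappa> / 2))"
    using \<kappa> by (simp add: summable_real_powr_iff)
  moreover have "\<forall>\<^sub>F n in sequentially. norm (real n powr (- 1 - \<kappa>) * ln (real n) ^ j) \<le> real n powr (- 1 - \<kappa> / 2)"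
    using ev eventually_ge_at_top[of 1]
  proof eventually_elim
    case (elim n)
    have l0: "0 \<le> ln (real n)" using elim(2) by simp
    have "ln (real n) ^ j \<le> (ln (real n) + 1) ^ j" using l0 by (intro power_mono) auto
    also have "... \<le> (ln (real n) + 1) ^ Suc j" using l0 by (intro power_increasing) auto
    finally have "ln (real n) ^ j * real n powr (- (\<kappa> / 2)) \<le> 1"
      using elim(1) mult_right_mono[of "ln (real n) ^ j" "(ln (real n) + 1) ^ Suc j" "real n powr (- (\<kappa> / 2))"]
      by simp
    hence "real n powr (- 1 - \<kappa> / 2) * (ln (real n) ^ j * real n powr (- (\<kappa> / 2))) \<le> real n powr (- 1 - \<kappa> / 2) * 1"
      by (intro mult_left_mono) auto
    moreover have "real n powr (- 1 - \<kappa>) = real n powr (- 1 - \<kappa> / 2) * real n powr (- (\<kappa> / 2))"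
    proof -
      have e: "- 1 - \<kappa> = (- 1 - \<kappa> / 2) + (- (\<kappa> / 2))" by simp
      show ?thesis by (subst e) (rule powr_add)
    qed
    ultimately show ?case using l0 by (simp add: mult_ac)
  qed
  ultimately show ?thesis by (rule summable_comparison_test_ev[rotated])
qed

text \<open>Either \<psi>(n) \<le> 1/n eventually and truncation changes nothing, or \<psi>(n) > 1/n
  for arbitrarily large n. In the second case monotonicity keeps the truncated function at least 1/n
  on a whole block from n/2 to n, and blocks contributing at least 1/4 violate the Cauchy
  criterion.\<close>

lemma min_inverse_not_summable:
  fixes \<psi> :: "nat \<Rightarrow> real"
  assumes nn: "\<And>n. 1 \<le> n \<Longrightarrow> 0 \<le> \<psi> n"
    and mono: "\<And>m n. 1 \<le> m \<Longrightarrow> m \<le> n \<Longrightarrow> \<psi> n \<le> \<psi> m"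
    and div: "\<not> summable (\<lambda>n. \<psi> (Suc n) * ln (real (Suc n)) ^ j)"
  shows "\<not> summable (\<lambda>n. min (\<psi> (Suc n)) (1 / real (Suc n)) * ln (real (Suc n)) ^ j)"
proof
  define g where "g n = min (\<psi> (Suc n)) (1 / real (Suc n)) * ln (real (Suc n)) ^ j" for n
  assume "summable (\<lambda>n. min (\<psi> (Suc n)) (1 / real (Suc n)) * ln (real (Suc n)) ^ j)"
  hence sg: "summable g" unfolding g_def .
  show False
  proof (cases "\<forall>\<^sub>F n in sequentially. \<psi> (Suc n) \<le> 1 / real (Suc n)")
    case True
    hence "\<forall>\<^sub>F n in sequentially. g n = \<psi> (Suc n) * ln (real (Suc n)) ^ j"
      by eventually_elim (simp add: g_def min_def)
    thus False using sg div summable_cong by metis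
  next
    case False
    obtain N where N: "\<And>m n. N \<le> m \<Longrightarrow> norm (sum g {m..<n}) < 1/4"
      using sg unfolding summable_Cauchy by (metis zero_less_divide_1_iff zero_less_numeral)
    \<comment> \<open>The 10 makes the indices of the block larger than e, so that the logarithms
      are at least 1.\<close>
    obtain n where n: "2 * N + 10 \<le> n" "\<not> \<psi> (Suc n) \<le> 1 / real (Suc n)"
      using False unfolding eventually_sequentially by blast
    have each: "1 / real (Suc n) \<le> g m" if m: "m \<in> {n div 2..<n}" for m
    proof -
      have "1 / real (Suc n) \<le> \<psi> (Suc m)" using mono[of "Suc m" "Suc n"] m n by auto
      moreover have "1 / real (Suc n) \<le> 1 / real (Suc m)" using m by (intro frac_le) auto
      ultimately have a: "1 / real (Suc n) \<le> min (\<psi> (Suc m)) (1 / real (Suc m))" by simp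
      have "3 \<le> Suc m" using m n by auto
      hence "exp 1 \<le> real (Suc m)" using exp_le by linarith
      hence "1 \<le> ln (real (Suc m))" by (subst ln_ge_iff) auto
      hence b: "1 \<le> ln (real (Suc m)) ^ j" by (rule one_le_power)
      have "1 / real (Suc n) * 1 \<le> min (\<psi> (Suc m)) (1 / real (Suc m)) * ln (real (Suc m)) ^ j"
      proof (rule mult_mono[OF a b])
        have "0 \<le> 1 / real (Suc n)" by simp
        thus "0 \<le> min (\<psi> (Suc m)) (1 / real (Suc m))" using a by (rule order_trans)
      qed simp
      thus ?thesis unfolding g_def by simp
    qed
    have "1 / 4 \<le> real (n - n div 2) * (1 / real (Suc n))"
    proof -
      have "Suc n \<le> 4 * (n - n div 2)" using n by linarith
      hence "real (Suc n) \<le> real (4 * (n - n div 2))" by (simp only: of_nat_le_iff)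
      thus ?thesis by (simp add: field_simps)
    qed
    also have "... = (\<Sum>m\<in>{n div 2..<n}. 1 / real (Suc n))" by simp
    also have "... \<le> sum g {n div 2..<n}" by (intro sum_mono each)
    finally have "1 / 4 \<le> norm (sum g {n div 2..<n})" by simp
    moreover have "N \<le> n div 2" using n by linarith
    ultimately show False using N[of "n div 2" n] by linarith
  qed
qed

text \<open>Where \<phi>(n) is below n^(-1 - \<kappa>) the series converges, so the divergence is
  carried by the other n. On these, 1/\<phi>(n) is at most n^(1 + \<kappa>), the upper bound on
  \<open>4 ^ S\<close> under which the boxes were counted.\<close>

lemma truncated_divergence:
  fixes \<psi> :: "nat \<Rightarrow> real" and \<kappa> :: real
  assumes nn: "\<And>n. 1 \<le> n \<Longrightarrow> 0 \<le> \<psi> n"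
    and mono: "\<And>m n. 1 \<le> m \<Longrightarrow> m \<le> n \<Longrightarrow> \<psi> n \<le> \<psi> m"
    and div: "\<not> summable (\<lambda>n. \<psi> (Suc n) * ln (real (Suc n)) ^ j)"
    and \<kappa>: "0 < \<kappa>" and N0: "1 \<le> N0"
    and \<phi>: "\<And>n. \<phi> n = min (\<psi> n) (1 / real n)"
  obtains J where "finite J" "J \<subseteq> {n. N0 \<le> n \<and> real n powr (- 1 - \<kappa>) \<le> \<phi> n}" "M < (\<Sum>n\<in>J. \<phi> n * ln (real n) ^ j)"
proof (rule ccontr)
  note obt = that
  assume neg: "\<not> thesis"
  define G where "G = {n. N0 \<le> n \<and> real n powr (- 1 - \<kappa>) \<le> \<phi> n}"
  define g where "g n = \<phi> n * ln (real n) ^ j" for n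
  have g0: "0 \<le> g n" if "1 \<le> n" for n unfolding g_def \<phi> using nn[OF that] that by simp
  have bd: "(\<Sum>n\<in>J. g n) \<le> M" if "finite J" "J \<subseteq> G" for J
    using neg obt[OF that(1) that(2)[unfolded G_def]] unfolding g_def by linarith
  have "summable (\<lambda>n. if n \<in> G then g n else 0)"
  proof (rule summableI_nonneg_bounded)
    fix n show "0 \<le> (if n \<in> G then g n else 0)" using g0 N0 by (auto simp: G_def)
    have "(\<Sum>i<n. if i \<in> G then g i else 0) = (\<Sum>i\<in>{i\<in>{..<n}. i \<in> G}. g i)"
      by (rule sum.inter_filter[symmetric]) simp
    also have "... \<le> M" by (rule bd) auto
    finally show "(\<Sum>i<n. if i \<in> G then g i else 0) \<le> M" .
  qed
  hence "summable (\<lambda>n. (if n \<in> G then g n else 0) + real n powr (- 1 - \<kappa>) * ln (real n) ^ j)"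
    by (intro summable_add summable_powr_log \<kappa>)
  moreover have "\<forall>\<^sub>F n in sequentially. norm (g n) \<le> (if n \<in> G then g n else 0) + real n powr (- 1 - \<kappa>) * ln (real n) ^ j"
    using eventually_ge_at_top[of N0]
  proof eventually_elim
    case (elim n)
    have n1: "1 \<le> n" using elim N0 by simp
    hence l0: "0 \<le> ln (real n) ^ j" by simp
    show ?case
    proof (cases "n \<in> G")
      case True
      thus ?thesis using g0[OF n1] l0 by simp
    next
      case False
      hence "\<phi> n \<le> real n powr (- 1 - \<kappa>)" using elim unfolding G_def by auto
      hence "g n \<le> real n powr (- 1 - \<kappa>) * ln (real n) ^ j" unfolding g_def using l0 by (rule mult_right_mono)
      thus ?thesis using False g0[OF n1] by simp
    qed
  qed
  ultimately have "summable g" by (rule summable_comparison_test_ev[rotated])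
  hence "summable (\<lambda>n. g (Suc n))" by (simp add: summable_Suc_iff)
  thus False using min_inverse_not_summable[OF nn mono div] unfolding g_def \<phi> by simp
qed

section \<open>From the variance to almost every point\<close>

interpretation lborel_product: product_sigma_finite "\<lambda>_ :: nat. lborel :: real measure" ..

abbreviation lborel_prod :: "nat set \<Rightarrow> (nat \<Rightarrow> real) measure" where
  "lborel_prod I \<equiv> \<Pi>\<^sub>M i\<in>I. lborel"

definition weight_prod :: "nat set \<Rightarrow> (nat \<Rightarrow> real) \<Rightarrow> real" where
  "weight_prod I x = (\<Prod>i\<in>I. weight (x i))"

lemma weight_prod_pos: "0 < weight_prod I x"
  unfolding weight_prod_def by (intro prod_pos) (auto intro: weight_pos)

lemma measurable_weight_prod [measurable]: "weight_prod I \<in> borel_measurable (lborel_prod I)"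
  unfolding weight_prod_def by measurable

definition weight_mass :: "nat set \<Rightarrow> real" where
  "weight_mass I = (\<integral>x. weight x \<partial>lborel) ^ card I"

lemma weight_mass_nonneg: "0 \<le> weight_mass I"
  unfolding weight_mass_def by (intro zero_le_power Bochner_Integration.integral_nonneg) (auto intro: weight_pos less_imp_le)

lemma weight_prod_character:
  fixes \<omega> :: "nat \<Rightarrow> real"
  assumes I: "finite I"
  shows integrable_weight_prod_cis:
      "integrable (lborel_prod I) (\<lambda>x. of_real (weight_prod I x) * cis (\<Sum>i\<in>I. \<omega> i * x i))" (is ?int)
    and "cmod (\<integral>x. of_real (weight_prod I x) * cis (\<Sum>i\<in>I. \<omega> i * x i) \<partial>(lborel_prod I)) \<le> weight_mass I" (is ?bound)
    and "i \<in> I \<Longrightarrow> 1 \<le> \<bar>\<omega> i\<bar> \<Longrightarrow>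
      (\<integral>x. of_real (weight_prod I x) * cis (\<Sum>i\<in>I. \<omega> i * x i) \<partial>(lborel_prod I)) = 0"
proof -
  have eq: "of_real (weight_prod I x) * cis (\<Sum>i\<in>I. \<omega> i * x i) = (\<Prod>i\<in>I. of_real (weight (x i)) * cis (\<omega> i * x i))" for x
    unfolding weight_prod_def by (simp add: prod.distrib cis_sum)
  show ?int
    unfolding eq by (intro lborel_product.product_integrable_prod I integrable_weight_cis)
  have int: "(\<integral>x. of_real (weight_prod I x) * cis (\<Sum>i\<in>I. \<omega> i * x i) \<partial>(lborel_prod I))
     = (\<Prod>i\<in>I. \<integral>x. of_real (weight x) * cis (\<omega> i * x) \<partial>lborel)"
    unfolding eq by (intro lborel_product.product_integral_prod I integrable_weight_cis)
  have "cmod (\<integral>x. of_real (weight x) * cis (\<omega> i * x) \<partial>lborel) \<le> (\<integral>x. weight x \<partial>lborel)" for i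
  proof -
    have "cmod (\<integral>x. of_real (weight x) * cis (\<omega> i * x) \<partial>lborel) \<le> (\<integral>x. cmod (of_real (weight x) * cis (\<omega> i * x)) \<partial>lborel)"
      by (rule integral_norm_bound)
    also have "... = (\<integral>x. weight x \<partial>lborel)" by (simp add: norm_mult less_imp_le[OF weight_pos])
    finally show ?thesis .
  qed
  hence "(\<Prod>i\<in>I. cmod (\<integral>x. of_real (weight x) * cis (\<omega> i * x) \<partial>lborel)) \<le> (\<Prod>i\<in>I. \<integral>x. weight x \<partial>lborel)"
    by (intro prod_mono) auto
  thus ?bound unfolding int weight_mass_def by (simp add: prod_norm[symmetric])
  show "(\<integral>x. of_real (weight_prod I x) * cis (\<Sum>i\<in>I. \<omega> i * x i) \<partial>(lborel_prod I)) = 0"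
    if "i \<in> I" "1 \<le> \<bar>\<omega> i\<bar>"
    unfolding int using I that weight_fourier(2) by (auto intro!: prod_zero)
qed

text \<open>Since the Fourier transform of the weight has compact support, only pairs of nearby
  frequencies contribute.\<close>

lemma weighted_square_integral_le:
  fixes c :: "'j \<Rightarrow> complex" and \<omega> :: "'j \<Rightarrow> nat \<Rightarrow> real"
  assumes I: "finite I" and J: "finite J"
  shows "(\<integral>\<^sup>+x. ennreal (weight_prod I x * (cmod (\<Sum>j\<in>J. c j * cis (\<Sum>i\<in>I. \<omega> j i * x i)))\<^sup>2) \<partial>(lborel_prod I))
    \<le> ennreal (weight_mass I * (\<Sum>(j, l)\<in>{(j, l). j \<in> J \<and> l \<in> J \<and> (\<forall>i\<in>I. \<bar>\<omega> j i - \<omega> l i\<bar> < 1)}. cmod (c j) * cmod (c l)))"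
proof -
  let ?M = "lborel_prod I"
  define P where "P x = (\<Sum>j\<in>J. c j * cis (\<Sum>i\<in>I. \<omega> j i * x i))" for x
  define h where "h j l x = of_real (weight_prod I x) * cis (\<Sum>i\<in>I. (\<omega> j i - \<omega> l i) * x i)" for j l x
  define near where "near = {(j, l). j \<in> J \<and> l \<in> J \<and> (\<forall>i\<in>I. \<bar>\<omega> j i - \<omega> l i\<bar> < 1)}"
  have near: "near \<subseteq> J \<times> J" unfolding near_def by auto
  have h_int: "integrable ?M (h j l)" for j l
    unfolding h_def by (rule integrable_weight_prod_cis[OF I])
  have expand: "complex_of_real (weight_prod I x * (cmod (P x))\<^sup>2) = (\<Sum>(j, l)\<in>J \<times> J. c j * cnj (c l) * h j l x)" for x
  proof -
    have "complex_of_real (weight_prod I x * (cmod (P x))\<^sup>2) = of_real (weight_prod I x) * (P x * cnj (P x))"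
      by (simp only: of_real_mult complex_norm_square)
    also have "... = (\<Sum>j\<in>J. \<Sum>l\<in>J. of_real (weight_prod I x) * ((c j * cis (\<Sum>i\<in>I. \<omega> j i * x i)) * cnj (c l * cis (\<Sum>i\<in>I. \<omega> l i * x i))))"
      unfolding P_def cnj_sum sum_product by (simp add: sum_distrib_left)
    also have "... = (\<Sum>j\<in>J. \<Sum>l\<in>J. c j * cnj (c l) * h j l x)"
    proof (intro sum.cong refl)
      fix j l
      have "(\<Sum>i\<in>I. (\<omega> j i - \<omega> l i) * x i) = (\<Sum>i\<in>I. \<omega> j i * x i) + - (\<Sum>i\<in>I. \<omega> l i * x i)"
        by (simp add: left_diff_distrib sum_subtractf)
      hence "cis (\<Sum>i\<in>I. (\<omega> j i - \<omega> l i) * x i) = cis (\<Sum>i\<in>I. \<omega> j i * x i) * cnj (cis (\<Sum>i\<in>I. \<omega> l i * x i))"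
        by (simp only: cis_mult cis_cnj)
      thus "of_real (weight_prod I x) * ((c j * cis (\<Sum>i\<in>I. \<omega> j i * x i)) * cnj (c l * cis (\<Sum>i\<in>I. \<omega> l i * x i))) = c j * cnj (c l) * h j l x"
        unfolding h_def by simp
    qed
    finally show ?thesis by (simp add: sum.cartesian_product)
  qed
  have int_c: "integrable ?M (\<lambda>x. complex_of_real (weight_prod I x * (cmod (P x))\<^sup>2))"
    unfolding expand by (intro Bochner_Integration.integrable_sum) (auto simp: case_prod_unfold intro!: integrable_mult_right h_int)
  hence int_r: "integrable ?M (\<lambda>x. weight_prod I x * (cmod (P x))\<^sup>2)"
    using integrable_Re[OF int_c] by simp
  have "complex_of_real (\<integral>x. weight_prod I x * (cmod (P x))\<^sup>2 \<partial>?M) = (\<integral>x. complex_of_real (weight_prod I x * (cmod (P x))\<^sup>2) \<partial>?M)"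
    by (rule integral_complex_of_real[symmetric])
  also have "... = (\<Sum>(j, l)\<in>J \<times> J. c j * cnj (c l) * (\<integral>x. h j l x \<partial>?M))"
    unfolding expand by (subst Bochner_Integration.integral_sum) (auto simp: case_prod_unfold intro!: integrable_mult_right h_int)
  also have "... = (\<Sum>(j, l)\<in>near. c j * cnj (c l) * (\<integral>x. h j l x \<partial>?M))"
  proof (rule sum.mono_neutral_right)
    show "finite (J \<times> J)" using J by simp
    show "\<forall>x\<in>J \<times> J - near. (case x of (j, l) \<Rightarrow> c j * cnj (c l) * (\<integral>x. h j l x \<partial>?M)) = 0"
    proof clarify
      fix j l assume "j \<in> J" "l \<in> J" "(j, l) \<notin> near"
      then obtain i where "i \<in> I" "1 \<le> \<bar>\<omega> j i - \<omega> l i\<bar>" unfolding near_def by (auto simp: not_less)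
      hence "(\<integral>x. h j l x \<partial>?M) = 0" unfolding h_def by (rule weight_prod_character(3)[OF I])
      thus "c j * cnj (c l) * (\<integral>x. h j l x \<partial>?M) = 0" by simp
    qed
  qed (rule near)
  finally have "cmod (complex_of_real (\<integral>x. weight_prod I x * (cmod (P x))\<^sup>2 \<partial>?M)) \<le> (\<Sum>(j, l)\<in>near. cmod (c j * cnj (c l) * (\<integral>x. h j l x \<partial>?M)))"
    by (simp only: case_prod_unfold) (rule norm_sum)
  also have "... \<le> (\<Sum>(j, l)\<in>near. weight_mass I * (cmod (c j) * cmod (c l)))"
  proof (intro sum_mono, clarify)
    fix j l
    have "cmod (\<integral>x. h j l x \<partial>?M) \<le> weight_mass I" unfolding h_def by (rule weight_prod_character(2)[OF I])
    hence "cmod (c j) * cmod (c l) * cmod (\<integral>x. h j l x \<partial>?M) \<le> cmod (c j) * cmod (c l) * weight_mass I"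
      by (intro mult_left_mono) auto
    thus "cmod (c j * cnj (c l) * (\<integral>x. h j l x \<partial>?M)) \<le> weight_mass I * (cmod (c j) * cmod (c l))"
      by (simp add: norm_mult mult.commute)
  qed
  also have "... = weight_mass I * (\<Sum>(j, l)\<in>near. cmod (c j) * cmod (c l))"
    by (simp add: sum_distrib_left case_prod_unfold)
  finally have "(\<integral>x. weight_prod I x * (cmod (P x))\<^sup>2 \<partial>?M) \<le> weight_mass I * (\<Sum>(j, l)\<in>near. cmod (c j) * cmod (c l))"
    by (simp add: abs_le_iff)
  moreover have "(\<integral>\<^sup>+x. ennreal (weight_prod I x * (cmod (P x))\<^sup>2) \<partial>?M) = ennreal (\<integral>x. weight_prod I x * (cmod (P x))\<^sup>2 \<partial>?M)"
    using int_r by (intro nn_integral_eq_integral) (auto intro!: mult_nonneg_nonneg less_imp_le[OF weight_prod_pos])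
  ultimately show ?thesis unfolding P_def near_def by (simp add: ennreal_leI)
qed

text \<open>A second moment criterion: no convergence is needed, because \<open>F\<close> stays bounded along the
  sequence only on a set where it deviates from its mean by at least a quarter of \<open>m\<close>.\<close>

lemma unbounded_AE_of_variance:
  fixes F :: "nat \<Rightarrow> (nat \<Rightarrow> real) \<Rightarrow> real" and E m :: "nat \<Rightarrow> real"
  assumes meas [measurable]: "\<And>p. F p \<in> borel_measurable (lborel_prod I)"
    and var: "\<And>p. (\<integral>\<^sup>+x. ennreal (weight_prod I x * (F p x - E p)\<^sup>2) \<partial>(lborel_prod I)) \<le> ennreal (K * m p)"
    and E: "\<And>p. m p / 2 \<le> E p" and m: "\<And>p. real p < m p" and K: "0 \<le> K"
  shows "AE x in (lborel_prod I). \<forall>R :: nat. \<exists>p. real R < F p x"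
proof -
  let ?M = "lborel_prod I"
  have "AE x in ?M. \<exists>p. real R < F p x" for R :: nat
  proof -
    define Z where "Z = {x \<in> space ?M. \<forall>p. F p x \<le> real R}"
    have Z [measurable]: "Z \<in> sets ?M" unfolding Z_def by measurable
    define v where "v = (\<integral>\<^sup>+x. ennreal (weight_prod I x) * indicator Z x \<partial>?M)"
    \<comment> \<open>For such p the bound R is at most m/4, so on \<open>Z\<close> the mean exceeds
      F by at least m/2 - m/4, and Chebyshev's inequality gives 16K/m.\<close>
    have v_le: "v \<le> ennreal (16 * K / real p)" if p: "4 * R + 1 \<le> p" for p
    proof -
      have mp: "4 * real R \<le> m p" "real p < m p" "0 < m p" using m[of p] p by auto
      have "ennreal ((m p / 4)\<^sup>2) * v = (\<integral>\<^sup>+x. ennreal ((m p / 4)\<^sup>2) * (ennreal (weight_prod I x) * indicator Z x) \<partial>?M)"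
        unfolding v_def by (rule nn_integral_cmult[symmetric]) measurable
      also have "... \<le> (\<integral>\<^sup>+x. ennreal (weight_prod I x * (F p x - E p)\<^sup>2) \<partial>?M)"
      proof (rule nn_integral_mono)
        fix x
        show "ennreal ((m p / 4)\<^sup>2) * (ennreal (weight_prod I x) * indicator Z x) \<le> ennreal (weight_prod I x * (F p x - E p)\<^sup>2)"
        proof (cases "x \<in> Z")
          case True
          hence "F p x \<le> real R" unfolding Z_def by simp
          hence "m p / 4 \<le> E p - F p x" using E[of p] mp by linarith
          hence "(m p / 4)\<^sup>2 \<le> (E p - F p x)\<^sup>2" using mp by (intro power_mono) auto
          hence "(m p / 4)\<^sup>2 * weight_prod I x \<le> weight_prod I x * (F p x - E p)\<^sup>2"
            using weight_prod_pos[of I x] by (simp add: power2_commute mult.commute)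
          thus ?thesis using True weight_prod_pos[of I x]
            by (simp add: ennreal_leI less_imp_le flip: ennreal_mult)
        qed simp
      qed
      also have "... \<le> ennreal (K * m p)" by (rule var)
      finally have le: "ennreal ((m p / 4)\<^sup>2) * v \<le> ennreal (K * m p)" .
      have pos: "0 < (m p / 4)\<^sup>2" using mp by simp
      have "v = ennreal (1 / (m p / 4)\<^sup>2) * (ennreal ((m p / 4)\<^sup>2) * v)"
        using pos by (simp flip: mult.assoc ennreal_mult)
      also have "... \<le> ennreal (1 / (m p / 4)\<^sup>2) * ennreal (K * m p)" using le by (rule mult_left_mono) simp
      also have "... = ennreal (16 * K / m p)"
        using mp K by (simp add: power2_eq_square flip: ennreal_mult)
      also have "... \<le> ennreal (16 * K / real p)"
        using mp K p by (intro ennreal_leI divide_left_mono) auto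
      finally show ?thesis .
    qed
    have "(\<lambda>p :: nat. 16 * K / real p) \<longlonglongrightarrow> 0" by real_asymp
    hence "(\<lambda>p :: nat. ennreal (16 * K / real p)) \<longlonglongrightarrow> ennreal 0" by (rule tendsto_ennrealI)
    hence "v \<le> ennreal 0"
      by (rule tendsto_lowerbound[OF _ _ sequentially_bot])
         (use v_le in \<open>auto simp: eventually_sequentially\<close>)
    hence "v = 0" by simp
    hence "AE x in ?M. ennreal (weight_prod I x) * indicator Z x = 0"
      unfolding v_def by (subst (asm) nn_integral_0_iff_AE) auto
    thus ?thesis
    proof (rule AE_mp, intro AE_I2 impI)
      fix x assume x: "x \<in> space ?M" and "ennreal (weight_prod I x) * indicator Z x = 0"
      hence "x \<notin> Z" using weight_prod_pos[of I x] by (auto simp: indicator_def)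
      thus "\<exists>p. real R < F p x" using x unfolding Z_def by (auto simp: not_le)
    qed
  qed
  thus ?thesis by (simp add: AE_all_countable)
qed

section \<open>Characters restricted to the hyperplane\<close>

definition hyperplane_point :: "nat \<Rightarrow> (nat \<Rightarrow> real) \<Rightarrow> real \<Rightarrow> (nat \<Rightarrow> real) \<Rightarrow> nat \<Rightarrow> real" where
  "hyperplane_point k \<alpha> d x = x(1 := d - (\<Sum>i=2..k. \<alpha> i * x i))"

lemma measurable_hyperplane_point_component:
  assumes "i \<in> {1..k}"
  shows "(\<lambda>x. hyperplane_point k \<alpha> d x i) \<in> borel_measurable (lborel_prod {2..k})"
proof (cases "i = 1")
  case True
  have "(\<lambda>x. x j) \<in> borel_measurable (lborel_prod {2..k})" if "j \<in> {2..k}" for j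
    using measurable_component_singleton[OF that, of "\<lambda>_. lborel"] by simp
  hence "(\<lambda>x. d - (\<Sum>i=2..k. \<alpha> i * x i)) \<in> borel_measurable (lborel_prod {2..k})"
    by (intro borel_measurable_diff borel_measurable_sum borel_measurable_times) auto
  thus ?thesis using True unfolding hyperplane_point_def by simp
next
  case False
  hence "i \<in> {2..k}" using assms by auto
  from measurable_component_singleton[OF this, of "\<lambda>_. lborel"] show ?thesis
    using False unfolding hyperplane_point_def by simp
qed

lemma nonzero_vec_iff:
  assumes "t \<in> freq_box k a"
  shows "nonzero_vec k t \<longleftrightarrow> t \<noteq> (\<lambda>i\<in>{1..k}. 0)"
proof -
  have "t = (\<lambda>i\<in>{1..k}. 0)" if "\<forall>i\<in>{1..k}. t i = 0"
  proof
    fix i show "t i = (\<lambda>i\<in>{1..k}. 0) i"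
    proof (cases "i \<in> {1..k}")
      case False
      thus ?thesis using PiE_arb[OF assms[unfolded freq_box_def] False] by (simp only: restrict_apply if_False)
    qed (use that in simp)
  qed
  thus ?thesis unfolding nonzero_vec_def by auto
qed

lemma zero_in_freq_box: "(\<lambda>i\<in>{1..k}. 0) \<in> freq_box k a"
  unfolding freq_box_def by (auto simp: restrict_PiE_iff)

text \<open>The offset \<open>d\<close> and the shift \<open>y\<close> occur only in the constant
  part of the phase, that is, in unimodular factors of the coefficients. The variance bound sees
  absolute values of coefficients only, so it is uniform in both and the inhomogeneous problem is no
  harder than the homogeneous one.\<close>

lemma phase_split:
  assumes "1 \<le> k"
  shows "(\<Sum>i=1..k. of_int (t i) * (real n * hyperplane_point k \<alpha> d x i - y i))
    = (of_int (t 1) * (real n * d - y 1) - (\<Sum>i=2..k. of_int (t i) * y i))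
      + (\<Sum>i=2..k. real n * (of_int (t i) - \<alpha> i * of_int (t 1)) * x i)"
proof -
  have split: "{1..k} = insert 1 {2..k}" using assms by auto
  have "(\<Sum>i=1..k. of_int (t i) * (real n * hyperplane_point k \<alpha> d x i - y i))
     = of_int (t 1) * (real n * (d - (\<Sum>i=2..k. \<alpha> i * x i)) - y 1) + (\<Sum>i=2..k. of_int (t i) * (real n * x i - y i))"
    unfolding split hyperplane_point_def by simp
  also have "(\<Sum>i=2..k. of_int (t i) * (real n * x i - y i)) = (\<Sum>i=2..k. real n * of_int (t i) * x i) - (\<Sum>i=2..k. of_int (t i) * y i)"
    by (simp add: sum_subtractf algebra_simps)
  also have "of_int (t 1) * (real n * (d - (\<Sum>i=2..k. \<alpha> i * x i)) - y 1)
     = of_int (t 1) * (real n * d - y 1) - (\<Sum>i=2..k. real n * \<alpha> i * of_int (t 1) * x i)"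
    by (simp add: sum_distrib_left algebra_simps)
  finally show ?thesis
    by (simp add: sum_subtractf algebra_simps)
qed

lemma sum_over_Sigma:
  assumes "finite A" "\<And>x. finite (B x)"
  shows "(\<Sum>z\<in>Sigma A B. f z) = (\<Sum>x\<in>A. \<Sum>y\<in>B x. f (x, y))"
  using assms by (subst sum.Sigma) auto

context variance_setup
begin

lemma finite_Box: "finite (Box n)"
proof (cases "n = 0")
  \<comment> \<open>\<open>0 powr \<tau>\<close> is 0, so no power of 4 obeys the cap and there are
    no boxes.\<close>
  case True
  have "1 \<in> {1..k}" using k by auto
  moreover have "\<not> (4 :: real) ^ j \<le> 0" for j by (simp add: not_le)
  ultimately have "Box n = {}" unfolding scale_box_def True by auto
  thus ?thesis by simp
qed (use finite_scale_box \<tau> in auto)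

text \<open>Reindexes the close pairs of terms by (n, m, a, b, t, s), which brings the sum into the
  form of \<open>variance_sum_le\<close>. The factor 4 is the square of the coefficient bound
  2.\<close>

lemma near_frequencies_le:
  fixes d :: real and cf :: "(nat \<Rightarrow> nat) \<Rightarrow> ivec \<Rightarrow> real" and ph :: "nat \<times> (nat \<Rightarrow> nat) \<times> ivec \<Rightarrow> real"
  assumes fin: "finite J" and sub: "J \<subseteq> G" and cf: "\<And>a t. \<bar>cf a t\<bar> \<le> 2"
    and JJ: "JJ = Sigma J (\<lambda>n. Sigma (Box n) (\<lambda>a. {t \<in> freq_box k a. nonzero_vec k t}))"
    and coef: "\<And>n a t. coef (n, a, t) = of_real (\<psi> n * cf a t) * cis (ph (n, a, t))"
    and freq: "\<And>n a t i. freq (n, a, t) i = 2 * pi * (real n * (of_int (t i) - \<alpha> i * of_int (t 1)))"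
  shows "(\<Sum>(j, l)\<in>{(j, l). j \<in> JJ \<and> l \<in> JJ \<and> (\<forall>i\<in>{2..k}. \<bar>freq j i - freq l i\<bar> < 1)}. cmod (coef j) * cmod (coef l))
    \<le> 4 * ((10 + 8 * 36 ^ k * C3) * (\<Sum>n\<in>J. mass n))"
proof -
  define near where "near = {(j, l). j \<in> JJ \<and> l \<in> JJ \<and> (\<forall>i\<in>{2..k}. \<bar>freq j i - freq l i\<bar> < 1)}"
  define U where "U = Sigma J (\<lambda>n. Sigma J (\<lambda>m. Sigma (Box n) (\<lambda>a. Sigma (Box m) (\<lambda>b. corr_pairs k \<alpha> n a m b))))"
  define \<Phi> :: "(nat \<times> (nat \<Rightarrow> nat) \<times> ivec) \<times> (nat \<times> (nat \<Rightarrow> nat) \<times> ivec) \<Rightarrow> _"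
    where "\<Phi> = (\<lambda>(j, l). (fst j, fst l, fst (snd j), fst (snd l), (snd (snd j), snd (snd l))))"
  have finU: "finite U" unfolding U_def using fin finite_Box by (intro finite_SigmaI) auto
  have inj: "inj_on \<Phi> near"
  proof (rule inj_onI)
    fix u v assume "\<Phi> u = \<Phi> v"
    thus "u = v" unfolding \<Phi>_def by (simp add: split_beta prod_eq_iff)
  qed
  have img: "\<Phi> ` near \<subseteq> U"
  proof (rule image_subsetI, clarify)
    fix n a t m b s assume nr: "((n, a, t), (m, b, s)) \<in> near"
    have mem: "n \<in> J" "a \<in> Box n" "t \<in> freq_box k a" "nonzero_vec k t" "m \<in> J" "b \<in> Box m" "s \<in> freq_box k b" "nonzero_vec k s"
      using nr unfolding near_def JJ by auto
    have "freq_close k \<alpha> n m t s"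
      unfolding freq_close_def
    proof
      fix i assume i: "i \<in> {2..k}"
      define z where "z = of_int (int n * t i - int m * s i) - \<alpha> i * of_int (int n * t 1 - int m * s 1)"
      have "\<bar>freq (n, a, t) i - freq (m, b, s) i\<bar> < 1" using nr i unfolding near_def by auto
      moreover have "freq (n, a, t) i - freq (m, b, s) i = 2 * pi * z"
        unfolding freq z_def by (simp add: algebra_simps)
      ultimately have "2 * pi * \<bar>z\<bar> < 1" by (simp add: abs_mult)
      moreover have "1 * \<bar>z\<bar> \<le> 2 * pi * \<bar>z\<bar>" using pi_gt3 by (intro mult_right_mono) auto
      ultimately have "\<bar>z\<bar> < 1" by linarith
      thus "\<bar>of_int (int n * t i - int m * s i) - \<alpha> i * of_int (int n * t 1 - int m * s 1)\<bar> < 1"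
        unfolding z_def .
    qed
    hence "(t, s) \<in> corr_pairs k \<alpha> n a m b" unfolding corr_pairs_def using mem by blast
    thus "\<Phi> ((n, a, t), (m, b, s)) \<in> U" unfolding U_def \<Phi>_def using mem by auto
  qed
  have \<psi>J: "0 < \<psi> n" if "n \<in> J" for n using \<psi>pos sub that by auto
  have "(\<Sum>(j, l)\<in>near. cmod (coef j) * cmod (coef l)) \<le> (\<Sum>x\<in>near. 4 * (\<psi> (fst (\<Phi> x)) * \<psi> (fst (snd (\<Phi> x)))))"
  proof (intro sum_mono, clarify)
    fix n a t m b s assume "((n, a, t), (m, b, s)) \<in> near"
    hence "n \<in> J" "m \<in> J" unfolding near_def JJ by auto
    hence p: "0 < \<psi> n" "0 < \<psi> m" using \<psi>J by auto
    have "cmod (coef (n, a, t)) \<le> 2 * \<psi> n" "cmod (coef (m, b, s)) \<le> 2 * \<psi> m"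
      unfolding coef norm_mult norm_cis norm_of_real abs_mult using p cf[of a t] cf[of b s]
      by (simp_all add: mult.commute mult_left_mono)
    hence "cmod (coef (n, a, t)) * cmod (coef (m, b, s)) \<le> (2 * \<psi> n) * (2 * \<psi> m)"
      using p by (intro mult_mono) auto
    thus "cmod (coef (n, a, t)) * cmod (coef (m, b, s)) \<le> 4 * (\<psi> (fst (\<Phi> ((n, a, t), (m, b, s)))) * \<psi> (fst (snd (\<Phi> ((n, a, t), (m, b, s))))))"
      unfolding \<Phi>_def by simp
  qed
  also have "... = (\<Sum>u\<in>\<Phi> ` near. 4 * (\<psi> (fst u) * \<psi> (fst (snd u))))"
    by (simp add: sum.reindex[OF inj])
  also have "... \<le> (\<Sum>u\<in>U. 4 * (\<psi> (fst u) * \<psi> (fst (snd u))))"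
  proof (rule sum_mono2[OF finU img])
    fix u assume "u \<in> U - \<Phi> ` near"
    hence "fst u \<in> J" "fst (snd u) \<in> J" unfolding U_def by auto
    thus "0 \<le> 4 * (\<psi> (fst u) * \<psi> (fst (snd u)))" using \<psi>J by (simp add: less_imp_le)
  qed
  also have "... = (\<Sum>n\<in>J. \<Sum>m\<in>J. \<Sum>a\<in>Box n. \<Sum>b\<in>Box m. \<Sum>ts\<in>corr_pairs k \<alpha> n a m b. 4 * (\<psi> n * \<psi> m))"
    unfolding U_def using fin finite_Box by (simp add: sum_over_Sigma sum_distrib_right)
  also have "... = 4 * (\<Sum>n\<in>J. \<Sum>m\<in>J. \<psi> n * \<psi> m * (\<Sum>a\<in>Box n. \<Sum>b\<in>Box m. real (card (corr_pairs k \<alpha> n a m b))))"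
    by (simp add: sum_distrib_left mult_ac)
  also have "... \<le> 4 * ((10 + 8 * 36 ^ k * C3) * (\<Sum>n\<in>J. mass n))"
    using variance_sum_le[OF fin sub] by simp
  finally show ?thesis unfolding near_def .
qed

text \<open>\<open>Slow\<close> makes the boxes small enough: the sides k/4^(a_i) multiply to
  k^k/4^S \<le> \<psi>(n), so a positive box summand certifies that n is a solution. As the other n
  contribute at most 0, finitely many solutions at x would bound all \<open>F p x\<close> by one
  number, while the second moment makes \<open>F p x\<close> unbounded in p for almost every
  x.\<close>

theorem AE_infinitely_often:
  fixes d :: real and y :: "nat \<Rightarrow> real"
  assumes Slow: "\<And>n. n \<in> G \<Longrightarrow> real k ^ k / \<psi> n \<le> 4 ^ S n"
    and unb: "\<And>M :: real. \<exists>J. finite J \<and> J \<subseteq> G \<and> M < (\<Sum>n\<in>J. mass n)"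
  shows "AE x in (lborel_prod {2..k}). infinite {n \<in> G.
    (\<Prod>i=1..k. nearest_int_dist (real n * hyperplane_point k \<alpha> d x i - y i)) < \<psi> n}"
proof -
  let ?M = "lborel_prod {2..k}"
  define zv :: ivec where "zv = (\<lambda>i\<in>{1..k}. 0)"
  define \<theta> where "\<theta> n x i = real n * hyperplane_point k \<alpha> d x i - y i" for n x i
  have k1: "1 \<le> k" using k by simp
  have "\<forall>a. \<exists>q. box_minorant k a q" using box_minorant_exists[OF k] ..
  from choice[OF this] obtain q where q: "\<forall>a. box_minorant k a (q a)" ..
  define cf where "cf a = fst (q a)" for a
  define g where "g a = snd (q a)" for a
  have bm: "box_minorant k a (cf a, g a)" for a using q unfolding cf_def g_def by simp
  note bm' = bm[unfolded box_minorant_def split_conv]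
  have gexp: "of_real (g a \<theta>) = (\<Sum>t\<in>freq_box k a. of_real (cf a t) * character k t \<theta>)" for a \<theta>
    by (rule bm'[THEN conjunct1, THEN spec])
  have cf2: "\<bar>cf a t\<bar> \<le> 2" for a t by (rule bm'[THEN conjunct2, THEN conjunct1, THEN spec])
  have cf0: "1 / 2 \<le> cf a zv" for a
    unfolding zv_def by (rule bm'[THEN conjunct2, THEN conjunct2, THEN conjunct1])
  note gfar = bm'[THEN conjunct2, THEN conjunct2, THEN conjunct2, rule_format]
  have hit: "(\<Prod>i=1..k. nearest_int_dist (\<theta> n x i)) < \<psi> n" if n: "n \<in> G" and a: "a \<in> Box n" and pos: "0 < g a (\<theta> n x)" for n a x
  proof -
    have near: "nearest_int_dist (\<theta> n x i) < real k / 4 ^ a i" if "i \<in> {1..k}" for i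
      using gfar[OF that, of a "\<theta> n x"] pos by linarith
    have "(\<Prod>i=1..k. nearest_int_dist (\<theta> n x i)) < (\<Prod>i=1..k. real k / 4 ^ a i)"
    proof -
      have "0 \<le> nearest_int_dist (\<theta> n x i)" for i by (simp add: nearest_int_dist_def)
      thus ?thesis using near less_imp_le[OF near] k1 by (intro prod_mono_strict) auto
    qed
    also have "... = real k ^ k / 4 ^ S n"
      using a unfolding scale_box_def by (simp add: prod_dividef power_sum[symmetric])
    also have "... \<le> \<psi> n"
      using Slow[OF n] \<psi>pos[OF n] by (simp add: field_simps)
    finally show ?thesis .
  qed
  have "\<forall>p :: nat. \<exists>J. finite J \<and> J \<subseteq> G \<and> real p < (\<Sum>n\<in>J. mass n)"
    using unb by blast
  from choice[OF this] obtain J where "\<forall>p :: nat. finite (J p) \<and> J p \<subseteq> G \<and> real p < (\<Sum>n\<in>J p. mass n)" ..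
  hence J: "\<And>p. finite (J p)" "\<And>p. J p \<subseteq> G" "\<And>p :: nat. real p < (\<Sum>n\<in>J p. mass n)" by simp_all
  define m where "m p = (\<Sum>n\<in>J p. mass n)" for p
  define F where "F p x = (\<Sum>n\<in>J p. \<Sum>a\<in>Box n. \<psi> n * g a (\<theta> n x))" for p x
  define E where "E p = (\<Sum>n\<in>J p. \<Sum>a\<in>Box n. \<psi> n * cf a zv)" for p
  define ph where "ph = (\<lambda>(n :: nat, a :: nat \<Rightarrow> nat, t :: ivec). 2 * pi * (of_int (t 1) * (real n * d - y 1) - (\<Sum>i=2..k. of_int (t i) * y i)))"
  define coef where "coef = (\<lambda>(n, a, t). complex_of_real (\<psi> n * cf a t) * cis (ph (n, a, t)))"
  define freq where "freq = (\<lambda>(n :: nat, a :: nat \<Rightarrow> nat, t :: ivec) i. 2 * pi * (real n * (of_int (t i) - \<alpha> i * of_int (t 1))))"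
  define JJ where "JJ p = Sigma (J p) (\<lambda>n. Sigma (Box n) (\<lambda>a. {t \<in> freq_box k a. nonzero_vec k t}))" for p
  have finJJ: "finite (JJ p)" for p unfolding JJ_def using J(1) finite_Box by (intro finite_SigmaI) auto
  \<comment> \<open>Removing the zero frequency subtracts the mean; what remains is a combination of
    characters in the free coordinates.\<close>
  have gsplit: "complex_of_real (\<psi> n * g a (\<theta> n x) - \<psi> n * cf a zv)
      = (\<Sum>t\<in>{t \<in> freq_box k a. nonzero_vec k t}. coef (n, a, t) * cis (\<Sum>i=2..k. freq (n, a, t) i * x i))" for n a x
  proof -
    let ?f = "\<lambda>t. of_real (cf a t) * character k t (\<theta> n x)"
    have set: "{t \<in> freq_box k a. nonzero_vec k t} = freq_box k a - {zv}"
      using nonzero_vec_iff[of _ k a] unfolding zv_def by blast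
    have "of_real (g a (\<theta> n x)) = ?f zv + (\<Sum>t\<in>freq_box k a - {zv}. ?f t)"
      unfolding gexp by (rule sum.remove[OF finite_freq_box zero_in_freq_box[of k a, folded zv_def]])
    moreover have "?f zv = of_real (cf a zv)" by (simp add: zv_def)
    ultimately have "complex_of_real (\<psi> n * g a (\<theta> n x) - \<psi> n * cf a zv) = of_real (\<psi> n) * (\<Sum>t\<in>freq_box k a - {zv}. ?f t)"
      by (simp add: algebra_simps)
    also have "... = (\<Sum>t\<in>freq_box k a - {zv}. coef (n, a, t) * cis (\<Sum>i=2..k. freq (n, a, t) i * x i))"
    proof (subst sum_distrib_left, intro sum.cong refl)
      fix t
      have "2 * pi * (\<Sum>i=1..k. of_int (t i) * \<theta> n x i) = ph (n, a, t) + (\<Sum>i=2..k. freq (n, a, t) i * x i)"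
        unfolding \<theta>_def phase_split[OF k1] ph_def freq_def by (simp add: distrib_left sum_distrib_left mult.assoc)
      thus "of_real (\<psi> n) * ?f t = coef (n, a, t) * cis (\<Sum>i=2..k. freq (n, a, t) i * x i)"
        unfolding coef_def by (simp add: cis_mult[symmetric])
    qed
    finally show ?thesis unfolding set .
  qed
  have FE: "(F p x - E p)\<^sup>2 = (cmod (\<Sum>j\<in>JJ p. coef j * cis (\<Sum>i\<in>{2..k}. freq j i * x i)))\<^sup>2" for p x
  proof -
    have "complex_of_real (F p x - E p) = (\<Sum>n\<in>J p. \<Sum>a\<in>Box n. complex_of_real (\<psi> n * g a (\<theta> n x) - \<psi> n * cf a zv))"
      unfolding F_def E_def by (simp add: sum_subtractf)
    also have "... = (\<Sum>j\<in>JJ p. coef j * cis (\<Sum>i\<in>{2..k}. freq j i * x i))"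
      unfolding gsplit JJ_def using J(1) finite_Box by (simp add: sum_over_Sigma)
    finally have "cmod (complex_of_real (F p x - E p)) = cmod (\<Sum>j\<in>JJ p. coef j * cis (\<Sum>i\<in>{2..k}. freq j i * x i))" by simp
    hence "\<bar>F p x - E p\<bar> = cmod (\<Sum>j\<in>JJ p. coef j * cis (\<Sum>i\<in>{2..k}. freq j i * x i))"
      unfolding norm_of_real .
    hence "\<bar>F p x - E p\<bar>\<^sup>2 = (cmod (\<Sum>j\<in>JJ p. coef j * cis (\<Sum>i\<in>{2..k}. freq j i * x i)))\<^sup>2" by simp
    thus ?thesis unfolding power2_abs .
  qed
  have \<theta>meas: "(\<lambda>x. \<theta> n x i) \<in> borel_measurable ?M" if "i \<in> {1..k}" for n i
    unfolding \<theta>_def using measurable_hyperplane_point_component[OF that, of \<alpha> d] by measurable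
  have gmeas: "(\<lambda>x. g a (\<theta> n x)) \<in> borel_measurable ?M" for n a
  proof -
    have "g a (\<theta> n x) = Re (\<Sum>t\<in>freq_box k a. of_real (cf a t) * character k t (\<theta> n x))" for x
      using arg_cong[OF gexp[of a "\<theta> n x"], of Re] by (simp only: complex.sel Re_complex_of_real)
    hence e: "(\<lambda>x. g a (\<theta> n x)) = (\<lambda>x. \<Sum>t\<in>freq_box k a. cf a t * cos (2 * pi * (\<Sum>i=1..k. of_int (t i) * \<theta> n x i)))"
      by (simp add: fun_eq_iff)
    have "(\<lambda>x. \<Sum>i=1..k. of_int (t i) * \<theta> n x i) \<in> borel_measurable ?M" for t :: ivec
      by (intro borel_measurable_sum borel_measurable_times \<theta>meas) auto
    note [measurable] = this
    show ?thesis unfolding e by measurable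
  qed
  have Fmeas: "F p \<in> borel_measurable ?M" for p
    unfolding F_def by (intro borel_measurable_sum borel_measurable_times gmeas) auto
  define K where "K = weight_mass {2..k} * (4 * (10 + 8 * 36 ^ k * C3))"
  have "AE x in ?M. \<forall>R :: nat. \<exists>p. real R < F p x"
  proof (rule unbounded_AE_of_variance[where K = K and m = m and E = E])
    show "F p \<in> borel_measurable ?M" for p by (rule Fmeas)
    show "(\<integral>\<^sup>+x. ennreal (weight_prod {2..k} x * (F p x - E p)\<^sup>2) \<partial>?M) \<le> ennreal (K * m p)" for p
    proof -
      have "(\<integral>\<^sup>+x. ennreal (weight_prod {2..k} x * (F p x - E p)\<^sup>2) \<partial>?M)
        \<le> ennreal (weight_mass {2..k} * (\<Sum>(j, l)\<in>{(j, l). j \<in> JJ p \<and> l \<in> JJ p \<and> (\<forall>i\<in>{2..k}. \<bar>freq j i - freq l i\<bar> < 1)}. cmod (coef j) * cmod (coef l)))"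
        unfolding FE by (rule weighted_square_integral_le[OF _ finJJ]) simp
      also have "... \<le> ennreal (weight_mass {2..k} * (4 * ((10 + 8 * 36 ^ k * C3) * (\<Sum>n\<in>J p. mass n))))"
        by (intro ennreal_leI mult_left_mono near_frequencies_le[where cf = cf and ph = ph, OF J(1) J(2) cf2 JJ_def] weight_mass_nonneg)
           (simp_all add: coef_def freq_def)
      also have "... = ennreal (K * m p)" unfolding K_def m_def by (simp only: mult.assoc)
      finally show ?thesis .
    qed
    show "m p / 2 \<le> E p" for p
    proof -
      have "m p / 2 = (\<Sum>n\<in>J p. \<Sum>a\<in>Box n. \<psi> n * (1 / 2))"
        unfolding m_def mass_def by (simp add: sum_divide_distrib mult.commute)
      also have "... \<le> E p"
        unfolding E_def
      proof (intro sum_mono mult_left_mono)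
        fix n a assume "n \<in> J p"
        thus "0 \<le> \<psi> n" using \<psi>pos J(2) by (meson less_imp_le subsetD)
      qed (rule cf0)
      finally show ?thesis .
    qed
    show "real p < m p" for p unfolding m_def by (rule J(3))
    show "0 \<le> K" unfolding K_def using weight_mass_nonneg C3 by simp
  qed
  thus ?thesis
  proof (rule AE_mp, intro AE_I2 impI)
    fix x assume ub: "\<forall>R :: nat. \<exists>p. real R < F p x"
    define D where "D = {n \<in> G. (\<Prod>i=1..k. nearest_int_dist (\<theta> n x i)) < \<psi> n}"
    have "infinite D"
    proof
      assume finD: "finite D"
      define h where "h n = (\<Sum>a\<in>Box n. \<psi> n * g a (\<theta> n x))" for n
      have "F p x \<le> (\<Sum>n\<in>D. \<bar>h n\<bar>)" for p
      proof -
        have "F p x = (\<Sum>n\<in>J p. h n)" unfolding F_def h_def ..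
        also have "... \<le> (\<Sum>n\<in>J p. if n \<in> D then \<bar>h n\<bar> else 0)"
        proof (rule sum_mono)
          fix n assume "n \<in> J p"
          hence n: "n \<in> G" using J(2) by blast
          show "h n \<le> (if n \<in> D then \<bar>h n\<bar> else 0)"
          proof (cases "n \<in> D")
            case False
            have "g a (\<theta> n x) \<le> 0" if "a \<in> Box n" for a
              using hit[OF n that] False n unfolding D_def by force
            hence "h n \<le> 0" unfolding h_def using \<psi>pos[OF n] by (intro sum_nonpos mult_nonneg_nonpos) auto
            thus ?thesis using False by simp
          qed simp
        qed
        also have "... = (\<Sum>n\<in>{n \<in> J p. n \<in> D}. \<bar>h n\<bar>)" by (rule sum.inter_filter[symmetric, OF J(1)])
        also have "... \<le> (\<Sum>n\<in>D. \<bar>h n\<bar>)" by (intro sum_mono2 finD) auto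
        finally show ?thesis .
      qed
      moreover obtain R :: nat where R: "(\<Sum>n\<in>D. \<bar>h n\<bar>) \<le> real R" using real_arch_simple by blast
      moreover obtain p where "real R < F p x" using ub by blast
      ultimately show False by (meson not_le order_trans)
    qed
    thus "infinite {n \<in> G. (\<Prod>i=1..k. nearest_int_dist (real n * hyperplane_point k \<alpha> d x i - y i)) < \<psi> n}"
      unfolding D_def \<theta>_def .
  qed
qed

end

section \<open>The induced measure on the hyperplane\<close>

lemma space_borel_PiM: "space (\<Pi>\<^sub>M i\<in>I. (borel :: real measure)) = (\<Pi>\<^sub>E i\<in>I. UNIV)"
  by (simp add: space_PiM)

lemma component_borel_measurable:
  "i \<in> I \<Longrightarrow> (\<lambda>x. x i) \<in> borel_measurable (\<Pi>\<^sub>M i\<in>I. (borel :: real measure))"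
  using measurable_component_singleton[of i I "\<lambda>_. borel"] by simp

lemma half_open_cube_sets: "half_open_cube k \<in> sets (\<Pi>\<^sub>M i\<in>{1..k}. borel)"
  unfolding half_open_cube_def by (rule sets_PiM_I_finite) auto

lemma hyperplane_sets:
  assumes "1 \<le> k"
  shows "hyperplane k \<alpha> d \<in> sets (\<Pi>\<^sub>M i\<in>{1..k}. borel)"
proof -
  have "(\<lambda>x. x 1 + (\<Sum>i=2..k. \<alpha> i * x i)) \<in> borel_measurable (\<Pi>\<^sub>M i\<in>{1..k}. (borel :: real measure))"
    using assms by (intro borel_measurable_add borel_measurable_sum borel_measurable_times component_borel_measurable) auto
  note [measurable] = this
  have "{x \<in> space (\<Pi>\<^sub>M i\<in>{1..k}. (borel :: real measure)). x 1 + (\<Sum>i=2..k. \<alpha> i * x i) = d} \<in> sets (\<Pi>\<^sub>M i\<in>{1..k}. borel)"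
    by measurable
  thus ?thesis unfolding hyperplane_def space_borel_PiM .
qed

lemma W_times_sets: "W_times k \<psi> y \<in> sets (\<Pi>\<^sub>M i\<in>{1..k}. borel)"
proof -
  let ?M = "\<Pi>\<^sub>M i\<in>{1..k}. (borel :: real measure)"
  have [measurable]: "nearest_int_dist \<in> borel_measurable borel"
    unfolding nearest_int_dist_def round_def by measurable
  have [measurable]: "(\<lambda>x. \<Prod>i=1..k. nearest_int_dist (real n * x i - y i)) \<in> borel_measurable ?M" for n
  proof (rule borel_measurable_prod)
    fix i assume "i \<in> {1..k}"
    note [measurable] = component_borel_measurable[OF this]
    show "(\<lambda>x. nearest_int_dist (real n * x i - y i)) \<in> borel_measurable ?M" by measurable
  qed
  define R where "R x \<longleftrightarrow> (\<forall>N. \<exists>n. N \<le> n \<and> 1 \<le> n \<and> (\<Prod>i=1..k. nearest_int_dist (real n * x i - y i)) < \<psi> n)" for x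
  have "{x \<in> space ?M. R x} \<in> sets ?M" unfolding R_def by measurable
  hence "half_open_cube k \<inter> {x \<in> space ?M. R x} \<in> sets ?M"
    by (rule sets.Int[OF half_open_cube_sets])
  moreover have "W_times k \<psi> y = half_open_cube k \<inter> {x \<in> space ?M. R x}"
  proof -
    have "infinite {n. n \<ge> 1 \<and> Q n} \<longleftrightarrow> (\<forall>N. \<exists>n. N \<le> n \<and> 1 \<le> n \<and> Q n)" for Q :: "nat \<Rightarrow> bool"
      unfolding infinite_nat_iff_unbounded_le by simp
    hence "infinite {n. n \<ge> 1 \<and> (\<Prod>i=1..k. nearest_int_dist (real n * x i - y i)) < \<psi> n} \<longleftrightarrow> R x" for x
      unfolding R_def .
    thus ?thesis
      unfolding W_times_def using sets.sets_into_space[OF half_open_cube_sets, of k] by blast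
  qed
  ultimately show ?thesis by simp
qed

lemma measurable_hyperplane_point:
  assumes "1 \<le> k"
  shows "hyperplane_point k \<alpha> d \<in> (lborel_prod {2..k}) \<rightarrow>\<^sub>M (\<Pi>\<^sub>M i\<in>{1..k}. borel)"
proof (rule measurable_PiM_single')
  show "(\<lambda>x. hyperplane_point k \<alpha> d x i) \<in> (lborel_prod {2..k}) \<rightarrow>\<^sub>M borel" if "i \<in> {1..k}" for i
    by (rule measurable_hyperplane_point_component[OF that])
  show "hyperplane_point k \<alpha> d \<in> space (lborel_prod {2..k}) \<rightarrow> (\<Pi>\<^sub>E i\<in>{1..k}. space borel)"
    using assms by (auto simp: space_PiM hyperplane_point_def PiE_iff extensional_def)
qed

text \<open>The graph map carries Lebesgue measure of the free coordinates to the surface measure up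
  to a constant factor, so null sets correspond. For the quotient of the two equal measures to be 1,
  they must also be finite: the free coordinates of a point of the section lie in the unit
  cube.\<close>

lemma full_induced_probability:
  assumes k: "1 \<le> k"
    and pos: "emeasure (hyperplane_lebesgue k \<alpha> d) (hyperplane k \<alpha> d \<inter> half_open_cube k) > 0"
    and W: "W \<in> sets (\<Pi>\<^sub>M i\<in>{1..k}. borel)"
    and AE: "AE x in (lborel_prod {2..k}). hyperplane_point k \<alpha> d x \<in> half_open_cube k \<longrightarrow> hyperplane_point k \<alpha> d x \<in> W"
  shows "emeasure (induced_probability k \<alpha> d) W = 1"
proof -
  let ?N = "lborel_prod {2..k}" and ?M = "\<Pi>\<^sub>M i\<in>{1..k}. (borel :: real measure)"
  let ?H = "hyperplane_point k \<alpha> d"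
  define s where "s = ennreal (sqrt (1 + (\<Sum>i=2..k. (\<alpha> i)\<^sup>2)))"
  define A where "A = hyperplane k \<alpha> d \<inter> half_open_cube k"
  have HL: "hyperplane_lebesgue k \<alpha> d = scale_measure s (distr ?N ?M ?H)"
    unfolding hyperplane_lebesgue_def s_def hyperplane_point_def ..
  note Hm [measurable] = measurable_hyperplane_point[OF k, of \<alpha> d]
  have A: "A \<in> sets ?M" unfolding A_def by (rule sets.Int[OF hyperplane_sets[OF k] half_open_cube_sets])
  have em: "emeasure (hyperplane_lebesgue k \<alpha> d) B = s * emeasure ?N (?H -` B \<inter> space ?N)" if "B \<in> sets ?M" for B
    unfolding HL emeasure_scale_measure emeasure_distr[OF Hm that] ..
  have AW: "A \<inter> W \<in> sets ?M" by (rule sets.Int[OF A W])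
  have "emeasure ?N (?H -` (A \<inter> W) \<inter> space ?N) = emeasure ?N (?H -` A \<inter> space ?N)"
  proof (rule emeasure_eq_AE)
    show "AE x in ?N. x \<in> ?H -` (A \<inter> W) \<inter> space ?N \<longleftrightarrow> x \<in> ?H -` A \<inter> space ?N"
      using AE
    proof eventually_elim
      case (elim x)
      thus ?case unfolding A_def vimage_Int by blast
    qed
  qed (rule measurable_sets[OF Hm AW] measurable_sets[OF Hm A])+
  hence same: "emeasure (hyperplane_lebesgue k \<alpha> d) (A \<inter> W) = emeasure (hyperplane_lebesgue k \<alpha> d) A"
    using em[OF A] em[OF AW] by simp
  have "emeasure ?N (?H -` A \<inter> space ?N) \<le> emeasure ?N (\<Pi>\<^sub>E i\<in>{2..k}. {0..<1})"
  proof (rule emeasure_mono)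
    show "?H -` A \<inter> space ?N \<subseteq> (\<Pi>\<^sub>E i\<in>{2..k}. {0..<1})"
    proof
      fix x assume x: "x \<in> ?H -` A \<inter> space ?N"
      have "x i \<in> {0..<1}" if i: "i \<in> {2..k}" for i
      proof -
        have "?H x \<in> half_open_cube k" using x unfolding A_def by simp
        moreover have "i \<in> {1..k}" using i by simp
        ultimately have "?H x i \<in> {0..<1}" unfolding half_open_cube_def by (rule PiE_mem)
        thus ?thesis using i by (simp add: hyperplane_point_def)
      qed
      thus "x \<in> (\<Pi>\<^sub>E i\<in>{2..k}. {0..<1})" using x by (simp add: space_PiM PiE_iff)
    qed
    show "(\<Pi>\<^sub>E i\<in>{2..k}. {0..<1}) \<in> sets ?N" by (rule sets_PiM_I_finite) auto
  qed
  also have "... = (\<Prod>i\<in>{2..k}. emeasure lborel {0..<1 :: real})"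
    by (rule lborel_product.emeasure_PiM) auto
  also have "... = 1" by simp
  finally have "emeasure (hyperplane_lebesgue k \<alpha> d) A \<le> s * 1"
    unfolding em[OF A] by (rule mult_left_mono) simp
  also have "s * 1 < top" unfolding s_def by simp
  finally have fin: "emeasure (hyperplane_lebesgue k \<alpha> d) A < top" .
  have sets: "sets (hyperplane_lebesgue k \<alpha> d) = sets ?M" unfolding HL by simp
  have "emeasure (induced_probability k \<alpha> d) W
     = emeasure (hyperplane_lebesgue k \<alpha> d) (A \<inter> W) / emeasure (hyperplane_lebesgue k \<alpha> d) A"
    unfolding induced_probability_def A_def[symmetric] using A W by (intro emeasure_uniform_measure) (simp_all only: sets)
  also have "... = 1"
    unfolding same using pos[folded A_def] by (intro ennreal_divide_self fin) simp
  finally show ?thesis .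
qed

section \<open>Choice of the exponents and conclusion\<close>

lemma exponent_gap:
  assumes "ereal (real k) > 4 + 2 * max_pair_exponent k \<alpha>"
  obtains w where "max_pair_exponent k \<alpha> < ereal w" "0 < w" "4 + 2 * w < real k"
proof -
  let ?D = "{dual_exponent [\<alpha> i, \<alpha> j] | i j. 2 \<le> i \<and> i < j \<and> j \<le> k}"
  have "?D \<subseteq> (\<lambda>(i, j). dual_exponent [\<alpha> i, \<alpha> j]) ` ({..k} \<times> {..k})" by auto
  hence "finite ?D" by (rule finite_subset) simp
  hence m0: "0 \<le> max_pair_exponent k \<alpha>" unfolding max_pair_exponent_def by (intro Max_ge) auto
  obtain r where r: "max_pair_exponent k \<alpha> = ereal r" "0 \<le> r" "4 + 2 * r < real k"
  proof -
    have "(4 :: ereal) = ereal 4" "(2 :: ereal) = ereal 2" by simp_all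
    hence less: "ereal 4 + ereal 2 * max_pair_exponent k \<alpha> < ereal (real k)" using assms by simp
    show thesis
    proof (cases "max_pair_exponent k \<alpha>")
      case (real r)
      thus thesis using less m0 that[of r] by simp
    next
      case PInf
      thus thesis using less by simp
    next
      case MInf
      thus thesis using m0 by simp
    qed
  qed
  \<comment> \<open>The witness is the midpoint between the maximal dual exponent r and (k -
    4)/2.\<close>
  show thesis
    by (rule that[of "r / 2 + real k / 4 - 1"]) (use r in auto)
qed

theorem mainTheorem4:
  fixes k :: nat and \<alpha> y :: "nat \<Rightarrow> real" and c :: real and \<psi> :: "nat \<Rightarrow> real"
  assumes "k \<ge> 2"
    and "emeasure (hyperplane_lebesgue k \<alpha> c) (hyperplane k \<alpha> c \<inter> half_open_cube k) > 0"
    and "\<And>n. n \<ge> 1 \<Longrightarrow> \<psi> n \<in> {0..<1}"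
    and "\<And>m n. 1 \<le> m \<Longrightarrow> m \<le> n \<Longrightarrow> \<psi> n \<le> \<psi> m"
    and "\<not> summable (\<lambda>n. \<psi> (Suc n) * ln (real (Suc n)) ^ (k - 1))"
    and "ereal (real k) > 4 + 2 * max_pair_exponent k \<alpha>"
  shows "emeasure (induced_probability k \<alpha> c) (W_times k \<psi> y) = 1"
proof -
  obtain w where w: "max_pair_exponent k \<alpha> < ereal w" "0 < w" "4 + 2 * w < real k"
    by (rule exponent_gap[OF assms(6)])
  have k5: "5 \<le> k" using w(2,3) by linarith
  hence k1: "1 \<le> k" and k0: "0 < real k" by auto
  obtain b where b: "0 < b" and bad: "badly_approximable_pairs k \<alpha> b w"
    by (rule badly_approximable[OF w(1)])
  define A where "A = (\<Sum>i=2..k. \<bar>\<alpha> i\<bar>)"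
  have A0: "0 \<le> A" unfolding A_def by (simp add: sum_nonneg)
  have A: "\<bar>\<alpha> i\<bar> \<le> A" if "i \<in> {2..k}" for i
    unfolding A_def using that by (intro member_le_sum) auto
  \<comment> \<open>\<open>\<tau> > 1 / k\<close> leaves enough boxes; the upper bounds make the error terms of the variance
    (diagonal and off-diagonal, respectively) negligible.\<close>
  have "1 / real k < min (1 / (real k - 1)) (1 / (2 * w + 4))"
    using w(2,3) k5 by (simp add: frac_less2)
  from dense[OF this] obtain \<tau> where \<tau>: "1 / real k < \<tau>" "\<tau> < min (1 / (real k - 1)) (1 / (2 * w + 4))"
    by blast
  have \<tau>0: "0 < \<tau>" using \<tau>(1) k0 by (meson divide_pos_pos less_trans zero_less_one)
  have \<tau>k: "1 < real k * \<tau>" using \<tau>(1) k0 by (simp add: field_simps)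
  have \<tau>k': "\<tau> * (real k - 1) < 1" using \<tau>(2) k5 by (simp add: pos_less_divide_eq)
  have \<tau>w: "\<tau> * (2 * w + 4) < 1" using \<tau>(2) w(2) by (simp add: pos_less_divide_eq)
  have \<tau>1: "\<tau> \<le> 1"
  proof -
    have "\<tau> * 1 \<le> \<tau> * (real k - 1)" using \<tau>0 k5 by (intro mult_left_mono) auto
    thus ?thesis using \<tau>k' by linarith
  qed
  define \<kappa> where "\<kappa> = (real k * \<tau> - 1) / 3"
  have \<kappa>: "0 < \<kappa>" unfolding \<kappa>_def using \<tau>k by simp
  \<comment> \<open>The factor 4 is what taking the least integer exponent \<open>S n\<close> below
    can lose against k^k/\<phi>(n).\<close>
  define C3 where "C3 = 4 * real k ^ k"
  have kk1: "1 \<le> real k ^ k" using k1 by (intro one_le_power) auto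
  have C3: "1 \<le> C3" unfolding C3_def using kk1 by simp
  \<comment> \<open>Solutions for \<phi> are solutions for \<psi>. The truncation at 1/n supplies
    the weight 1/m of the off-diagonal count and makes 4^(S(n)) at least n, the lower bound on S
    under which the boxes were counted.\<close>
  define \<phi> where "\<phi> n = min (\<psi> n) (1 / real n)" for n
  define S where "S n = (LEAST j. real k ^ k / \<phi> n \<le> 4 ^ j)" for n
  obtain c1 where c1: "0 < c1" and c1ev: "\<forall>\<^sub>F n in sequentially. \<forall>S. real n \<le> 4 ^ S \<and> 4 ^ S \<le> C3 * real n powr (1 + \<kappa>)
        \<longrightarrow> c1 * ln (real n) ^ (k - 1) \<le> real (card (scale_box k \<tau> S n))"
    using card_scale_box_eventually_ge[OF assms(1) \<tau>1 \<tau>k \<kappa>_def C3] by blast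
  obtain N0 where N0: "1 \<le> N0"
    and gr: "\<And>n. N0 \<le> n \<Longrightarrow> growth_ok k w b A \<tau> n"
    and boxes: "\<And>n S. N0 \<le> n \<Longrightarrow> real n \<le> 4 ^ S \<Longrightarrow> 4 ^ S \<le> C3 * real n powr (1 + \<kappa>)
        \<Longrightarrow> c1 * ln (real n) ^ (k - 1) \<le> real (card (scale_box k \<tau> S n))"
  proof -
    from eventually_conj[OF growth_eventually[OF k5 w(2) b A0 \<tau>0 \<tau>k' \<tau>w] c1ev, unfolded eventually_sequentially]
    obtain N where N: "\<And>n. N \<le> n \<Longrightarrow> growth_ok k w b A \<tau> n \<and> (\<forall>S. real n \<le> 4 ^ S \<and> 4 ^ S \<le> C3 * real n powr (1 + \<kappa>)
        \<longrightarrow> c1 * ln (real n) ^ (k - 1) \<le> real (card (scale_box k \<tau> S n)))"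
      by auto
    show thesis
      by (rule that[of "max 1 N"]) (use N in auto)
  qed
  define G where "G = {n. N0 \<le> n \<and> real n powr (- 1 - \<kappa>) \<le> \<phi> n}"
  have G1: "1 \<le> n" if "n \<in> G" for n using that N0 unfolding G_def by simp
  have \<phi>pos: "0 < \<phi> n" if "n \<in> G" for n
  proof -
    have "0 < real n powr (- 1 - \<kappa>)" using G1[OF that] by simp
    also have "... \<le> \<phi> n" using that unfolding G_def by blast
    finally show ?thesis .
  qed
  have \<phi>le: "\<phi> n \<le> 1 / real n" for n unfolding \<phi>_def by simp
  have Sge: "real k ^ k / \<phi> n \<le> 4 ^ S n" for n
  proof -
    obtain j where "real k ^ k / \<phi> n < 4 ^ j" using real_arch_pow[of 4 "real k ^ k / \<phi> n"] by auto
    hence "real k ^ k / \<phi> n \<le> 4 ^ j" by simp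
    thus ?thesis unfolding S_def by (rule LeastI)
  qed
  have Sle: "4 ^ S n \<le> C3 / \<phi> n" if n: "n \<in> G" for n
  proof (cases "S n")
    case 0
    have "1 / real n \<le> 1" using G1[OF n] by simp
    hence "\<phi> n \<le> 1" using \<phi>le[of n] by linarith
    thus ?thesis using 0 \<phi>pos[OF n] C3 by simp
  next
    case (Suc j)
    hence "\<not> real k ^ k / \<phi> n \<le> 4 ^ j" unfolding S_def by (intro not_less_Least) simp
    thus ?thesis using Suc unfolding C3_def by simp
  qed
  interpret variance_setup k \<alpha> \<phi> b w A \<tau> C3 S G
  proof
    show "growth_ok k w b A \<tau> n" if "n \<in> G" for n using gr that unfolding G_def by blast
    show "0 \<le> \<tau>" "0 < C3" using \<tau>0 C3 by linarith+
  qed ((rule k5 w(2) b \<tau>1 bad A G1 \<phi>pos \<phi>le Sle; assumption)+)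
  have \<psi>0: "0 \<le> \<psi> n" if "1 \<le> n" for n using assms(3)[OF that] by simp
  have unb: "\<exists>J. finite J \<and> J \<subseteq> G \<and> M < (\<Sum>n\<in>J. mass n)" for M :: real
  proof -
    obtain J where J: "finite J" "J \<subseteq> {n. N0 \<le> n \<and> real n powr (- 1 - \<kappa>) \<le> \<phi> n}"
      "M / c1 < (\<Sum>n\<in>J. \<phi> n * ln (real n) ^ (k - 1))"
      by (rule truncated_divergence[OF \<psi>0 assms(4) assms(5) \<kappa> N0 \<phi>_def, of "M / c1"]) (assumption | rule that)+
    have JG: "J \<subseteq> G" using J(2) unfolding G_def .
    have "M < c1 * (\<Sum>n\<in>J. \<phi> n * ln (real n) ^ (k - 1))" using J(3) c1 by (simp add: divide_less_eq mult.commute)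
    also have "... = (\<Sum>n\<in>J. \<phi> n * (c1 * ln (real n) ^ (k - 1)))" by (simp add: sum_distrib_left mult.left_commute)
    also have "... \<le> (\<Sum>n\<in>J. mass n)"
    proof (rule sum_mono)
      fix n assume "n \<in> J"
      hence n: "n \<in> G" using JG by blast
      have "real n \<le> real k ^ k / \<phi> n"
      proof -
        have "real n * \<phi> n \<le> real n * (1 / real n)" using \<phi>le by (intro mult_left_mono) auto
        also have "... \<le> real k ^ k" using kk1 G1[OF n] by simp
        finally show ?thesis using \<phi>pos[OF n] by (simp add: pos_le_divide_eq)
      qed
      hence lo: "real n \<le> 4 ^ S n" using Sge[of n] by linarith
      have "C3 / \<phi> n \<le> C3 / real n powr (- 1 - \<kappa>)"
        using n G1[OF n] C3 \<phi>pos[OF n] unfolding G_def by (intro divide_left_mono) auto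
      also have "... = C3 * real n powr (1 + \<kappa>)"
      proof -
        have "- 1 - \<kappa> = - (1 + \<kappa>)" by simp
        thus ?thesis by (simp only: powr_minus divide_inverse inverse_inverse_eq)
      qed
      finally have hi: "4 ^ S n \<le> C3 * real n powr (1 + \<kappa>)" using Sle[OF n] by linarith
      have "N0 \<le> n" using n unfolding G_def by simp
      from boxes[OF this lo hi] show "\<phi> n * (c1 * ln (real n) ^ (k - 1)) \<le> mass n"
        unfolding mass_def using \<phi>pos[OF n] by (intro mult_left_mono) auto
    qed
    finally show ?thesis using J(1) JG by blast
  qed
  have AE: "AE x in (lborel_prod {2..k}). infinite {n \<in> G.
    (\<Prod>i=1..k. nearest_int_dist (real n * hyperplane_point k \<alpha> c x i - y i)) < \<phi> n}"
    by (rule AE_infinitely_often[OF Sge unb])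
  show ?thesis
  proof (rule full_induced_probability[OF k1 assms(2) W_times_sets])
    show "AE x in (lborel_prod {2..k}). hyperplane_point k \<alpha> c x \<in> half_open_cube k \<longrightarrow> hyperplane_point k \<alpha> c x \<in> W_times k \<psi> y"
      using AE
    proof (rule AE_mp, intro AE_I2 impI)
      fix x assume inf: "infinite {n \<in> G. (\<Prod>i=1..k. nearest_int_dist (real n * hyperplane_point k \<alpha> c x i - y i)) < \<phi> n}"
        and cube: "hyperplane_point k \<alpha> c x \<in> half_open_cube k"
      have "{n \<in> G. (\<Prod>i=1..k. nearest_int_dist (real n * hyperplane_point k \<alpha> c x i - y i)) < \<phi> n}
        \<subseteq> {n. n \<ge> 1 \<and> (\<Prod>i=1..k. nearest_int_dist (real n * hyperplane_point k \<alpha> c x i - y i)) < \<psi> n}"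
        using G1 unfolding \<phi>_def by auto
      hence "infinite {n. n \<ge> 1 \<and> (\<Prod>i=1..k. nearest_int_dist (real n * hyperplane_point k \<alpha> c x i - y i)) < \<psi> n}"
        using inf infinite_super by blast
      thus "hyperplane_point k \<alpha> c x \<in> W_times k \<psi> y" unfolding W_times_def using cube by blast
    qed
  qed
qed

end
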